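(* Let $X_1,\dots,X_n$ be i.i.d. random vectors in $\mathbb{R}^p$ with distribution $N_p(\boldsymbol\mu,\Sigma)$, where $\Sigma$ is an unknown positive definite covariance matrix. The data are split evenly over $k$ machines: $\{1,\dots,n\}=S_1\cup\dots\cup S_k$ (disjoint), $|S_l|=n_l=n/k$ for every $l$. For each $l$, let $\bar X_l=n_l^{-1}\sum_{i\in S_l}X_i$, $\hat\Sigma_l=n_l^{-1}\sum_{i\in S_l}(X_i-\bar X_l)(X_i-\bar X_l)^\top$, and $$T_l^2=(n_l-1)(\bar X_l-\boldsymbol\mu_0)^\top\hat\Sigma_l^{-1}(\bar X_l-\boldsymbol\mu_0),\qquad T_{dis,n}^2=\frac{1}{k\sqrt p}\sum_{l=1}^k T_l^2,$$ where $\boldsymbol\mu_0\in\mathbb{R}^p$ is a given vector. Here $k=k_n$ and $p=p_n$ depend on $n$, and assume: $\gamma_n:=pk/n<1$, $\gamma_n\to r\in[0,1)$ as $n\to\infty$, and $n_l=n/k\to\infty$ as $n\to\infty$. Suppose the null hypothesis $H_0:\boldsymbol\mu=\boldsymbol\mu_0$ holds. Then, as $k\to\infty$, $$\sqrt k\left(T_{dis,n}^2-\frac{(n/k-1)\sqrt p}{n/k-p-2}\right)\xrightarrow{d} N\!\left(0,\frac{2}{(1-r)^3}\right).$$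
   Context: This concerns testing $H_0:\boldsymbol\mu=\boldsymbol\mu_0$ versus $H_1:\boldsymbol\mu\neq\boldsymbol\mu_0$ in a distributed setting where the $k$ machines each compute a local Hotelling $T^2$ statistic $T_l^2$ and only these scalars are pooled. $\xrightarrow{d}$ denotes convergence in distribution. *)

theory Defs
  imports "HOL-Probability.Probability"
begin

text \<open>Vectors of R^p are represented as functions nat => real, of which only the
components 0..p-1 are used; p x p matrices as nat => nat => real, entries (i,j) with i,j < p.\<close>

definition vdot :: "nat \<Rightarrow> (nat \<Rightarrow> real) \<Rightarrow> (nat \<Rightarrow> real) \<Rightarrow> real" where
  "vdot p a x = (\<Sum>c<p. a c * x c)"

definition quad_form :: "nat \<Rightarrow> (nat \<Rightarrow> nat \<Rightarrow> real) \<Rightarrow> (nat \<Rightarrow> real) \<Rightarrow> real" where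
  "quad_form p A v = (\<Sum>c<p. \<Sum>d<p. v c * A c d * v d)"

definition pos_def_mat :: "nat \<Rightarrow> (nat \<Rightarrow> nat \<Rightarrow> real) \<Rightarrow> bool" where
  "pos_def_mat p A \<longleftrightarrow> (\<forall>i<p. \<forall>j<p. A i j = A j i) \<and>
     (\<forall>v. (\<exists>c<p. v c \<noteq> 0) \<longrightarrow> quad_form p A v > 0)"

text \<open>Inverse of a p x p matrix (entries outside the p x p block are 0);
unspecified if the matrix is singular.\<close>
definition mat_inv :: "nat \<Rightarrow> (nat \<Rightarrow> nat \<Rightarrow> real) \<Rightarrow> (nat \<Rightarrow> nat \<Rightarrow> real)" where
  "mat_inv p A = (THE B. (\<forall>i j. (p \<le> i \<or> p \<le> j) \<longrightarrow> B i j = 0) \<and>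
     (\<forall>i<p. \<forall>j<p. (\<Sum>m<p. A i m * B m j) = (if i = j then 1 else 0)) \<and>
     (\<forall>i<p. \<forall>j<p. (\<Sum>m<p. B i m * A m j) = (if i = j then 1 else 0)))"

definition mvnormal :: "'a measure \<Rightarrow> nat \<Rightarrow> ('a \<Rightarrow> nat \<Rightarrow> real) \<Rightarrow> (nat \<Rightarrow> real)
     \<Rightarrow> (nat \<Rightarrow> nat \<Rightarrow> real) \<Rightarrow> bool" where
  "mvnormal M p X \<mu> \<Sigma> \<longleftrightarrow>
     (\<forall>a. (\<exists>c<p. a c \<noteq> 0) \<longrightarrow>
        distributed M lborel (\<lambda>\<omega>. vdot p a (X \<omega>))
          (normal_density (vdot p a \<mu>) (sqrt (quad_form p \<Sigma> a))))"

definition sample_mean :: "nat set \<Rightarrow> (nat \<Rightarrow> nat \<Rightarrow> real) \<Rightarrow> nat \<Rightarrow> real" where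
  "sample_mean S x c = (\<Sum>i\<in>S. x i c) / real (card S)"

definition sample_cov :: "nat set \<Rightarrow> (nat \<Rightarrow> nat \<Rightarrow> real) \<Rightarrow> nat \<Rightarrow> nat \<Rightarrow> real" where
  "sample_cov S x c d =
     (\<Sum>i\<in>S. (x i c - sample_mean S x c) * (x i d - sample_mean S x d)) / real (card S)"

definition hotelling_T2 :: "nat \<Rightarrow> nat set \<Rightarrow> (nat \<Rightarrow> real) \<Rightarrow> (nat \<Rightarrow> nat \<Rightarrow> real) \<Rightarrow> real" where
  "hotelling_T2 p S \<mu>0 x =
     (real (card S) - 1) *
       quad_form p (mat_inv p (sample_cov S x)) (\<lambda>c. sample_mean S x c - \<mu>0 c)"

definition T2_dis :: "nat \<Rightarrow> nat \<Rightarrow> (nat \<Rightarrow> nat set) \<Rightarrow> (nat \<Rightarrow> real) \<Rightarrow> (nat \<Rightarrow> nat \<Rightarrow> real) \<Rightarrow> real" where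
  "T2_dis p k S \<mu>0 x = (\<Sum>l<k. hotelling_T2 p (S l) \<mu>0 x) / (real k * sqrt (real p))"

end

theory Submission
  imports Defs "Jordan_Normal_Form.Determinant" "HOL-Real_Asymp.Real_Asymp"
begin

text \<open>Put the \<open>m\<close> centred observations of one machine into an \<open>m \<times> p\<close> matrix. By Sherman--Morrison,
  \<open>T\<^sup>2 / (m - 1) = R / (1 - R)\<close>, where \<open>R\<close> is the squared cosine of the angle between the vector
  \<open>(1, \<dots>, 1)\<close> and the column space. The law of the matrix is invariant under rotations of \<open>\<real>\<^sup>m\<close>
  (the joint characteristic function is), so \<open>(1, \<dots>, 1)\<close> may be replaced by an independent standard Gaussian
  vector; conditionally on the column space, \<open>R / (1 - R)\<close> then is a ratio of independent chi-square variables with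
  \<open>p\<close> and \<open>m - p\<close> degrees of freedom. Its mean and variance are explicit, and its fourth central
  moment stays bounded after scaling, so a characteristic function argument for row-wise i.i.d. triangular arrays applies.\<close>

section \<open>Inverse matrices\<close>

text \<open>The scheme works because \<open>mvnormal\<close> prescribes the law of every nontrivial
  linear functional, so the joint characteristic function of a data matrix is available at once;
  rotation invariance is then an identity between exponents, and neither a matrix density nor the
  Wishart law enters. The price is a uniqueness theorem for joint characteristic functions, derived
  from the one-dimensional one. Exceptional sets remain, because \<open>mat_inv\<close> is
  unspecified on singular matrices and the angle may degenerate; they are shown to be null. The
  centring constant of the theorem is the exact mean of \<open>T\<^sup>2 / sqrt p\<close>: a
  reciprocal chi-square with \<open>q\<close> degrees of freedom has mean
  \<open>1 / (q - 2)\<close>, and here \<open>q = m - p\<close>. With \<open>N = m - p - 2\<close>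
  the variance is \<open>2 * (m - 1)\<^sup>2 * (m - 2) / (N\<^sup>2 * (N - 2))\<close>, which tends
  to \<open>2 / (1 - r) ^ 3\<close> when \<open>p / m\<close> tends to \<open>r\<close>. Asymptotic
  normality comes from averaging over the \<open>k\<close> machines alone: \<open>p\<close> may stay
  bounded, so no limit theorem helps inside one machine, and fourth moments must be bounded
  uniformly in \<open>p\<close>.\<close>

definition nonsing :: "nat \<Rightarrow> (nat \<Rightarrow> nat \<Rightarrow> real) \<Rightarrow> bool" where
  "nonsing p A \<longleftrightarrow> det (mat p p (\<lambda>(i, j). A i j)) \<noteq> 0"

lemma nonsing_iff:
  "nonsing p A \<longleftrightarrow> (\<forall>a. (\<forall>i<p. (\<Sum>j<p. A i j * a j) = 0) \<longrightarrow> (\<forall>j<p. a j = 0))"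
proof -
  let ?A = "mat p p (\<lambda>(i, j). A i j)"
  have A: "?A \<in> carrier_mat p p" by simp
  have mv: "?A *\<^sub>v vec p a = 0\<^sub>v p \<longleftrightarrow> (\<forall>i<p. (\<Sum>j<p. A i j * a j) = 0)" for a
    by (auto simp: vec_eq_iff scalar_prod_def atLeast0LessThan)
  have z: "vec p a = 0\<^sub>v p \<longleftrightarrow> (\<forall>j<p. a j = 0)" for a :: "nat \<Rightarrow> real"
    by (auto simp: vec_eq_iff)
  have "det ?A = 0 \<longleftrightarrow> (\<exists>a. vec p a \<noteq> 0\<^sub>v p \<and> ?A *\<^sub>v vec p a = 0\<^sub>v p)"
    unfolding det_0_iff_vec_prod_zero[OF A]
  proof safe
    fix v :: "real vec" assume v: "v \<in> carrier_vec p" "v \<noteq> 0\<^sub>v p" "?A *\<^sub>v v = 0\<^sub>v p"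
    have "vec p (\<lambda>i. v $ i) = v" using v(1) by auto
    with v show "\<exists>a. vec p a \<noteq> 0\<^sub>v p \<and> ?A *\<^sub>v vec p a = 0\<^sub>v p" by metis
  next
    fix a :: "nat \<Rightarrow> real" assume "vec p a \<noteq> 0\<^sub>v p" "?A *\<^sub>v vec p a = 0\<^sub>v p"
    then show "\<exists>v. v \<in> carrier_vec p \<and> v \<noteq> 0\<^sub>v p \<and> ?A *\<^sub>v v = 0\<^sub>v p"
      by (intro exI[of _ "vec p a"]) simp
  qed
  then show ?thesis unfolding nonsing_def mv z by blast
qed

lemma nonsingD:
  assumes "nonsing p A" "\<And>i. i < p \<Longrightarrow> (\<Sum>j<p. A i j * a j) = 0" "j < p"
  shows "a j = 0"
  using assms unfolding nonsing_iff by blast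

text \<open>The adjugate divided by the determinant. Being rational in the entries of
  \<open>A\<close>, this formula gives measurability, which the definite description in
  \<open>mat_inv\<close> does not show.\<close>

definition inv_entry :: "nat \<Rightarrow> (nat \<Rightarrow> nat \<Rightarrow> real) \<Rightarrow> nat \<Rightarrow> nat \<Rightarrow> real" where
  "inv_entry p A i j = (if i < p \<and> j < p
     then cofactor (mat p p (\<lambda>(i, j). A i j)) j i / det (mat p p (\<lambda>(i, j). A i j)) else 0)"

lemma inv_entry:
  assumes "nonsing p A" "i < p" "j < p"
  shows "(\<Sum>m<p. A i m * inv_entry p A m j) = (if i = j then 1 else 0)"
    and "(\<Sum>m<p. inv_entry p A i m * A m j) = (if i = j then 1 else 0)"
proof -
  let ?A = "mat p p (\<lambda>(i, j). A i j)"
  have A: "?A \<in> carrier_mat p p" by simp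
  have d: "det ?A \<noteq> 0" using assms by (simp add: nonsing_def)
  have ind: "(M * N) $$ (i, j) = (\<Sum>m<p. M $$ (i, m) * N $$ (m, j))"
    if "M \<in> carrier_mat p p" "N \<in> carrier_mat p p" for M N :: "real mat"
    using that assms by (auto simp: scalar_prod_def atLeast0LessThan)
  have adj: "adj_mat ?A $$ (a, b) = cofactor ?A b a" if "a < p" "b < p" for a b
    using that by (simp add: adj_mat_def)
  have "(?A * adj_mat ?A) $$ (i, j) = (det ?A \<cdot>\<^sub>m 1\<^sub>m p) $$ (i, j)"
    using adj_mat(2)[OF A] by simp
  then have "(\<Sum>m<p. A i m * cofactor ?A j m) = det ?A * (if i = j then 1 else 0)"
    using assms unfolding ind[OF A adj_mat(1)[OF A]] by (simp add: adj cong: sum.cong_simp)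
  then show "(\<Sum>m<p. A i m * inv_entry p A m j) = (if i = j then 1 else 0)"
    using assms d by (simp add: inv_entry_def sum_divide_distrib[symmetric] cong: sum.cong_simp)
  have "(adj_mat ?A * ?A) $$ (i, j) = (det ?A \<cdot>\<^sub>m 1\<^sub>m p) $$ (i, j)"
    using adj_mat(3)[OF A] by simp
  then have "(\<Sum>m<p. cofactor ?A m i * A m j) = det ?A * (if i = j then 1 else 0)"
    using assms unfolding ind[OF adj_mat(1)[OF A] A] by (simp add: adj cong: sum.cong_simp)
  then show "(\<Sum>m<p. inv_entry p A i m * A m j) = (if i = j then 1 else 0)"
    using assms d by (simp add: inv_entry_def sum_divide_distrib[symmetric] cong: sum.cong_simp)
qed

lemma mat_inv_nonsing:
  assumes "nonsing p A"
  shows "mat_inv p A = inv_entry p A"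
  unfolding mat_inv_def
proof (rule the_equality)
  show "(\<forall>i j. p \<le> i \<or> p \<le> j \<longrightarrow> inv_entry p A i j = 0) \<and>
    (\<forall>i<p. \<forall>j<p. (\<Sum>m<p. A i m * inv_entry p A m j) = (if i = j then 1 else 0)) \<and>
    (\<forall>i<p. \<forall>j<p. (\<Sum>m<p. inv_entry p A i m * A m j) = (if i = j then 1 else 0))"
    using inv_entry[OF assms] by (auto simp: inv_entry_def)
next
  fix B assume B: "(\<forall>i j. p \<le> i \<or> p \<le> j \<longrightarrow> B i j = 0) \<and>
    (\<forall>i<p. \<forall>j<p. (\<Sum>m<p. A i m * B m j) = (if i = j then 1 else 0)) \<and>
    (\<forall>i<p. \<forall>j<p. (\<Sum>m<p. B i m * A m j) = (if i = j then 1 else 0))"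
  show "B = inv_entry p A"
  proof (intro ext)
    fix i j
    show "B i j = inv_entry p A i j"
    proof (cases "i < p \<and> j < p")
      case True
      \<comment> \<open>Uniqueness column by column: the difference of the two \<open>j\<close>-th
        columns lies in the kernel of \<open>A\<close>.\<close>
      have "(\<Sum>m<p. A l m * (B m j - inv_entry p A m j)) = 0" if "l < p" for l
        using B inv_entry(1)[OF assms, of l j] True that
        by (simp add: right_diff_distrib sum_subtractf)
      from nonsingD[OF assms this, of i] True show ?thesis by simp
    next
      case False
      then show ?thesis using B by (auto simp: inv_entry_def)
    qed
  qed
qed

text \<open>On singular matrices \<open>mat_inv\<close> is an unspecified but constant matrix, so statistics built
  from it stay measurable there.\<close>
lemma mat_inv_singular:
  assumes "\<not> nonsing p A"
  shows "mat_inv p A = (THE B. False)"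
proof -
  from assms obtain a j where a: "\<And>i. i < p \<Longrightarrow> (\<Sum>j<p. A i j * a j) = 0" "j < p" "a j \<noteq> 0"
    unfolding nonsing_iff by blast
  \<comment> \<open>A kernel vector \<open>a\<close> rules out a left inverse, as
    \<open>a = B (A a) = 0\<close> would follow. So the predicate under \<open>THE\<close> is
    \<open>False\<close> for every \<open>B\<close>, and is the same one for all singular
    \<open>A\<close>.\<close>
  have "\<not> ((\<forall>i<p. \<forall>j<p. (\<Sum>m<p. B i m * A m j) = (if i = j then 1 else 0)))" for B
  proof
    assume B: "\<forall>i<p. \<forall>j<p. (\<Sum>m<p. B i m * A m j) = (if i = j then 1 else 0)"
    have "a j = (\<Sum>l<p. (if j = l then 1 else 0) * a l)"
      using a(2) by (simp add: if_distrib[of "\<lambda>x. x * _"] cong: if_cong)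
    also have "\<dots> = (\<Sum>l<p. (\<Sum>m<p. B j m * A m l) * a l)"
      using B a(2) by (intro sum.cong) auto
    also have "\<dots> = (\<Sum>m<p. B j m * (\<Sum>l<p. A m l * a l))"
      unfolding sum_distrib_left sum_distrib_right mult.assoc by (rule sum.swap)
    also have "\<dots> = 0" using a(1) by simp
    finally show False using a(3) by simp
  qed
  then show ?thesis unfolding mat_inv_def by (intro arg_cong[of _ _ The] ext) (simp only: simp_thms)
qed

text \<open>Solving one linear system replaces every computation with entries of the inverse: later
  proofs only exhibit \<open>w\<close>.\<close>

lemma quad_form_mat_inv:
  assumes "nonsing p A" "\<And>i. i < p \<Longrightarrow> (\<Sum>j<p. A i j * w j) = v i"
  shows "quad_form p (mat_inv p A) v = vdot p v w"
proof -
  have w: "(\<Sum>j<p. inv_entry p A i j * v j) = w i" if i: "i < p" for i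
  proof -
    have "(\<Sum>j<p. inv_entry p A i j * v j) = (\<Sum>j<p. inv_entry p A i j * (\<Sum>l<p. A j l * w l))"
      using assms(2) by simp
    also have "\<dots> = (\<Sum>l<p. (\<Sum>j<p. inv_entry p A i j * A j l) * w l)"
      unfolding sum_distrib_left sum_distrib_right mult.assoc by (rule sum.swap)
    also have "\<dots> = (\<Sum>l<p. (if i = l then 1 else 0) * w l)"
      using inv_entry(2)[OF assms(1) i] by (intro sum.cong) auto
    also have "\<dots> = w i" using i by (simp add: if_distrib[of "\<lambda>x. x * _"] cong: if_cong)
    finally show ?thesis .
  qed
  have "quad_form p (mat_inv p A) v = (\<Sum>c<p. v c * (\<Sum>d<p. inv_entry p A c d * v d))"
    by (simp add: quad_form_def mat_inv_nonsing[OF assms(1)] sum_distrib_left mult.assoc)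
  also have "\<dots> = vdot p v w" using w by (simp add: vdot_def)
  finally show ?thesis .
qed

section \<open>Measurability of determinants, minors and inverse matrices\<close>

lemma measurable_det:
  fixes A :: "nat \<Rightarrow> nat \<Rightarrow> 'a \<Rightarrow> real"
  assumes "\<And>i j. i < p \<Longrightarrow> j < p \<Longrightarrow> A i j \<in> borel_measurable M"
  shows "(\<lambda>\<omega>. det (mat p p (\<lambda>(i, j). A i j \<omega>))) \<in> borel_measurable M"
proof -
  have "(\<lambda>\<omega>. det (mat p p (\<lambda>(i, j). A i j \<omega>))) =
      (\<lambda>\<omega>. \<Sum>q | q permutes {0..<p}. signof q * (\<Prod>i = 0..<p. A i (q i) \<omega>))"
    by (intro ext) (auto simp: det_def intro!: sum.cong prod.cong dest: permutes_in_image)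
  moreover have "A i (q i) \<in> borel_measurable M" if "q permutes {0..<p}" "i < p" for q i
    using that assms permutes_in_image[OF that(1), of i] by simp
  ultimately show ?thesis
    by (auto intro!: borel_measurable_sum borel_measurable_times borel_measurable_prod)
qed

lemma measurable_nonsing:
  fixes A :: "'a \<Rightarrow> nat \<Rightarrow> nat \<Rightarrow> real"
  assumes "\<And>i j. i < p \<Longrightarrow> j < p \<Longrightarrow> (\<lambda>\<omega>. A \<omega> i j) \<in> borel_measurable M"
  shows "Measurable.pred M (\<lambda>\<omega>. nonsing p (A \<omega>))"
proof -
  have [measurable]: "(\<lambda>\<omega>. det (mat p p (\<lambda>(i, j). A \<omega> i j))) \<in> borel_measurable M"
    by (rule measurable_det) (use assms in auto)
  show ?thesis unfolding nonsing_def by measurable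
qed

lemma measurable_cofactor:
  fixes A :: "'a \<Rightarrow> nat \<Rightarrow> nat \<Rightarrow> real"
  assumes A: "\<And>i j. i < p \<Longrightarrow> j < p \<Longrightarrow> (\<lambda>\<omega>. A \<omega> i j) \<in> borel_measurable M"
    and "i < p" "j < p"
  shows "(\<lambda>\<omega>. cofactor (mat p p (\<lambda>(i, j). A \<omega> i j)) i j) \<in> borel_measurable M"
proof -
  \<comment> \<open>Deleting a row and a column is written with index shifts, so that the minor is
    again a \<open>mat\<close> to which \<open>measurable_det\<close> applies.\<close>
  have md: "mat_delete (mat p p (\<lambda>(i, j). A \<omega> i j)) i j = mat (p - 1) (p - 1)
      (\<lambda>(i', j'). A \<omega> (if i' < i then i' else Suc i') (if j' < j then j' else Suc j'))" for \<omega>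
    by (rule eq_matI) (auto simp: mat_delete_def)
  show ?thesis unfolding cofactor_def md
    by (intro borel_measurable_times borel_measurable_const measurable_det A) auto
qed

text \<open>The entries of \<open>mat_inv\<close> are rational functions on the measurable event
  \<open>nonsing\<close> and constant off it, so the two pieces glue.\<close>

lemma measurable_quad_form_mat_inv:
  fixes A :: "'a \<Rightarrow> nat \<Rightarrow> nat \<Rightarrow> real"
  assumes A: "\<And>i j. i < p \<Longrightarrow> j < p \<Longrightarrow> (\<lambda>\<omega>. A \<omega> i j) \<in> borel_measurable M"
    and v: "\<And>i. i < p \<Longrightarrow> (\<lambda>\<omega>. v \<omega> i) \<in> borel_measurable M"
  shows "(\<lambda>\<omega>. quad_form p (mat_inv p (A \<omega>)) (v \<omega>)) \<in> borel_measurable M"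
proof -
  have [measurable]: "Measurable.pred M (\<lambda>\<omega>. nonsing p (A \<omega>))"
    by (rule measurable_nonsing[OF A])
  have e: "(\<lambda>\<omega>. inv_entry p (A \<omega>) i j) \<in> borel_measurable M" if "i < p" "j < p" for i j
    using that unfolding inv_entry_def
    by (auto intro!: borel_measurable_divide measurable_cofactor[OF A] measurable_det A)
  have "(\<lambda>\<omega>. mat_inv p (A \<omega>) i j) \<in> borel_measurable M" if "i < p" "j < p" for i j
  proof -
    have "(\<lambda>\<omega>. mat_inv p (A \<omega>) i j) =
        (\<lambda>\<omega>. if nonsing p (A \<omega>) then inv_entry p (A \<omega>) i j else (THE B. False) i j)"
      by (auto simp: mat_inv_nonsing mat_inv_singular fun_eq_iff)
    then show ?thesis using e[OF that] by simp
  qed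
  then show ?thesis unfolding quad_form_def
    by (intro borel_measurable_sum borel_measurable_times v) auto
qed

section \<open>Orthonormal systems in \<open>\<real>\<^sup>m\<close>\<close>

text \<open>Vector index first, coordinate second: \<open>y c\<close> is the \<open>c\<close>-th
  vector. A data column is thus \<open>y c\<close>, the transpose of the indexing
  \<open>x i c\<close> used by the statistics.\<close>

definition lin_indep :: "nat \<Rightarrow> nat \<Rightarrow> (nat \<Rightarrow> nat \<Rightarrow> real) \<Rightarrow> bool" where
  "lin_indep m p y \<longleftrightarrow> (\<forall>a. (\<forall>i<m. (\<Sum>c<p. a c * y c i) = 0) \<longrightarrow> (\<forall>c<p. a c = 0))"

definition orthonormal :: "nat \<Rightarrow> nat \<Rightarrow> (nat \<Rightarrow> nat \<Rightarrow> real) \<Rightarrow> bool" where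
  "orthonormal m k f \<longleftrightarrow> (\<forall>i<k. \<forall>j<k. vdot m (f i) (f j) = (if i = j then 1 else 0))"

lemma orthonormalD:
  "orthonormal m k f \<Longrightarrow> i < k \<Longrightarrow> j < k \<Longrightarrow> vdot m (f i) (f j) = (if i = j then 1 else 0)"
  by (simp add: orthonormal_def)

lemma vdot_commute: "vdot m x y = vdot m y x"
  by (simp add: vdot_def mult.commute)

lemma vdot_cong: "(\<And>i. i < m \<Longrightarrow> x i = x' i) \<Longrightarrow> (\<And>i. i < m \<Longrightarrow> y i = y' i) \<Longrightarrow> vdot m x y = vdot m x' y'"
  by (simp add: vdot_def)

lemma vdot_sum_right: "vdot m x (\<lambda>i. \<Sum>c\<in>A. a c * y c i) = (\<Sum>c\<in>A. a c * vdot m x (y c))"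
  unfolding vdot_def sum_distrib_left by (subst sum.swap) (simp add: mult_ac)

lemma vdot_sum_left: "vdot m (\<lambda>i. \<Sum>c\<in>A. a c * y c i) x = (\<Sum>c\<in>A. a c * vdot m (y c) x)"
  by (simp add: vdot_commute[of m _ x] vdot_sum_right)

lemma vdot_diff_left: "vdot m (\<lambda>i. x i - y i) z = vdot m x z - vdot m y z"
  by (simp add: vdot_def left_diff_distrib sum_subtractf)

lemma vdot_diff_right: "vdot m z (\<lambda>i. x i - y i) = vdot m z x - vdot m z y"
  by (simp add: vdot_def right_diff_distrib sum_subtractf)

lemma vdot_scale_left: "vdot m (\<lambda>i. c * x i) z = c * vdot m x z"
  by (simp add: vdot_def sum_distrib_left mult_ac)

lemma vdot_scale_right: "vdot m z (\<lambda>i. c * x i) = c * vdot m z x"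
  by (simp add: vdot_def sum_distrib_left mult_ac)

lemma vdot_self_nonneg: "0 \<le> vdot m x x"
  by (simp add: vdot_def sum_nonneg)

lemma vdot_self_eq_0: "vdot m x x = 0 \<longleftrightarrow> (\<forall>i<m. x i = 0)"
  by (auto simp: vdot_def sum_nonneg_eq_0_iff)

text \<open>If the Gram matrix annihilates \<open>a\<close>, the combination of the
  \<open>y c\<close> with weights \<open>a\<close> is orthogonal to every \<open>y c\<close>, hence
  to itself. This also expresses \<open>lin_indep\<close> by a determinant, which makes it a
  measurable event.\<close>

lemma nonsing_gram: "nonsing p (\<lambda>c d. vdot m (y c) (y d)) \<longleftrightarrow> lin_indep m p y"
proof -
  have "(\<forall>c<p. (\<Sum>d<p. vdot m (y c) (y d) * a d) = 0) \<longleftrightarrow> (\<forall>i<m. (\<Sum>c<p. a c * y c i) = 0)" for a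
  proof -
    define x where "x i = (\<Sum>c<p. a c * y c i)" for i
    have e: "(\<Sum>d<p. vdot m (y c) (y d) * a d) = vdot m (y c) x" for c
      by (simp add: x_def[abs_def] vdot_sum_right mult.commute)
    have "vdot m x x = (\<Sum>c<p. a c * vdot m (y c) x)"
      unfolding x_def[abs_def] by (rule vdot_sum_left)
    then have "(\<forall>c<p. vdot m (y c) x = 0) \<Longrightarrow> \<forall>i<m. x i = 0"
      by (subst vdot_self_eq_0[symmetric]) simp
    moreover have "(\<forall>i<m. x i = 0) \<Longrightarrow> \<forall>c<p. vdot m (y c) x = 0"
      by (simp add: vdot_def)
    ultimately show ?thesis unfolding e x_def[symmetric] by blast
  qed
  then show ?thesis unfolding nonsing_iff lin_indep_def by simp
qed

text \<open>The single computation behind Gram-Schmidt, basis extension and completeness. The length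
  formula follows by pairing the residual with \<open>x\<close> alone, since the part subtracted
  from \<open>x\<close> is orthogonal to it.\<close>

lemma orthonormal_residual:
  assumes f: "orthonormal m k f"
  defines "r \<equiv> \<lambda>x i. x i - (\<Sum>d<k. vdot m x (f d) * f d i)"
  shows "d < k \<Longrightarrow> vdot m (r x) (f d) = 0"
    and "vdot m (r x) (r x) = vdot m x x - (\<Sum>d<k. (vdot m x (f d))\<^sup>2)"
    and "vdot m (r x) (r x) \<noteq> 0 \<Longrightarrow> orthonormal m (Suc k) (f(k := (\<lambda>i. r x i / sqrt (vdot m (r x) (r x)))))"
proof -
  have o: "vdot m (r x) (f d) = 0" if "d < k" for d
  proof -
    have "(\<Sum>e<k. vdot m x (f e) * vdot m (f e) (f d)) = (\<Sum>e<k. if e = d then vdot m x (f e) else 0)"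
      using that by (intro sum.cong) (auto simp: orthonormalD[OF f])
    then show ?thesis using that unfolding r_def vdot_diff_left vdot_sum_left by simp
  qed
  show "d < k \<Longrightarrow> vdot m (r x) (f d) = 0" by (rule o)
  have "vdot m (r x) (r x) = vdot m (r x) x - (\<Sum>d<k. vdot m x (f d) * vdot m (r x) (f d))"
    by (subst (2) r_def) (simp add: vdot_diff_right vdot_sum_right)
  also have "\<dots> = vdot m (r x) x" using o by simp
  also have "\<dots> = vdot m x x - (\<Sum>d<k. (vdot m x (f d))\<^sup>2)"
    unfolding r_def vdot_diff_left vdot_sum_left by (simp add: power2_eq_square vdot_commute[of m "f _" x])
  finally show "vdot m (r x) (r x) = vdot m x x - (\<Sum>d<k. (vdot m x (f d))\<^sup>2)" .
  assume nz: "vdot m (r x) (r x) \<noteq> 0"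
  let ?s = "sqrt (vdot m (r x) (r x))"
  have s: "?s * ?s = vdot m (r x) (r x)" "?s \<noteq> 0"
    using nz vdot_self_nonneg[of m "r x"] by auto
  have n: "vdot m (\<lambda>i. r x i / ?s) (\<lambda>i. r x i / ?s) = 1"
    using vdot_scale_left[of m "1 / ?s" "r x"] vdot_scale_right[of m _ "1 / ?s" "r x"] s by simp
  have fr: "vdot m (\<lambda>i. r x i / ?s) (f d) = 0" if "d < k" for d
    using vdot_scale_left[of m "1 / ?s" "r x"] o[OF that] by simp
  show "orthonormal m (Suc k) (f(k := (\<lambda>i. r x i / ?s)))"
    unfolding orthonormal_def
  proof (intro allI impI)
    fix i j assume "i < Suc k" "j < Suc k"
    then consider "i < k" "j < k" | "i = k" "j < k" | "i < k" "j = k" | "i = k" "j = k" by linarith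
    then show "vdot m ((f(k := (\<lambda>i. r x i / ?s))) i) ((f(k := (\<lambda>i. r x i / ?s))) j) = (if i = j then 1 else 0)"
      using n fr vdot_commute[of m "f i"] by cases (simp_all add: orthonormalD[OF f])
  qed
qed

text \<open>A dimension count finds the new direction: the squared projections of the unit vectors
  onto the span of the system sum to \<open>k < m\<close>, so some unit vector has a projection
  shorter than 1 and leaves a nonzero residual.\<close>

lemma orthonormal_extend:
  assumes "orthonormal m k f" "k \<le> m"
  shows "\<exists>g. orthonormal m m g \<and> (\<forall>i<k. g i = f i)"
  using assms
proof (induction "m - k" arbitrary: k f)
  case 0
  then show ?case by (intro exI[of _ f]) auto
next
  case (Suc n)
  then have k: "k < m" by simp
  define e where "e i j = (if i = j then 1 else 0 :: real)" for i j :: nat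
  have ve: "vdot m (e i) x = x i" if "i < m" for i x
    using that by (simp add: vdot_def e_def if_distrib[of "\<lambda>x. x * _"] cong: if_cong)
  have "(\<Sum>i<m. \<Sum>d<k. (vdot m (e i) (f d))\<^sup>2) = (\<Sum>d<k. vdot m (f d) (f d))"
    by (subst sum.swap) (simp add: ve, simp add: vdot_def power2_eq_square)
  also have "\<dots> = real k" using Suc.prems(1) by (simp add: orthonormalD)
  finally have "(\<Sum>i<m. \<Sum>d<k. (vdot m (e i) (f d))\<^sup>2) < (\<Sum>i<m. 1)" using k by simp
  then obtain i where i: "i < m" "(\<Sum>d<k. (vdot m (e i) (f d))\<^sup>2) < 1"
    by (metis (no_types, lifting) lessThan_iff not_less sum_mono)
  let ?r = "\<lambda>j. e i j - (\<Sum>d<k. vdot m (e i) (f d) * f d j)"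
  have "vdot m ?r ?r \<noteq> 0"
    using orthonormal_residual(2)[OF Suc.prems(1), of "e i"] i ve[OF i(1), of "e i"] by (simp add: e_def)
  from orthonormal_residual(3)[OF Suc.prems(1) this]
  obtain F where F: "orthonormal m (Suc k) F" "\<And>j. j < k \<Longrightarrow> F j = f j" by fastforce
  have "\<exists>g. orthonormal m m g \<and> (\<forall>j<Suc k. g j = F j)"
    by (rule Suc.hyps(1)[OF _ F(1)]) (use Suc.hyps(2) k in auto)
  then show ?case using F(2) by (metis less_Suc_eq)
qed

text \<open>The same count with \<open>k = m\<close>: the residuals of the unit vectors have squared
  lengths summing to \<open>m - m = 0\<close>, so all vanish. This turns orthonormal rows of a
  square array into orthonormal columns.\<close>

lemma orthonormal_complete:
  assumes f: "orthonormal m m f" and "i < m" "j < m"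
  shows "(\<Sum>d<m. f d i * f d j) = (if i = j then 1 else 0)"
proof -
  define e where "e i j = (if i = j then 1 else 0 :: real)" for i j :: nat
  have ve: "vdot m (e i) x = x i" if "i < m" for i x
    using that by (simp add: vdot_def e_def if_distrib[of "\<lambda>x. x * _"] cong: if_cong)
  define r where "r i j = e i j - (\<Sum>d<m. vdot m (e i) (f d) * f d j)" for i j
  have r: "vdot m (r i) (r i) = 1 - (\<Sum>d<m. (vdot m (e i) (f d))\<^sup>2)" if "i < m" for i
    using orthonormal_residual(2)[OF f, of "e i"] ve[OF that, of "e i"] by (simp add: r_def[abs_def] e_def)
  have "(\<Sum>i<m. \<Sum>d<m. (vdot m (e i) (f d))\<^sup>2) = (\<Sum>d<m. vdot m (f d) (f d))"
    by (subst sum.swap) (simp add: ve, simp add: vdot_def power2_eq_square)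
  also have "\<dots> = real m" using f by (simp add: orthonormalD)
  finally have "(\<Sum>i<m. vdot m (r i) (r i)) = 0" by (simp add: r sum_subtractf)
  then have "vdot m (r i) (r i) = 0"
    using \<open>i < m\<close> by (subst (asm) sum_nonneg_eq_0_iff) (auto simp: vdot_self_nonneg)
  then have "r i j = 0" using \<open>j < m\<close> by (simp add: vdot_self_eq_0)
  then show ?thesis using ve \<open>i < m\<close> by (simp add: r_def e_def)
qed

lemma vdot_rotate:
  assumes "orthonormal m m R"
  shows "vdot m (\<lambda>i. vdot m (R i) x) (\<lambda>i. vdot m (R i) y) = vdot m x y"
proof -
  have "vdot m (\<lambda>i. vdot m (R i) x) (\<lambda>i. vdot m (R i) y) =
      (\<Sum>d<m. \<Sum>i<m. \<Sum>j<m. x i * y j * (R d i * R d j))"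
    by (simp add: vdot_def sum_product mult_ac)
  also have "\<dots> = (\<Sum>i<m. \<Sum>j<m. x i * y j * (\<Sum>d<m. R d i * R d j))"
    unfolding sum_distrib_left
    by (subst sum.swap, rule sum.cong[OF refl], rule sum.swap)
  also have "\<dots> = vdot m x y"
    by (simp add: orthonormal_complete[OF assms] vdot_def if_distrib[of "\<lambda>x. _ * x"] cong: if_cong sum.cong_simp)
  finally show ?thesis .
qed

lemma parseval:
  assumes "orthonormal m m f"
  shows "(\<Sum>d<m. (vdot m g (f d))\<^sup>2) = vdot m g g"
  using vdot_rotate[OF assms, of g g]
  by (simp only: vdot_def[of m "\<lambda>i. vdot m (f i) g"] power2_eq_square vdot_commute[of m g "f _"])

text \<open>The two spans agree, and both inclusions are used: the first carries orthogonality to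
  the \<open>f d\<close> over to the \<open>y c\<close>, the second carries it back.\<close>

lemma gram_schmidt:
  assumes "lin_indep m p y"
  shows "\<exists>f. orthonormal m p f \<and> (\<forall>c<p. \<exists>s. \<forall>i<m. y c i = (\<Sum>d<p. s d * f d i)) \<and>
      (\<forall>d<p. \<exists>t. \<forall>i<m. f d i = (\<Sum>c<p. t c * y c i))"
  using assms
  proof (induction p)
    case 0
    then show ?case by (simp add: orthonormal_def)
  next
    case (Suc p)
    have "lin_indep m p y" unfolding lin_indep_def
    proof (intro allI impI)
      fix a c assume "\<forall>i<m. (\<Sum>c<p. a c * y c i) = 0" "c < p"
      then have "\<forall>c<Suc p. (a(p := 0)) c = 0"
        using Suc.prems[unfolded lin_indep_def, rule_format, of "a(p := 0)"] by simp
      then show "a c = 0" using \<open>c < p\<close> by (metis fun_upd_other less_SucI nat_neq_iff)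
    qed
    from Suc.IH[OF this] obtain f where f: "orthonormal m p f"
      and s: "\<And>c. c < p \<Longrightarrow> \<exists>s. \<forall>i<m. y c i = (\<Sum>d<p. s d * f d i)"
      and t: "\<And>d. d < p \<Longrightarrow> \<exists>t. \<forall>i<m. f d i = (\<Sum>c<p. t c * y c i)" by blast
    from t obtain t where t: "\<And>d i. d < p \<Longrightarrow> i < m \<Longrightarrow> f d i = (\<Sum>c<p. t d c * y c i)" by metis
    define r where "r i = y p i - (\<Sum>d<p. vdot m (y p) (f d) * f d i)" for i
    \<comment> \<open>Coefficients of the residual in terms of the old vectors:
      \<open>r = y p + \<Sum>c<p. u c * y c\<close>. A vanishing \<open>r\<close> would be a linear
      relation with coefficient 1 at \<open>y p\<close>.\<close>
    define u where "u c = - (\<Sum>d<p. vdot m (y p) (f d) * t d c)" for c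
    have ru: "r i = y p i + (\<Sum>c<p. u c * y c i)" if "i < m" for i
    proof -
      have "(\<Sum>d<p. vdot m (y p) (f d) * f d i) = (\<Sum>d<p. \<Sum>c<p. vdot m (y p) (f d) * t d c * y c i)"
        using that t by (simp add: sum_distrib_left mult.assoc)
      also have "\<dots> = (\<Sum>c<p. - u c * y c i)"
        by (subst sum.swap) (simp add: u_def sum_distrib_right)
      finally show ?thesis by (simp add: r_def sum_negf)
    qed
    have nz: "vdot m r r \<noteq> 0"
    proof
      assume "vdot m r r = 0"
      then have "\<forall>i<m. (\<Sum>c<Suc p. (u(p := 1)) c * y c i) = 0"
        using ru by (simp add: vdot_self_eq_0 add.commute)
      then have "(u(p := 1)) p = 0" using Suc.prems unfolding lin_indep_def by blast
      then show False by simp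
    qed
    let ?q = "sqrt (vdot m r r)"
    have q: "?q \<noteq> 0" using nz by simp
    let ?f = "f(p := \<lambda>i. r i / ?q)"
    have "orthonormal m (Suc p) ?f"
      using orthonormal_residual(3)[OF f, of "y p"] nz by (simp add: r_def[abs_def])
    moreover have "\<exists>s. \<forall>i<m. y c i = (\<Sum>d<Suc p. s d * ?f d i)" if "c < Suc p" for c
    proof (cases "c = p")
      case True
      show ?thesis
        using q True by (intro exI[of _ "(\<lambda>d. vdot m (y p) (f d))(p := ?q)"]) (simp add: r_def)
    next
      case False
      then obtain s' where "\<forall>i<m. y c i = (\<Sum>d<p. s' d * f d i)" using s \<open>c < Suc p\<close> by (metis less_SucE)
      then show ?thesis by (intro exI[of _ "s'(p := 0)"]) simp
    qed
    moreover have "\<exists>t. \<forall>i<m. ?f d i = (\<Sum>c<Suc p. t c * y c i)" if "d < Suc p" for d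
    proof (cases "d = p")
      case True
      show ?thesis
        using q True ru by (intro exI[of _ "(\<lambda>c. u c / ?q)(p := 1 / ?q)"])
          (simp add: add_divide_distrib sum_divide_distrib)
    next
      case False
      then show ?thesis
        using t \<open>d < Suc p\<close> by (intro exI[of _ "(t d)(p := 0)"]) simp
    qed
    ultimately show ?case by blast
  qed

text \<open>The witness is the first vector added when the orthonormalised \<open>x\<close> is
  completed to a basis, available since \<open>k < m\<close>. It supplies a hyperplane containing
  \<open>k\<close> given rows.\<close>

lemma exists_orthogonal:
  assumes "lin_indep m k x" "k < m"
  shows "\<exists>a. (\<exists>c<m. a c \<noteq> 0) \<and> (\<forall>j<k. vdot m a (x j) = 0)"
proof -
  obtain f where f: "orthonormal m k f"
    and s: "\<And>c. c < k \<Longrightarrow> \<exists>s. \<forall>i<m. x c i = (\<Sum>d<k. s d * f d i)"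
    and t: "\<And>d. d < k \<Longrightarrow> \<exists>t. \<forall>i<m. f d i = (\<Sum>c<k. t c * x c i)"
    using gram_schmidt[OF assms(1)] by blast
  obtain g where g: "orthonormal m m g" "\<And>i. i < k \<Longrightarrow> g i = f i"
    using orthonormal_extend[OF f] assms(2) by auto
  have "vdot m (g k) (x j) = 0" if j: "j < k" for j
  proof -
    from s[OF j] obtain s where "\<forall>i<m. x j i = (\<Sum>d<k. s d * f d i)" by blast
    then have "vdot m (g k) (x j) = vdot m (g k) (\<lambda>i. \<Sum>d<k. s d * f d i)" by (intro vdot_cong) auto
    also have "\<dots> = (\<Sum>d<k. s d * vdot m (g k) (g d))"
      unfolding vdot_sum_right using g(2) by simp
    also have "\<dots> = 0" using assms(2) by (simp add: orthonormalD[OF g(1)])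
    finally show ?thesis .
  qed
  moreover have "\<exists>c<m. g k c \<noteq> 0"
    using orthonormalD[OF g(1) assms(2) assms(2)] vdot_self_eq_0[of m "g k"] by auto
  ultimately show ?thesis by blast
qed

text \<open>By Parseval, a vector orthogonal to a basis has length 0. This converts independence of
  \<open>p\<close> rows into independence of the \<open>p\<close> columns.\<close>

lemma lin_indep_square_orthogonal_zero:
  assumes "lin_indep p p x" "\<And>j. j < p \<Longrightarrow> vdot p a (x j) = 0" "c < p"
  shows "a c = 0"
proof -
  obtain f where f: "orthonormal p p f"
    and s: "\<And>c. c < p \<Longrightarrow> \<exists>s. \<forall>i<p. x c i = (\<Sum>d<p. s d * f d i)"
    and t: "\<And>d. d < p \<Longrightarrow> \<exists>t. \<forall>i<p. f d i = (\<Sum>c<p. t c * x c i)"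
    using gram_schmidt[OF assms(1)] by blast
  have "vdot p a (f d) = 0" if d: "d < p" for d
  proof -
    from t[OF d] obtain t where "\<forall>i<p. f d i = (\<Sum>c<p. t c * x c i)" by blast
    then have "vdot p a (f d) = vdot p a (\<lambda>i. \<Sum>c<p. t c * x c i)" by (intro vdot_cong) auto
    also have "\<dots> = 0" unfolding vdot_sum_right using assms(2) by simp
    finally show ?thesis .
  qed
  then have "vdot p a a = 0" using parseval[OF f, of a] by simp
  then show ?thesis using assms(3) by (simp add: vdot_self_eq_0)
qed

text \<open>With \<open>Y\<close> the matrix of columns \<open>y c\<close> and \<open>'\<close> for
  transposition, this is \<open>g' Y (Y' Y)^-1 Y' g\<close>: the squared length of the orthogonal
  projection of \<open>g\<close> onto their span, whenever they are independent.\<close>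

definition proj_sq :: "nat \<Rightarrow> nat \<Rightarrow> (nat \<Rightarrow> nat \<Rightarrow> real) \<Rightarrow> (nat \<Rightarrow> real) \<Rightarrow> real" where
  "proj_sq m p y g = quad_form p (mat_inv p (\<lambda>c d. vdot m (y c) (y d))) (\<lambda>c. vdot m (y c) g)"

text \<open>The coefficient vector \<open>w\<close> of the projection solves the normal equations,
  so \<open>quad_form_mat_inv\<close> applies. One basis serves all \<open>g\<close>: with fixed
  columns and random \<open>g\<close>, the projection is read off from the first \<open>p\<close>
  rotated coordinates.\<close>

lemma proj_sq_eq:
  assumes "lin_indep m p y" "p \<le> m"
  shows "\<exists>f. orthonormal m m f \<and> (\<forall>g. proj_sq m p y g = (\<Sum>d<p. (vdot m (f d) g)\<^sup>2))"
proof -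
  obtain f where f: "orthonormal m p f"
    and s: "\<And>c. c < p \<Longrightarrow> \<exists>s. \<forall>i<m. y c i = (\<Sum>d<p. s d * f d i)"
    and t: "\<And>d. d < p \<Longrightarrow> \<exists>t. \<forall>i<m. f d i = (\<Sum>c<p. t c * y c i)"
    using gram_schmidt[OF assms(1)] by blast
  obtain h where h: "orthonormal m m h" "\<And>i. i < p \<Longrightarrow> h i = f i"
    using orthonormal_extend[OF f] assms(2) by auto
  from t obtain t where t: "\<And>d i. d < p \<Longrightarrow> i < m \<Longrightarrow> f d i = (\<Sum>c<p. t d c * y c i)" by metis
  have "proj_sq m p y g = (\<Sum>d<p. (vdot m (h d) g)\<^sup>2)" for g
  proof -
    define w where "w c = (\<Sum>d<p. vdot m (f d) g * t d c)" for c
    have Pg: "(\<Sum>c<p. w c * y c i) = (\<Sum>d<p. vdot m (f d) g * f d i)" if "i < m" for i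
    proof -
      have "(\<Sum>d<p. vdot m (f d) g * f d i) = (\<Sum>d<p. \<Sum>c<p. vdot m (f d) g * t d c * y c i)"
        using that t by (simp add: sum_distrib_left mult.assoc)
      then show ?thesis by (subst (asm) sum.swap) (simp add: w_def sum_distrib_right)
    qed
    have yP: "(\<Sum>d<p. vdot m (y c) (y d) * w d) = vdot m (y c) g" if c: "c < p" for c
    proof -
      from s[OF c] obtain s where s: "\<forall>i<m. y c i = (\<Sum>d<p. s d * f d i)" by blast
      have yv: "vdot m (y c) x = (\<Sum>d<p. s d * vdot m (f d) x)" for x
        using s by (subst vdot_sum_left[symmetric]) (intro vdot_cong, auto)
      have "(\<Sum>d<p. vdot m (y c) (y d) * w d) = vdot m (y c) (\<lambda>i. \<Sum>d<p. w d * y d i)"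
        by (simp add: vdot_sum_right mult.commute)
      also have "\<dots> = vdot m (y c) (\<lambda>i. \<Sum>d<p. vdot m (f d) g * f d i)"
        by (intro vdot_cong Pg) auto
      also have "\<dots> = (\<Sum>d<p. vdot m (f d) g * vdot m (y c) (f d))" by (rule vdot_sum_right)
      also have "\<dots> = (\<Sum>d<p. vdot m (f d) g * (\<Sum>e<p. s e * vdot m (f e) (f d)))"
        by (simp add: yv)
      also have "\<dots> = (\<Sum>d<p. vdot m (f d) g * s d)"
        by (intro sum.cong refl) (simp add: orthonormalD[OF f] if_distrib[of "\<lambda>x. _ * x"] cong: if_cong sum.cong_simp)
      also have "\<dots> = vdot m (y c) g" by (simp add: yv mult.commute)
      finally show ?thesis .
    qed
    have "proj_sq m p y g = vdot p (\<lambda>c. vdot m (y c) g) w"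
      unfolding proj_sq_def using assms(1) yP by (intro quad_form_mat_inv) (simp_all add: nonsing_gram)
    also have "\<dots> = vdot m (\<lambda>i. \<Sum>c<p. w c * y c i) g"
      by (simp add: vdot_sum_left) (simp add: vdot_def mult.commute)
    also have "\<dots> = vdot m (\<lambda>i. \<Sum>d<p. vdot m (f d) g * f d i) g"
      by (intro vdot_cong Pg) auto
    also have "\<dots> = (\<Sum>d<p. (vdot m (h d) g)\<^sup>2)"
      unfolding vdot_sum_left using h(2) by (simp add: power2_eq_square)
    finally show ?thesis .
  qed
  then show ?thesis using h(1) by blast
qed

text \<open>Centring the columns subtracts a rank-one matrix from their Gram matrix
  (Sherman--Morrison).\<close>
lemma quad_form_centred_gram:
  fixes m :: nat and Q :: real
  assumes "lin_indep m p y" "0 < m"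
  defines "v \<equiv> \<lambda>c. vdot m (y c) (\<lambda>_. 1)" and "Q \<equiv> proj_sq m p y (\<lambda>_. 1)"
  defines "A \<equiv> \<lambda>c d. (vdot m (y c) (y d) - v c * v d / m) / m"
  assumes "Q \<noteq> m"
  shows "quad_form p (mat_inv p A) (\<lambda>c. v c / m) = Q / (m - Q)"
proof -
  let ?G = "\<lambda>c d. vdot m (y c) (y d)"
  have G: "nonsing p ?G" using assms(1) by (simp add: nonsing_gram)
  define w where "w c = (\<Sum>d<p. inv_entry p ?G c d * v d)" for c
  have Gw: "(\<Sum>d<p. ?G c d * w d) = v c" if c: "c < p" for c
  proof -
    have "(\<Sum>d<p. ?G c d * w d) = (\<Sum>e<p. (\<Sum>d<p. ?G c d * inv_entry p ?G d e) * v e)"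
      unfolding w_def sum_distrib_left sum_distrib_right mult.assoc by (rule sum.swap)
    also have "\<dots> = v c"
      using c inv_entry(1)[OF G c] by (simp add: if_distrib[of "\<lambda>x. x * _"] cong: if_cong sum.cong_simp)
    finally show ?thesis .
  qed
  have Q: "Q = vdot p v w"
    unfolding Q_def proj_sq_def v_def[symmetric] by (rule quad_form_mat_inv[OF G]) (use Gw in auto)
  have Aa: "(\<Sum>d<p. A c d * a d) = ((\<Sum>d<p. ?G c d * a d) - v c * vdot p v a / m) / m" for a c
  proof -
    have "(\<Sum>d<p. A c d * a d) = (\<Sum>d<p. (?G c d * a d - v c / m * (v d * a d)) / m)"
      using assms(2) by (intro sum.cong) (simp_all add: A_def field_simps)
    also have "\<dots> = ((\<Sum>d<p. ?G c d * a d) - v c / m * (\<Sum>d<p. v d * a d)) / m"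
      by (simp only: sum_divide_distrib[symmetric] sum_subtractf sum_distrib_left)
    finally show ?thesis by (simp add: vdot_def[of p v a])
  qed
  \<comment> \<open>If \<open>A a = 0\<close>, then \<open>a\<close> is \<open>w\<close> times
    \<open>(v . a) / m\<close>; pairing with \<open>v\<close> gives
    \<open>(v . a) * (m - Q) = 0\<close>, and \<open>Q \<noteq> m\<close> forces
    \<open>a = 0\<close>.\<close>
  have nA: "nonsing p A"
    unfolding nonsing_iff
  proof (intro allI impI)
    fix a c assume "\<forall>c<p. (\<Sum>d<p. A c d * a d) = 0" and c: "c < p"
    then have Ga: "(\<Sum>d<p. ?G c d * a d) = v c * vdot p v a / m" if "c < p" for c
      using that assms(2) by (simp add: Aa)
    have eq: "a c = w c * vdot p v a / m" if c: "c < p" for c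
    proof -
      have "(\<Sum>d<p. ?G c d * (a d - w d * vdot p v a / m)) = 0" if "c < p" for c
      proof -
        have "(\<Sum>d<p. ?G c d * (a d - w d * vdot p v a / m)) =
            (\<Sum>d<p. ?G c d * a d) - (\<Sum>d<p. ?G c d * w d) * (vdot p v a / m)"
          unfolding sum_distrib_right sum_subtractf[symmetric]
          by (intro sum.cong) (simp_all add: right_diff_distrib)
        then show ?thesis using Ga[OF that] Gw[OF that] by simp
      qed
      from nonsingD[OF G this c] show ?thesis by simp
    qed
    have "vdot p v a = vdot p v (\<lambda>c. (vdot p v a / m) * w c)"
    proof (rule vdot_cong)
      fix i assume i: "i < p"
      show "a i = vdot p v a / m * w i" by (subst eq[OF i]) simp
    qed simp
    also have "\<dots> = vdot p v a / m * Q" by (simp only: vdot_scale_right Q)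
    finally have "vdot p v a * (m - Q) = 0" using assms(2) by (simp add: field_simps)
    then have "vdot p v a = 0" using \<open>Q \<noteq> m\<close> by simp
    then show "a c = 0" using eq[OF c] by simp
  qed
  have mQ: "m - Q \<noteq> 0" using \<open>Q \<noteq> m\<close> by simp
  \<comment> \<open>The rank-one update only rescales the solution \<open>w\<close> of the uncentred
    system: \<open>A w = (1 - Q / m) v / m\<close>, whence the factor
    \<open>m / (m - Q)\<close>.\<close>
  have Aw: "(\<Sum>d<p. A c d * (m / (m - Q) * w d)) = v c / m" if c: "c < p" for c
  proof -
    have "(\<Sum>d<p. A c d * (m / (m - Q) * w d)) = m / (m - Q) * (\<Sum>d<p. A c d * w d)"
      by (simp add: sum_distrib_left mult_ac)
    also have "\<dots> = m / (m - Q) * ((v c - v c * Q / m) / m)" by (simp add: Aa Gw[OF c] Q)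
    also have "\<dots> = v c / m" using assms(2) mQ by (simp add: field_simps)
    finally show ?thesis .
  qed
  have "quad_form p (mat_inv p A) (\<lambda>c. v c / m) = vdot p (\<lambda>c. v c / m) (\<lambda>d. m / (m - Q) * w d)"
    by (rule quad_form_mat_inv[OF nA Aw])
  also have "\<dots> = m / (m - Q) * vdot p v w / m"
    using vdot_scale_left[of p "1 / m" v] unfolding vdot_scale_right by simp
  also have "\<dots> = Q / (m - Q)" unfolding Q[symmetric] using assms(2) by simp
  finally show ?thesis .
qed

text \<open>A shift by \<open>\<nu>\<close> changes the sample mean but not the sample covariance,
  so both can be expressed through \<open>y\<close>; the enumeration \<open>h\<close> of the block
  turns them into inner products in dimension \<open>m\<close>. If the projection had squared length
  \<open>m\<close>, the centred Gram matrix would be singular.\<close>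

lemma hotelling_T2_eq_proj_sq:
  fixes x :: "nat \<Rightarrow> nat \<Rightarrow> real" and \<nu> :: "nat \<Rightarrow> real"
  assumes h: "bij_betw h {..<m} S" and "0 < m"
  defines "y \<equiv> \<lambda>c i. x (h i) c - \<nu> c"
  assumes "lin_indep m p y" "proj_sq m p y (\<lambda>_. 1) \<noteq> m"
  shows "hotelling_T2 p S \<nu> x = (real m - 1) * (proj_sq m p y (\<lambda>_. 1) / (m - proj_sq m p y (\<lambda>_. 1)))"
proof -
  have card: "card S = m" using bij_betw_same_card[OF h] by simp
  have re: "(\<Sum>i\<in>S. F i) = (\<Sum>i<m. F (h i))" for F :: "nat \<Rightarrow> real"
    using sum.reindex_bij_betw[OF h, of F] by simp
  let ?v = "\<lambda>c. vdot m (y c) (\<lambda>_. 1)"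
  have mean: "sample_mean S x c - \<nu> c = ?v c / m" for c
    using assms(2) by (simp add: sample_mean_def re card vdot_def y_def sum_subtractf diff_divide_distrib)
  have "sample_cov S x c d = (vdot m (y c) (y d) - ?v c * ?v d / m) / m" for c d
  proof -
    have e: "x (h i) c - sample_mean S x c = y c i - ?v c / m" for i c
      using mean[of c] by (simp add: y_def)
    have v: "?v c = (\<Sum>i<m. y c i)" for c by (simp add: vdot_def)
    have gen: "(\<Sum>i<m. (y c i - a) * (y d i - b)) = vdot m (y c) (y d) - a * ?v d - ?v c * b + m * (a * b)" for a b :: real
    proof -
      have "(\<Sum>i<m. (y c i - a) * (y d i - b)) = (\<Sum>i<m. y c i * y d i - a * y d i - y c i * b + a * b)"
        by (intro sum.cong) (simp_all add: algebra_simps)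
      then show ?thesis unfolding v vdot_def[of m "y c" "y d"]
        by (simp add: sum.distrib sum_subtractf sum_distrib_left sum_distrib_right)
    qed
    have "(\<Sum>i<m. (y c i - ?v c / m) * (y d i - ?v d / m)) = vdot m (y c) (y d) - ?v c * ?v d / m"
      unfolding gen using assms(2) by (simp add: field_simps)
    then show ?thesis by (simp add: sample_cov_def re card e)
  qed
  then have "sample_cov S x = (\<lambda>c d. (vdot m (y c) (y d) - ?v c * ?v d / m) / m)"
    by (intro ext)
  then show ?thesis
    unfolding hotelling_T2_def mean card
    using quad_form_centred_gram[OF assms(4) assms(2) assms(5)] by simp
qed

section \<open>Uniqueness of joint characteristic functions\<close>

lemma measure_eq_integral_indicator:
  "A \<in> sets M \<Longrightarrow> measure M A = (\<integral>x. indicator A x \<partial>M)"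
  by (simp add: sets.Int_space_eq2)

text \<open>The shift by 2 turns the signed weight \<open>V\<close> into a density bounded away from 0.\<close>
lemma (in prob_space) tilted_distr:
  fixes X V :: "'a \<Rightarrow> real"
  assumes [measurable]: "X \<in> borel_measurable M" "V \<in> borel_measurable M"
    and V: "\<And>\<omega>. \<bar>V \<omega>\<bar> \<le> 1"
  defines "c \<equiv> 2 + expectation V"
  defines "D \<equiv> distr (density M (\<lambda>\<omega>. ennreal ((2 + V \<omega>) / c))) borel X"
  shows "c \<ge> 1"
    and "real_distribution D"
    and "char D s = (2 * expectation (\<lambda>\<omega>. iexp (s * X \<omega>)) +
      expectation (\<lambda>\<omega>. complex_of_real (V \<omega>) * iexp (s * X \<omega>))) / c"
    and "B \<in> sets borel \<Longrightarrow> measure D B = (2 * expectation (\<lambda>\<omega>. indicator B (X \<omega>)) +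
      expectation (\<lambda>\<omega>. V \<omega> * indicator B (X \<omega>))) / c"
proof -
  have iV: "integrable M V"
    by (rule integrable_const_bound[of _ 1]) (use V in auto)
  have "expectation V \<ge> expectation (\<lambda>_. -1)"
    using V by (intro integral_mono iV) (auto simp: abs_le_iff minus_le_iff)
  then show c: "c \<ge> 1" by (simp add: c_def prob_space)
  have pos: "0 \<le> (2 + V \<omega>) / c" for \<omega>
    using c V[of \<omega>] by (intro divide_nonneg_nonneg) (auto simp: abs_le_iff)
  let ?D = "density M (\<lambda>\<omega>. ennreal ((2 + V \<omega>) / c))"
  have "emeasure ?D (space ?D) = (\<integral>\<^sup>+\<omega>. ennreal ((2 + V \<omega>) / c) \<partial>M)"
    by (subst emeasure_density) (auto intro!: nn_integral_cong)
  also have "\<dots> = ennreal (expectation (\<lambda>\<omega>. (2 + V \<omega>) / c))"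
    using iV pos by (intro nn_integral_eq_integral) auto
  also have "expectation (\<lambda>\<omega>. (2 + V \<omega>) / c) = c / c"
    using iV by (simp add: c_def prob_space)
  finally have "emeasure ?D (space ?D) = 1" using c by simp
  then interpret D: prob_space ?D by (rule prob_spaceI)
  show "real_distribution D"
    unfolding D_def by (rule D.real_distribution_distr) simp
  have i1: "integrable M (\<lambda>\<omega>. iexp (s * X \<omega>))"
    by (rule integrable_const_bound[of _ 1]) auto
  have i2: "integrable M (\<lambda>\<omega>. complex_of_real (V \<omega>) * iexp (s * X \<omega>))"
    by (rule integrable_const_bound[of _ 1]) (use V in \<open>auto simp: norm_mult\<close>)
  have "char D s = (\<integral>\<omega>. ((2 + V \<omega>) / c) *\<^sub>R iexp (s * X \<omega>) \<partial>M)"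
    unfolding char_def D_def
    by (simp add: integral_distr, subst integral_density) (use pos in \<open>auto\<close>)
  also have "\<dots> = (\<integral>\<omega>. (2 * iexp (s * X \<omega>) + complex_of_real (V \<omega>) * iexp (s * X \<omega>)) / c \<partial>M)"
    by (intro Bochner_Integration.integral_cong) (auto simp: scaleR_conv_of_real field_simps)
  also have "\<dots> = (2 * expectation (\<lambda>\<omega>. iexp (s * X \<omega>)) +
      expectation (\<lambda>\<omega>. complex_of_real (V \<omega>) * iexp (s * X \<omega>))) / c"
    using i1 i2 by simp
  finally show "char D s = (2 * expectation (\<lambda>\<omega>. iexp (s * X \<omega>)) +
      expectation (\<lambda>\<omega>. complex_of_real (V \<omega>) * iexp (s * X \<omega>))) / c" .
  assume [measurable]: "B \<in> sets borel"
  have i3: "integrable M (\<lambda>\<omega>. indicator B (X \<omega>) :: real)"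
    by (rule integrable_const_bound[of _ 1]) auto
  have i4: "integrable M (\<lambda>\<omega>. V \<omega> * indicator B (X \<omega>))"
    by (rule integrable_const_bound[of _ 1]) (use V in \<open>auto simp: indicator_def\<close>)
  have "measure D B = (\<integral>x. indicator B x \<partial>D)"
    by (rule measure_eq_integral_indicator) (simp add: D_def)
  also have "\<dots> = (\<integral>\<omega>. indicator B (X \<omega>) \<partial>?D)"
    unfolding D_def by (rule integral_distr) auto
  also have "\<dots> = (\<integral>\<omega>. ((2 + V \<omega>) / c) *\<^sub>R indicator B (X \<omega>) \<partial>M)"
    by (rule integral_density) (use pos in auto)
  also have "\<dots> = (\<integral>\<omega>. (2 * indicator B (X \<omega>) + V \<omega> * indicator B (X \<omega>)) / c \<partial>M)"
    by (intro Bochner_Integration.integral_cong) (auto simp: field_simps)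
  also have "\<dots> = (2 * expectation (\<lambda>\<omega>. indicator B (X \<omega>)) +
      expectation (\<lambda>\<omega>. V \<omega> * indicator B (X \<omega>))) / c"
    using i3 i4 by simp
  finally show "measure D B = (2 * expectation (\<lambda>\<omega>. indicator B (X \<omega>)) +
      expectation (\<lambda>\<omega>. V \<omega> * indicator B (X \<omega>))) / c" .
qed

text \<open>Levy uniqueness is applied to two tilted laws, one with weight 0 and one with weight
  \<open>V\<close>. Subtracting the unweighted identity removes the artificial shift; the
  normalising constants agree because \<open>wchar\<close> at \<open>s = 0\<close> equates the
  expectations of \<open>V\<close> and \<open>W\<close>.\<close>

lemma weighted_char_uniqueness_real:
  fixes X V :: "'a \<Rightarrow> real" and Y W :: "'b \<Rightarrow> real"
  assumes M: "prob_space M" and N: "prob_space N"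
    and X: "X \<in> borel_measurable M" and V: "V \<in> borel_measurable M" "\<And>\<omega>. \<bar>V \<omega>\<bar> \<le> 1"
    and Y: "Y \<in> borel_measurable N" and W: "W \<in> borel_measurable N" "\<And>\<omega>. \<bar>W \<omega>\<bar> \<le> 1"
    and char: "\<And>s. (\<integral>\<omega>. iexp (s * X \<omega>) \<partial>M) = (\<integral>\<omega>. iexp (s * Y \<omega>) \<partial>N)"
    and wchar: "\<And>s. (\<integral>\<omega>. complex_of_real (V \<omega>) * iexp (s * X \<omega>) \<partial>M) =
      (\<integral>\<omega>. complex_of_real (W \<omega>) * iexp (s * Y \<omega>) \<partial>N)"
    and B: "B \<in> sets borel"
  shows "(\<integral>\<omega>. V \<omega> * indicator B (X \<omega>) \<partial>M) = (\<integral>\<omega>. W \<omega> * indicator B (Y \<omega>) \<partial>N)"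
proof -
  note TM = prob_space.tilted_distr[OF M X] and TN = prob_space.tilted_distr[OF N Y]
  note V0 = borel_measurable_const[of "0::real"]
  have V0': "\<And>\<omega>. \<bar>0::real\<bar> \<le> 1" by simp
  have 0: "(\<integral>\<omega>. V \<omega> \<partial>M) = (\<integral>\<omega>. W \<omega> \<partial>N)"
    using wchar[of 0] by (simp add: of_real_eq_iff)
  have "distr (density M (\<lambda>\<omega>. ennreal ((2 + 0) / (2 + integral\<^sup>L M (\<lambda>_. 0::real))))) borel X =
     distr (density N (\<lambda>\<omega>. ennreal ((2 + 0) / (2 + integral\<^sup>L N (\<lambda>_. 0::real))))) borel Y"
    by (intro Levy_uniqueness TM(2)[OF V0 V0'] TN(2)[OF V0 V0'] ext)
      (subst TM(3)[OF V0 V0'], subst TN(3)[OF V0 V0'], simp only: char, simp)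
  from arg_cong[OF this, of "\<lambda>D. measure D B"]
  have 1: "(\<integral>\<omega>. indicator B (X \<omega>) \<partial>M) = (\<integral>\<omega>. indicator B (Y \<omega>) \<partial>N :: real)"
    by (subst (asm) TM(4)[OF V0 V0' B], subst (asm) TN(4)[OF V0 V0' B]) simp
  have "distr (density M (\<lambda>\<omega>. ennreal ((2 + V \<omega>) / (2 + integral\<^sup>L M V)))) borel X =
     distr (density N (\<lambda>\<omega>. ennreal ((2 + W \<omega>) / (2 + integral\<^sup>L N W)))) borel Y"
    by (intro Levy_uniqueness TM(2)[OF V] TN(2)[OF W] ext)
      (subst TM(3)[OF V], subst TN(3)[OF W], simp only: char wchar 0)
  from arg_cong[OF this, of "\<lambda>D. measure D B"] show ?thesis
    using TM(1)[OF V] by (subst (asm) TM(4)[OF V B], subst (asm) TN(4)[OF W B]) (simp add: 0 1)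
qed

lemma weighted_char_uniqueness:
  fixes X :: "'a \<Rightarrow> real" and Y :: "'b \<Rightarrow> real" and V :: "'a \<Rightarrow> complex" and W :: "'b \<Rightarrow> complex"
  assumes M: "prob_space M" and N: "prob_space N"
    and X: "X \<in> borel_measurable M" and V: "V \<in> borel_measurable M" "\<And>\<omega>. cmod (V \<omega>) \<le> 1"
    and Y: "Y \<in> borel_measurable N" and W: "W \<in> borel_measurable N" "\<And>\<omega>. cmod (W \<omega>) \<le> 1"
    and char: "\<And>s. (\<integral>\<omega>. iexp (s * X \<omega>) \<partial>M) = (\<integral>\<omega>. iexp (s * Y \<omega>) \<partial>N)"
    and wchar: "\<And>s. (\<integral>\<omega>. V \<omega> * iexp (s * X \<omega>) \<partial>M) = (\<integral>\<omega>. W \<omega> * iexp (s * Y \<omega>) \<partial>N)"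
    and B: "B \<in> sets borel"
  shows "(\<integral>\<omega>. V \<omega> * of_real (indicator B (X \<omega>)) \<partial>M) = (\<integral>\<omega>. W \<omega> * of_real (indicator B (Y \<omega>)) \<partial>N)"
proof -
  interpret M: prob_space M by fact
  interpret N: prob_space N by fact
  note [measurable] = X Y V(1) W(1) B
  have iM: "integrable M (\<lambda>\<omega>. V \<omega> * iexp (s * X \<omega>))" for s
    by (rule M.integrable_const_bound[of _ 1]) (use V in \<open>auto simp: norm_mult\<close>)
  have iN: "integrable N (\<lambda>\<omega>. W \<omega> * iexp (s * Y \<omega>))" for s
    by (rule N.integrable_const_bound[of _ 1]) (use W in \<open>auto simp: norm_mult\<close>)
  \<comment> \<open>Conjugation exchanges the frequencies \<open>s\<close> and \<open>-s\<close>, so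
    \<open>wchar\<close> also yields the identity for the conjugated weights, and with it those for
    real and imaginary parts.\<close>
  have cM: "(\<integral>\<omega>. cnj (V \<omega>) * iexp (s * X \<omega>) \<partial>M) = cnj (\<integral>\<omega>. V \<omega> * iexp (- s * X \<omega>) \<partial>M)" for s
    by (subst Bochner_Integration.integral_cnj[symmetric]) (simp add: exp_cnj)
  have cN: "(\<integral>\<omega>. cnj (W \<omega>) * iexp (s * Y \<omega>) \<partial>N) = cnj (\<integral>\<omega>. W \<omega> * iexp (- s * Y \<omega>) \<partial>N)" for s
    by (subst Bochner_Integration.integral_cnj[symmetric]) (simp add: exp_cnj)
  have [measurable]: "cnj \<in> borel_measurable borel"
    by (intro borel_measurable_continuous_onI continuous_intros)
  have icM: "integrable M (\<lambda>\<omega>. cnj (V \<omega>) * iexp (s * X \<omega>))" for s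
    by (rule M.integrable_const_bound[of _ 1]) (use V in \<open>auto simp: norm_mult\<close>)
  have icN: "integrable N (\<lambda>\<omega>. cnj (W \<omega>) * iexp (s * Y \<omega>))" for s
    by (rule N.integrable_const_bound[of _ 1]) (use W in \<open>auto simp: norm_mult\<close>)
  have Re_eq: "complex_of_real (Re z) = (z + cnj z) / 2" for z
    by (simp add: complex_eq_iff)
  obtain k where Im_eq: "complex_of_real (Im z) = k * (z - cnj z)" for z
    by (rule that[of "- \<i> / 2"]) (simp add: complex_eq_iff)
  have bRe: "cmod z \<le> 1 \<Longrightarrow> \<bar>Re z\<bar> \<le> 1" and bIm: "cmod z \<le> 1 \<Longrightarrow> \<bar>Im z\<bar> \<le> 1" for z
    using abs_Re_le_cmod[of z] abs_Im_le_cmod[of z] by linarith+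
  have re: "(\<integral>\<omega>. Re (V \<omega>) * indicator B (X \<omega>) \<partial>M) = (\<integral>\<omega>. Re (W \<omega>) * indicator B (Y \<omega>) \<partial>N)"
  proof (rule weighted_char_uniqueness_real[OF M N X _ bRe[OF V(2)] Y _ bRe[OF W(2)] char _ B])
    fix s
    have "(\<integral>\<omega>. complex_of_real (Re (V \<omega>)) * iexp (s * X \<omega>) \<partial>M) =
       ((\<integral>\<omega>. V \<omega> * iexp (s * X \<omega>) \<partial>M) + (\<integral>\<omega>. cnj (V \<omega>) * iexp (s * X \<omega>) \<partial>M)) / 2"
      unfolding Re_eq using iM[of s] icM[of s]
      by (simp add: distrib_right add_divide_distrib)
    also have "\<dots> = ((\<integral>\<omega>. W \<omega> * iexp (s * Y \<omega>) \<partial>N) + (\<integral>\<omega>. cnj (W \<omega>) * iexp (s * Y \<omega>) \<partial>N)) / 2"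
      unfolding cM cN wchar ..
    also have "\<dots> = (\<integral>\<omega>. complex_of_real (Re (W \<omega>)) * iexp (s * Y \<omega>) \<partial>N)"
      unfolding Re_eq using iN[of s] icN[of s]
      by (simp add: distrib_right add_divide_distrib)
    finally show "(\<integral>\<omega>. complex_of_real (Re (V \<omega>)) * iexp (s * X \<omega>) \<partial>M) =
      (\<integral>\<omega>. complex_of_real (Re (W \<omega>)) * iexp (s * Y \<omega>) \<partial>N)" .
  qed measurable
  have im: "(\<integral>\<omega>. Im (V \<omega>) * indicator B (X \<omega>) \<partial>M) = (\<integral>\<omega>. Im (W \<omega>) * indicator B (Y \<omega>) \<partial>N)"
  proof (rule weighted_char_uniqueness_real[OF M N X _ bIm[OF V(2)] Y _ bIm[OF W(2)] char _ B])
    fix s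
    have "(\<integral>\<omega>. complex_of_real (Im (V \<omega>)) * iexp (s * X \<omega>) \<partial>M) =
       k * ((\<integral>\<omega>. V \<omega> * iexp (s * X \<omega>) \<partial>M) - (\<integral>\<omega>. cnj (V \<omega>) * iexp (s * X \<omega>) \<partial>M))"
      unfolding Im_eq using iM[of s] icM[of s]
      by (simp add: left_diff_distrib right_diff_distrib mult.assoc)
    also have "\<dots> = k * ((\<integral>\<omega>. W \<omega> * iexp (s * Y \<omega>) \<partial>N) - (\<integral>\<omega>. cnj (W \<omega>) * iexp (s * Y \<omega>) \<partial>N))"
      unfolding cM cN wchar ..
    also have "\<dots> = (\<integral>\<omega>. complex_of_real (Im (W \<omega>)) * iexp (s * Y \<omega>) \<partial>N)"
      unfolding Im_eq using iN[of s] icN[of s]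
      by (simp add: left_diff_distrib right_diff_distrib mult.assoc)
    finally show "(\<integral>\<omega>. complex_of_real (Im (V \<omega>)) * iexp (s * X \<omega>) \<partial>M) =
      (\<integral>\<omega>. complex_of_real (Im (W \<omega>)) * iexp (s * Y \<omega>) \<partial>N)" .
  qed measurable
  have i5: "integrable M (\<lambda>\<omega>. V \<omega> * of_real (indicator B (X \<omega>)))"
    by (rule M.integrable_const_bound[of _ 1]) (use V in \<open>auto simp: norm_mult indicator_def\<close>)
  have i6: "integrable N (\<lambda>\<omega>. W \<omega> * of_real (indicator B (Y \<omega>)))"
    by (rule N.integrable_const_bound[of _ 1]) (use W in \<open>auto simp: norm_mult indicator_def\<close>)
  show ?thesis
    using re im i5 i6 by (simp add: complex_eq_iff flip: integral_Re integral_Im)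
qed

text \<open>The exponentials in the joint characteristic function are replaced by indicators one
  coordinate at a time.\<close>
theorem joint_char_uniqueness:
  fixes X :: "'i \<Rightarrow> 'a \<Rightarrow> real" and Y :: "'i \<Rightarrow> 'b \<Rightarrow> real"
  assumes M: "prob_space M" and N: "prob_space N" and I: "finite I"
    and X: "\<And>i. i \<in> I \<Longrightarrow> X i \<in> borel_measurable M"
    and Y: "\<And>i. i \<in> I \<Longrightarrow> Y i \<in> borel_measurable N"
    and char: "\<And>t. (\<integral>\<omega>. iexp (\<Sum>i\<in>I. t i * X i \<omega>) \<partial>M) = (\<integral>\<omega>. iexp (\<Sum>i\<in>I. t i * Y i \<omega>) \<partial>N)"
  shows "distr M (\<Pi>\<^sub>M i\<in>I. borel) (\<lambda>\<omega>. \<lambda>i\<in>I. X i \<omega>) = distr N (\<Pi>\<^sub>M i\<in>I. borel) (\<lambda>\<omega>. \<lambda>i\<in>I. Y i \<omega>)"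
proof -
  interpret M: prob_space M by fact
  interpret N: prob_space N by fact
  have mixed: "(\<integral>\<omega>. (\<Prod>i\<in>J. of_real (indicator (B i) (X i \<omega>))) * iexp (\<Sum>i\<in>I - J. t i * X i \<omega>) \<partial>M) =
      (\<integral>\<omega>. (\<Prod>i\<in>J. of_real (indicator (B i) (Y i \<omega>))) * iexp (\<Sum>i\<in>I - J. t i * Y i \<omega>) \<partial>N)"
    if "J \<subseteq> I" and B: "\<And>i. B i \<in> sets borel" for J t and B :: "'i \<Rightarrow> real set"
    using finite_subset[OF that(1) I] that(1)
  proof (induction J arbitrary: t rule: finite_induct)
    case empty
    then show ?case using char by simp
  next
    case (insert j J)
    have j: "j \<in> I" "j \<notin> J" and JI: "J \<subseteq> I" using insert by auto
    have split: "I - J = insert j (I - insert j J)" using j by auto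
    have fin: "finite (I - insert j J)" using I by simp
    define V :: "'a \<Rightarrow> complex" where "V \<omega> = (\<Prod>i\<in>J. of_real (indicator (B i) (X i \<omega>))) * iexp (\<Sum>i\<in>I - insert j J. t i * X i \<omega>)" for \<omega>
    define W :: "'b \<Rightarrow> complex" where "W \<omega> = (\<Prod>i\<in>J. of_real (indicator (B i) (Y i \<omega>))) * iexp (\<Sum>i\<in>I - insert j J. t i * Y i \<omega>)" for \<omega>
    have Xm: "X i \<in> borel_measurable M" if "i \<in> insert j J \<or> i \<in> I" for i using that X JI j by auto
    have Ym: "Y i \<in> borel_measurable N" if "i \<in> insert j J \<or> i \<in> I" for i using that Y JI j by auto
    have indM: "(\<lambda>\<omega>. complex_of_real (indicator (B i) (X i \<omega>))) \<in> borel_measurable M" if "i \<in> J" for i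
      using Xm[of i] that B[of i] by simp
    have indN: "(\<lambda>\<omega>. complex_of_real (indicator (B i) (Y i \<omega>))) \<in> borel_measurable N" if "i \<in> J" for i
      using Ym[of i] that B[of i] by simp
    have sM: "(\<lambda>\<omega>. \<Sum>i\<in>I - insert j J. t i * X i \<omega>) \<in> borel_measurable M"
      by (intro borel_measurable_sum borel_measurable_times Xm) auto
    have sN: "(\<lambda>\<omega>. \<Sum>i\<in>I - insert j J. t i * Y i \<omega>) \<in> borel_measurable N"
      by (intro borel_measurable_sum borel_measurable_times Ym) auto
    have Vm: "V \<in> borel_measurable M"
      unfolding V_def by (intro borel_measurable_times borel_measurable_prod indM) (use sM in measurable)
    have Wm: "W \<in> borel_measurable N"
      unfolding W_def by (intro borel_measurable_times borel_measurable_prod indN) (use sN in measurable)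
    have Vb: "cmod (V \<omega>) \<le> 1" for \<omega>
      unfolding V_def norm_mult prod_norm[symmetric] by (auto intro!: prod_le_1 simp: indicator_def)
    have Wb: "cmod (W \<omega>) \<le> 1" for \<omega>
      unfolding W_def norm_mult prod_norm[symmetric] by (auto intro!: prod_le_1 simp: indicator_def)
    have upd: "(\<Sum>i\<in>I - insert j J. (t(j := s)) i * Z i) = (\<Sum>i\<in>I - insert j J. t i * Z i)" for s and Z :: "'i \<Rightarrow> real"
      by (intro sum.cong) auto
    have ex: "iexp (\<Sum>i\<in>I - J. (t(j := s)) i * Z i) = iexp (s * Z j) * iexp (\<Sum>i\<in>I - insert j J. t i * Z i)"
      for s and Z :: "'i \<Rightarrow> real"
      unfolding split sum.insert[OF fin, of j, simplified] upd by (simp add: exp_add distrib_left)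
    have ch: "(\<integral>\<omega>. iexp (s * X j \<omega>) \<partial>M) = (\<integral>\<omega>. iexp (s * Y j \<omega>) \<partial>N)" for s
      using char[of "\<lambda>i. if i = j then s else 0"] I j by (simp add: if_distrib[of "\<lambda>x. x * _"] cong: if_cong)
    have wch: "(\<integral>\<omega>. V \<omega> * iexp (s * X j \<omega>) \<partial>M) = (\<integral>\<omega>. W \<omega> * iexp (s * Y j \<omega>) \<partial>N)" for s
      using insert.IH[OF JI, of "t(j := s)"] unfolding ex V_def W_def by (simp add: mult_ac)
    have "(\<integral>\<omega>. V \<omega> * of_real (indicator (B j) (X j \<omega>)) \<partial>M) = (\<integral>\<omega>. W \<omega> * of_real (indicator (B j) (Y j \<omega>)) \<partial>N)"
      by (rule weighted_char_uniqueness[OF M N X[OF j(1)] Vm Vb Y[OF j(1)] Wm Wb ch wch B])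
    then show ?case using insert.hyps by (simp add: V_def W_def mult_ac)
  qed
  let ?P = "\<Pi>\<^sub>M i\<in>I. borel :: real measure"
  have Xr: "(\<lambda>\<omega>. \<lambda>i\<in>I. X i \<omega>) \<in> measurable M ?P" using X by (intro measurable_restrict) auto
  have Yr: "(\<lambda>\<omega>. \<lambda>i\<in>I. Y i \<omega>) \<in> measurable N ?P" using Y by (intro measurable_restrict) auto
  interpret dM: prob_space "distr M ?P (\<lambda>\<omega>. \<lambda>i\<in>I. X i \<omega>)" by (rule M.prob_space_distr[OF Xr])
  interpret dN: prob_space "distr N ?P (\<lambda>\<omega>. \<lambda>i\<in>I. Y i \<omega>)" by (rule N.prob_space_distr[OF Yr])
  show ?thesis
  proof (rule measure_eqI_PiM_finite[OF I])
    fix A :: "'i \<Rightarrow> real set" assume A: "\<And>i. i \<in> I \<Longrightarrow> A i \<in> sets borel"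
    define B where "B i = (if i \<in> I then A i else {})" for i
    have B: "B i \<in> sets borel" for i using A by (simp add: B_def)
    have box: "Pi\<^sub>E I A \<in> sets ?P" using A I by (intro sets_PiM_I_finite) auto
    have ind: "(\<Prod>i\<in>I. complex_of_real (indicator (B i) (Z i))) = of_real (indicator (Pi\<^sub>E I A) (\<lambda>i\<in>I. Z i))"
      for Z :: "'i \<Rightarrow> real"
      using I by (auto simp: indicator_def B_def PiE_def Pi_def)
    have mX: "measure (distr M ?P (\<lambda>\<omega>. \<lambda>i\<in>I. X i \<omega>)) (Pi\<^sub>E I A) =
        (\<integral>x. indicator (Pi\<^sub>E I A) x \<partial>distr M ?P (\<lambda>\<omega>. \<lambda>i\<in>I. X i \<omega>))"
      by (rule measure_eq_integral_indicator) (use box in simp)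
    have mY: "measure (distr N ?P (\<lambda>\<omega>. \<lambda>i\<in>I. Y i \<omega>)) (Pi\<^sub>E I A) =
        (\<integral>x. indicator (Pi\<^sub>E I A) x \<partial>distr N ?P (\<lambda>\<omega>. \<lambda>i\<in>I. Y i \<omega>))"
      by (rule measure_eq_integral_indicator) (use box in simp)
    have iX: "(\<integral>x. indicator (Pi\<^sub>E I A) x \<partial>distr M ?P (\<lambda>\<omega>. \<lambda>i\<in>I. X i \<omega>)) =
        (\<integral>\<omega>. indicator (Pi\<^sub>E I A) (\<lambda>i\<in>I. X i \<omega>) \<partial>M :: real)"
      by (rule integral_distr[OF Xr]) (use box in simp)
    have iY: "(\<integral>x. indicator (Pi\<^sub>E I A) x \<partial>distr N ?P (\<lambda>\<omega>. \<lambda>i\<in>I. Y i \<omega>)) =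
        (\<integral>\<omega>. indicator (Pi\<^sub>E I A) (\<lambda>i\<in>I. Y i \<omega>) \<partial>N :: real)"
      by (rule integral_distr[OF Yr]) (use box in simp)
    \<comment> \<open>With \<open>J = I\<close> no exponential is left and both sides are
      probabilities of boxes, which determine a law on the finite product.\<close>
    have "(\<integral>\<omega>. (\<Prod>i\<in>I. of_real (indicator (B i) (X i \<omega>))) * iexp (\<Sum>i\<in>I - I. 0 * X i \<omega>) \<partial>M) =
      (\<integral>\<omega>. (\<Prod>i\<in>I. of_real (indicator (B i) (Y i \<omega>))) * iexp (\<Sum>i\<in>I - I. 0 * Y i \<omega>) \<partial>N)"
      by (rule mixed[OF subset_refl B])
    then have mx: "(\<integral>\<omega>. (\<Prod>i\<in>I. complex_of_real (indicator (B i) (X i \<omega>))) \<partial>M) =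
      (\<integral>\<omega>. (\<Prod>i\<in>I. of_real (indicator (B i) (Y i \<omega>))) \<partial>N)"
      by simp
    have "complex_of_real (measure (distr M ?P (\<lambda>\<omega>. \<lambda>i\<in>I. X i \<omega>)) (Pi\<^sub>E I A)) =
        complex_of_real (measure (distr N ?P (\<lambda>\<omega>. \<lambda>i\<in>I. Y i \<omega>)) (Pi\<^sub>E I A))"
      using mx unfolding mX mY iX iY ind integral_complex_of_real .
    then show "emeasure (distr M ?P (\<lambda>\<omega>. \<lambda>i\<in>I. X i \<omega>)) (Pi\<^sub>E I A) =
        emeasure (distr N ?P (\<lambda>\<omega>. \<lambda>i\<in>I. Y i \<omega>)) (Pi\<^sub>E I A)"
      by (simp add: dM.emeasure_eq_measure dN.emeasure_eq_measure)
  next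
    show "range (\<lambda>_::nat. Pi\<^sub>E I (\<lambda>_. UNIV)) \<subseteq> prod_algebra I (\<lambda>_. borel :: real measure)"
      using I by (auto intro!: prod_algebraI_finite)
  qed (auto simp: space_PiM dM.emeasure_eq_measure)
qed

section \<open>Rotation invariance of Gaussian arrays\<close>

text \<open>The reflection in the hyperplane orthogonal to \<open>g - g'\<close> exchanges two
  vectors of equal length.\<close>

lemma householder:
  assumes "vdot m g g = vdot m g' g'"
  shows "\<exists>R. orthonormal m m R \<and> (\<forall>i<m. vdot m (R i) g = g' i)"
proof -
  define w where "w i = g i - g' i" for i
  \<comment> \<open>If \<open>w\<close> vanishes below \<open>m\<close>, division by zero gives
    \<open>\<beta> = 0\<close> and \<open>R\<close> is the identity, as it should be when
    \<open>g\<close> and \<open>g'\<close> agree.\<close>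
  define \<beta> where "\<beta> = 2 / vdot m w w"
  define R where "R i k = (if i = k then 1 else 0) - \<beta> * w i * w k" for i k
  have Rx: "vdot m (R i) x = x i - \<beta> * w i * vdot m w x" if "i < m" for i x
  proof -
    have "vdot m (R i) x = (\<Sum>k<m. (if i = k then x k else 0) - \<beta> * w i * (w k * x k))"
      unfolding vdot_def by (intro sum.cong) (auto simp: R_def algebra_simps)
    then show ?thesis using that by (simp add: sum_subtractf vdot_def sum_distrib_left)
  qed
  have b: "\<beta> * (2 - \<beta> * vdot m w w) = 0" by (simp add: \<beta>_def)
  have "orthonormal m m R" unfolding orthonormal_def
  proof (intro allI impI)
    fix i j assume ij: "i < m" "j < m"
    have "vdot m w (R j) = w j - \<beta> * w j * vdot m w w"
      using Rx[OF ij(2), of w] by (simp add: vdot_commute)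
    then have "vdot m (R i) (R j) = (if i = j then 1 else 0) - \<beta> * (2 - \<beta> * vdot m w w) * w i * w j"
      using ij by (simp add: Rx, simp add: R_def algebra_simps)
    then show "vdot m (R i) (R j) = (if i = j then 1 else 0)" by (simp add: b)
  qed
  moreover have "vdot m (R i) g = g' i" if i: "i < m" for i
  proof (cases "vdot m w w = 0")
    case True
    then show ?thesis using i by (simp add: Rx \<beta>_def) (simp add: vdot_self_eq_0 w_def)
  next
    case False
    have "vdot m w w = 2 * vdot m w g"
      unfolding w_def using assms by (simp add: vdot_diff_left vdot_diff_right vdot_commute[of m g' g])
    then show ?thesis using i False by (simp add: Rx \<beta>_def field_simps) (simp add: w_def)
  qed
  ultimately show ?thesis by blast
qed

section \<open>Projections and angles under rotation and scaling\<close>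

lemma mat_inv_cong:
  assumes "\<And>i j. i < p \<Longrightarrow> j < p \<Longrightarrow> A i j = B i j"
  shows "mat_inv p A = mat_inv p B"
  unfolding mat_inv_def using assms by (simp cong: sum.cong_simp)

lemma proj_sq_cong:
  assumes "\<And>c i. c < p \<Longrightarrow> i < m \<Longrightarrow> y c i = y' c i" "\<And>i. i < m \<Longrightarrow> g i = g' i"
  shows "proj_sq m p y g = proj_sq m p y' g'"
proof -
  have "mat_inv p (\<lambda>c d. vdot m (y c) (y d)) = mat_inv p (\<lambda>c d. vdot m (y' c) (y' d))"
    by (intro mat_inv_cong vdot_cong) (simp_all add: assms)
  moreover have "vdot m (y c) g = vdot m (y' c) g'" if "c < p" for c
    using that by (intro vdot_cong) (simp_all add: assms)
  ultimately show ?thesis unfolding proj_sq_def quad_form_def by simp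
qed

lemma proj_sq_rotate:
  assumes "orthonormal m m R"
  shows "proj_sq m p (\<lambda>c i. vdot m (R i) (y c)) (\<lambda>i. vdot m (R i) g) = proj_sq m p y g"
  unfolding proj_sq_def by (simp add: vdot_rotate[OF assms])

lemma proj_sq_scale: "proj_sq m p y (\<lambda>i. c * g i) = c\<^sup>2 * proj_sq m p y g"
  unfolding proj_sq_def quad_form_def vdot_scale_right sum_distrib_left
  by (intro sum.cong) (simp_all add: power2_eq_square)

definition cos_sq :: "nat \<Rightarrow> nat \<Rightarrow> (nat \<Rightarrow> nat \<Rightarrow> real) \<Rightarrow> (nat \<Rightarrow> real) \<Rightarrow> real" where
  "cos_sq m p y g = proj_sq m p y g / vdot m g g"

lemma cos_sq_cong:
  assumes "\<And>c i. c < p \<Longrightarrow> i < m \<Longrightarrow> y c i = y' c i" "\<And>i. i < m \<Longrightarrow> g i = g' i"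
  shows "cos_sq m p y g = cos_sq m p y' g'"
  unfolding cos_sq_def using proj_sq_cong[OF assms] vdot_cong[of m g g' g g'] assms(2) by simp

lemma cos_sq_rotate:
  assumes "orthonormal m m R"
  shows "cos_sq m p (\<lambda>c i. vdot m (R i) (y c)) (\<lambda>i. vdot m (R i) g) = cos_sq m p y g"
  unfolding cos_sq_def proj_sq_rotate[OF assms] vdot_rotate[OF assms] ..

lemma cos_sq_scale: "c \<noteq> 0 \<Longrightarrow> cos_sq m p y (\<lambda>i. c * g i) = cos_sq m p y g"
  by (simp add: cos_sq_def proj_sq_scale vdot_scale_left vdot_scale_right power2_eq_square)

lemma measurable_vdot:
  assumes "\<And>i. i < m \<Longrightarrow> (\<lambda>\<omega>. x \<omega> i) \<in> borel_measurable M"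
    "\<And>i. i < m \<Longrightarrow> (\<lambda>\<omega>. y \<omega> i) \<in> borel_measurable M"
  shows "(\<lambda>\<omega>. vdot m (x \<omega>) (y \<omega>)) \<in> borel_measurable M"
  unfolding vdot_def by (intro borel_measurable_sum borel_measurable_times assms) auto

lemma measurable_cos_sq:
  assumes y: "\<And>c i. c < p \<Longrightarrow> i < m \<Longrightarrow> (\<lambda>\<omega>. y \<omega> c i) \<in> borel_measurable M"
    and g: "\<And>i. i < m \<Longrightarrow> (\<lambda>\<omega>. g \<omega> i) \<in> borel_measurable M"
  shows "(\<lambda>\<omega>. cos_sq m p (y \<omega>) (g \<omega>)) \<in> borel_measurable M"
  unfolding cos_sq_def proj_sq_def
  by (intro borel_measurable_divide measurable_quad_form_mat_inv measurable_vdot y g)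

text \<open>A Gaussian array has \<open>p\<close> columns in \<open>\<real>\<^sup>m\<close> whose \<open>m\<close> rows are independent with law \<open>N(0, \<Sigma>)\<close>,
  expressed through the joint characteristic function.\<close>
definition gauss_array ::
    "'a measure \<Rightarrow> nat \<Rightarrow> nat \<Rightarrow> (nat \<Rightarrow> nat \<Rightarrow> real) \<Rightarrow> ('a \<Rightarrow> nat \<Rightarrow> nat \<Rightarrow> real) \<Rightarrow> bool" where
  "gauss_array M m p \<Sigma> y \<longleftrightarrow> (\<forall>c<p. \<forall>i<m. (\<lambda>\<omega>. y \<omega> c i) \<in> borel_measurable M) \<and>
    (\<forall>b. (\<integral>\<omega>. iexp (\<Sum>i<m. \<Sum>c<p. b i c * y \<omega> c i) \<partial>M) =
      of_real (exp (- (\<Sum>i<m. quad_form p \<Sigma> (b i)) / 2)))"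

lemma gauss_arrayD:
  assumes "gauss_array M m p \<Sigma> y"
  shows "c < p \<Longrightarrow> i < m \<Longrightarrow> (\<lambda>\<omega>. y \<omega> c i) \<in> borel_measurable M"
    and "(\<integral>\<omega>. iexp (\<Sum>i<m. \<Sum>c<p. b i c * y \<omega> c i) \<partial>M) =
      of_real (exp (- (\<Sum>i<m. quad_form p \<Sigma> (b i)) / 2))"
  using assms unfolding gauss_array_def by blast+

text \<open>The rotation is moved from the array to the frequencies. The exponent depends on
  \<open>b\<close> only through the inner products of the vectors \<open>\<lambda>i. b i c\<close>,
  and a rotation preserves these.\<close>

lemma gauss_array_rotate:
  assumes y: "gauss_array M m p \<Sigma> y" and R: "orthonormal m m R"
  shows "gauss_array M m p \<Sigma> (\<lambda>\<omega> c i. vdot m (R i) (y \<omega> c))"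
  unfolding gauss_array_def
proof (intro conjI allI impI)
  fix c i assume "c < p" "i < m"
  then show "(\<lambda>\<omega>. vdot m (R i) (y \<omega> c)) \<in> borel_measurable M"
    using y by (intro measurable_vdot) (auto simp: gauss_array_def)
next
  fix b :: "nat \<Rightarrow> nat \<Rightarrow> real"
  define b' where "b' k c = (\<Sum>i<m. R i k * b i c)" for k c
  have lin: "(\<Sum>i<m. \<Sum>c<p. b i c * vdot m (R i) (y \<omega> c)) = (\<Sum>k<m. \<Sum>c<p. b' k c * y \<omega> c k)" for \<omega>
  proof -
    have "(\<Sum>i<m. \<Sum>c<p. b i c * vdot m (R i) (y \<omega> c)) = (\<Sum>c<p. \<Sum>i<m. \<Sum>k<m. R i k * b i c * y \<omega> c k)"
      by (subst sum.swap) (simp add: vdot_def sum_distrib_left mult_ac)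
    also have "\<dots> = (\<Sum>c<p. \<Sum>k<m. b' k c * y \<omega> c k)"
      by (rule sum.cong[OF refl], subst sum.swap) (simp add: b'_def sum_distrib_right)
    also have "\<dots> = (\<Sum>k<m. \<Sum>c<p. b' k c * y \<omega> c k)" by (rule sum.swap)
    finally show ?thesis .
  qed
  have quad: "(\<Sum>k<m. quad_form p \<Sigma> (b' k)) = (\<Sum>i<m. quad_form p \<Sigma> (b i))"
  proof -
    have one: "(\<Sum>k<m. b' k c * b' k d) = (\<Sum>i<m. b i c * b i d)" for c d
    proof -
      have "(\<Sum>k<m. b' k c * b' k d) = (\<Sum>k<m. \<Sum>i<m. \<Sum>j<m. b i c * b j d * (R i k * R j k))"
        by (simp add: b'_def sum_product mult_ac)
      also have "\<dots> = (\<Sum>i<m. \<Sum>j<m. b i c * b j d * vdot m (R i) (R j))"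
        unfolding vdot_def sum_distrib_left
        by (subst sum.swap, rule sum.cong[OF refl], rule sum.swap)
      also have "\<dots> = (\<Sum>i<m. b i c * b i d)"
        by (simp add: orthonormalD[OF R] if_distrib[of "\<lambda>x. _ * x"] cong: if_cong sum.cong_simp)
      finally show ?thesis .
    qed
    have q: "(\<Sum>k<m. quad_form p \<Sigma> (a k)) = (\<Sum>c<p. \<Sum>d<p. \<Sigma> c d * (\<Sum>k<m. a k c * a k d))" for a
      unfolding quad_form_def sum_distrib_left
      by (subst sum.swap, rule sum.cong[OF refl], subst sum.swap) (simp add: mult_ac)
    show ?thesis unfolding q one ..
  qed
  show "(\<integral>\<omega>. iexp (\<Sum>i<m. \<Sum>c<p. b i c * vdot m (R i) (y \<omega> c)) \<partial>M) =
      of_real (exp (- (\<Sum>i<m. quad_form p \<Sigma> (b i)) / 2))"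
    using y unfolding gauss_array_def lin quad[symmetric] by blast
qed

text \<open>Equal joint characteristic functions give equal laws on a finite product space, whose
  elements carry information only on \<open>{..<m} \<times> {..<p}\<close>; \<open>cong\<close>
  states that \<open>\<Phi>\<close> reads no other entries.\<close>

lemma gauss_array_distr_eq:
  fixes \<Phi> :: "(nat \<Rightarrow> nat \<Rightarrow> real) \<Rightarrow> real"
  assumes M: "prob_space M" and N: "prob_space N"
    and y: "gauss_array M m p \<Sigma> y" and z: "gauss_array N m p \<Sigma> z"
    and cong: "\<And>u v. (\<And>c i. c < p \<Longrightarrow> i < m \<Longrightarrow> u c i = v c i) \<Longrightarrow> \<Phi> u = \<Phi> v"
    and meas: "(\<lambda>u. \<Phi> (\<lambda>c i. u (i, c))) \<in> borel_measurable (\<Pi>\<^sub>M a\<in>{..<m} \<times> {..<p}. borel)"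
  shows "distr M borel (\<lambda>\<omega>. \<Phi> (y \<omega>)) = distr N borel (\<lambda>\<omega>. \<Phi> (z \<omega>))"
proof -
  let ?I = "{..<m} \<times> {..<p}"
  let ?P = "\<Pi>\<^sub>M a\<in>?I. borel :: real measure"
  let ?Y = "\<lambda>\<omega>. \<lambda>a\<in>?I. y \<omega> (snd a) (fst a)" and ?Z = "\<lambda>\<omega>. \<lambda>a\<in>?I. z \<omega> (snd a) (fst a)"
  have Y: "?Y \<in> measurable M ?P" and Z: "?Z \<in> measurable N ?P"
    using y z by (auto intro!: measurable_restrict simp: gauss_array_def)
  have "distr M ?P ?Y = distr N ?P ?Z"
  proof (rule joint_char_uniqueness[OF M N])
    fix t :: "nat \<times> nat \<Rightarrow> real"
    have s: "(\<Sum>a\<in>?I. t a * w (snd a) (fst a)) = (\<Sum>i<m. \<Sum>c<p. t (i, c) * w c i)" for w :: "nat \<Rightarrow> nat \<Rightarrow> real"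
      by (subst sum.cartesian_product) (auto intro!: sum.cong)
    show "(\<integral>\<omega>. iexp (\<Sum>a\<in>?I. t a * y \<omega> (snd a) (fst a)) \<partial>M) = (\<integral>\<omega>. iexp (\<Sum>a\<in>?I. t a * z \<omega> (snd a) (fst a)) \<partial>N)"
      unfolding s gauss_arrayD(2)[OF y, of "\<lambda>i c. t (i, c)"] gauss_arrayD(2)[OF z, of "\<lambda>i c. t (i, c)"] ..
  qed (use y z in \<open>auto simp: gauss_array_def\<close>)
  then have "distr (distr M ?P ?Y) borel (\<lambda>u. \<Phi> (\<lambda>c i. u (i, c))) = distr (distr N ?P ?Z) borel (\<lambda>u. \<Phi> (\<lambda>c i. u (i, c)))"
    by simp
  then have "distr M borel (\<lambda>\<omega>. \<Phi> (\<lambda>c i. ?Y \<omega> (i, c))) = distr N borel (\<lambda>\<omega>. \<Phi> (\<lambda>c i. ?Z \<omega> (i, c)))"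
    by (simp only: distr_distr[OF meas Y] distr_distr[OF meas Z] comp_def)
  moreover have "\<Phi> (\<lambda>c i. ?Y \<omega> (i, c)) = \<Phi> (y \<omega>)" for \<omega> by (rule cong) auto
  moreover have "\<Phi> (\<lambda>c i. ?Z \<omega> (i, c)) = \<Phi> (z \<omega>)" for \<omega> by (rule cong) auto
  ultimately show ?thesis by (simp only:)
qed

section \<open>Standard Gaussian vectors as one-column arrays\<close>

abbreviation std_gauss :: "nat \<Rightarrow> (nat \<Rightarrow> real) measure" where
  "std_gauss m \<equiv> \<Pi>\<^sub>M i\<in>{..<m}. std_normal_distribution"

lemma prob_space_std_normal: "prob_space std_normal_distribution"
  using real_dist_normal_dist by (simp add: real_distribution_def)

lemma prob_space_std_gauss: "prob_space (std_gauss m)"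
  by (intro prob_space_PiM prob_space_std_normal)

text \<open>For \<open>i \<ge> m\<close> the coordinate is the constant \<open>undefined\<close> on
  the whole space, hence measurable as well.\<close>

lemma measurable_std_gauss_component:
  "(\<lambda>g. g i) \<in> borel_measurable (std_gauss m)"
proof (cases "i < m")
  case True
  then show ?thesis
    using measurable_component_singleton[of i "{..<m}" "\<lambda>_. std_normal_distribution"] by simp
next
  case False
  then have "g i = undefined" if "g \<in> space (std_gauss m)" for g
    using that by (auto simp: space_PiM PiE_def extensional_def)
  then show ?thesis by (subst measurable_cong[where g = "\<lambda>_. undefined"]) auto
qed

text \<open>A standard Gaussian vector is a single column with variance 1, so the rotation
  invariance proved for arrays covers it.\<close>

lemma gauss_array_std_gauss: "gauss_array (std_gauss m) m 1 (\<lambda>_ _. 1) (\<lambda>g c. g)"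
  unfolding gauss_array_def
proof (intro conjI allI impI)
  fix b :: "nat \<Rightarrow> nat \<Rightarrow> real"
  interpret S: prob_space std_normal_distribution by (rule prob_space_std_normal)
  interpret product_sigma_finite "\<lambda>_. std_normal_distribution" ..
  have "(\<integral>g. iexp (\<Sum>i<m. \<Sum>c<1. b i c * g i) \<partial>std_gauss m) = (\<integral>g. (\<Prod>i<m. iexp (b i 0 * g i)) \<partial>std_gauss m)"
    by (simp add: sum_distrib_left exp_sum)
  also have "\<dots> = (\<Prod>i<m. \<integral>x. iexp (b i 0 * x) \<partial>std_normal_distribution)"
    by (intro product_integral_prod S.integrable_const_bound[of _ 1]) auto
  also have "\<dots> = (\<Prod>i<m. of_real (exp (- (b i 0)\<^sup>2 / 2)))"
    using char_std_normal_distribution by (intro prod.cong refl) (simp add: char_def fun_eq_iff)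
  also have "\<dots> = of_real (exp (- (\<Sum>i<m. quad_form 1 (\<lambda>_ _. 1) (b i)) / 2))"
    by (simp add: quad_form_def exp_sum[symmetric] sum_negf sum_divide_distrib power2_eq_square flip: of_real_prod)
  finally show "(\<integral>g. iexp (\<Sum>i<m. \<Sum>c<1. b i c * g i) \<partial>std_gauss m) =
    of_real (exp (- (\<Sum>i<m. quad_form 1 (\<lambda>_ _. 1) (b i)) / 2))" .
qed (simp add: measurable_std_gauss_component)

lemma std_gauss_rotate:
  fixes \<Phi> :: "(nat \<Rightarrow> real) \<Rightarrow> real"
  assumes R: "orthonormal m m R"
    and cong: "\<And>u v. (\<And>i. i < m \<Longrightarrow> u i = v i) \<Longrightarrow> \<Phi> u = \<Phi> v"
    and meas: "\<Phi> \<in> borel_measurable (\<Pi>\<^sub>M i\<in>{..<m}. borel)"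
  shows "distr (std_gauss m) borel (\<lambda>g. \<Phi> (\<lambda>i. vdot m (R i) g)) = distr (std_gauss m) borel \<Phi>"
proof -
  have "distr (std_gauss m) borel (\<lambda>g. (\<lambda>u. \<Phi> (u 0)) (\<lambda>c i. vdot m (R i) g)) =
     distr (std_gauss m) borel (\<lambda>g. (\<lambda>u. \<Phi> (u 0)) (\<lambda>c. g))"
  proof (rule gauss_array_distr_eq[OF prob_space_std_gauss prob_space_std_gauss
        gauss_array_rotate[OF gauss_array_std_gauss R] gauss_array_std_gauss])
    show "(\<lambda>u. \<Phi> (\<lambda>i. u (i, 0))) \<in> borel_measurable (\<Pi>\<^sub>M a\<in>{..<m} \<times> {..<1::nat}. borel)"
    proof -
      have "(\<lambda>u. \<lambda>i\<in>{..<m}. u (i, 0::nat)) \<in> measurable (\<Pi>\<^sub>M a\<in>{..<m} \<times> {..<1::nat}. borel) (\<Pi>\<^sub>M i\<in>{..<m}. borel :: real measure)"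
        by (intro measurable_restrict measurable_component_singleton) auto
      from measurable_compose[OF this meas]
      have "(\<lambda>u. \<Phi> (\<lambda>i\<in>{..<m}. u (i, 0))) \<in> borel_measurable (\<Pi>\<^sub>M a\<in>{..<m} \<times> {..<1::nat}. borel)" .
      moreover have "\<Phi> (\<lambda>i\<in>{..<m}. u (i, 0)) = \<Phi> (\<lambda>i. u (i, 0))" for u :: "nat \<times> nat \<Rightarrow> real"
        by (rule cong) auto
      ultimately show ?thesis by simp
    qed
  qed (rule cong, simp)
  then show ?thesis by simp
qed

text \<open>No conditional law is formed. The law of \<open>cos_sq\<close> is the same for all
  nonzero directions, so it may be averaged over a Gaussian \<open>g\<close>; Fubini then puts the
  integral over \<open>g\<close> inside, where the columns are fixed and almost surely
  independent.\<close>

theorem distr_cos_sq: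
  assumes M: "prob_space M" and y: "gauss_array M m p \<Sigma> y"
    and li: "AE \<omega> in M. lin_indep m p (y \<omega>)" and pm: "p \<le> m" and e: "vdot m e e \<noteq> 0"
  shows "distr M borel (\<lambda>\<omega>. cos_sq m p (y \<omega>) e) =
    distr (std_gauss m) borel (\<lambda>g. (\<Sum>d<p. (g d)\<^sup>2) / (\<Sum>d<m. (g d)\<^sup>2))"
proof -
  interpret M: prob_space M by fact
  interpret N: prob_space "std_gauss m" by (rule prob_space_std_gauss)
  interpret NM: pair_prob_space "std_gauss m" M ..
  let ?N = "std_gauss m"
  let ?F = "\<lambda>g. (\<Sum>d<p. (g d)\<^sup>2) / (\<Sum>d<m. (g d)\<^sup>2) :: real"
  have m: "0 < m" using e by (cases m) (auto simp: vdot_def)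
  have ym: "(\<lambda>\<omega>. y \<omega> c i) \<in> borel_measurable M" if "c < p" "i < m" for c i
    using y that by (simp add: gauss_array_def)
  have Fm: "?F \<in> borel_measurable ?N"
    by (intro borel_measurable_divide borel_measurable_sum borel_measurable_power measurable_std_gauss_component)
  have cm: "(\<lambda>\<omega>. cos_sq m p (y \<omega>) g) \<in> borel_measurable M" for g
    by (intro measurable_cos_sq ym) auto
  have cN: "(\<lambda>g. cos_sq m p u g) \<in> borel_measurable ?N" for u
    by (intro measurable_cos_sq measurable_std_gauss_component) auto
  have cNM: "(\<lambda>(g, \<omega>). cos_sq m p (y \<omega>) g) \<in> borel_measurable (?N \<Otimes>\<^sub>M M)"
    unfolding case_prod_beta
    by (intro measurable_cos_sq measurable_compose[OF measurable_snd ym]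
        measurable_compose[OF measurable_fst measurable_std_gauss_component])
  have swap: "distr M borel (\<lambda>\<omega>. cos_sq m p (y \<omega>) e) = distr M borel (\<lambda>\<omega>. cos_sq m p (y \<omega>) g)"
    if g: "vdot m g g \<noteq> 0" for g
  proof -
    \<comment> \<open>A reflection preserves length, so \<open>g\<close> is first scaled to the
      length of \<open>e\<close>; \<open>cos_sq\<close> does not see the factor.\<close>
    define s where "s = sqrt (vdot m e e / vdot m g g)"
    have pos: "vdot m e e > 0" "vdot m g g > 0"
      using e g vdot_self_nonneg[of m e] vdot_self_nonneg[of m g] by auto
    then have s: "s \<noteq> 0" "s * s * vdot m g g = vdot m e e" by (auto simp: s_def)
    then have "vdot m e e = vdot m (\<lambda>i. s * g i) (\<lambda>i. s * g i)"
      by (simp add: vdot_scale_left vdot_scale_right mult.assoc)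
    then obtain R where R: "orthonormal m m R" "\<And>i. i < m \<Longrightarrow> vdot m (R i) e = s * g i"
      using householder[of m e "\<lambda>i. s * g i"] by blast
    have "cos_sq m p (y \<omega>) e = cos_sq m p (\<lambda>c i. vdot m (R i) (y \<omega> c)) g" for \<omega>
    proof -
      have "cos_sq m p (y \<omega>) e = cos_sq m p (\<lambda>c i. vdot m (R i) (y \<omega> c)) (\<lambda>i. vdot m (R i) e)"
        by (rule cos_sq_rotate[OF R(1), symmetric])
      also have "\<dots> = cos_sq m p (\<lambda>c i. vdot m (R i) (y \<omega> c)) (\<lambda>i. s * g i)"
        by (intro cos_sq_cong R(2)) auto
      finally show ?thesis using s(1) by (simp add: cos_sq_scale)
    qed
    moreover have "distr M borel (\<lambda>\<omega>. (\<lambda>u. cos_sq m p u g) (\<lambda>c i. vdot m (R i) (y \<omega> c))) =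
       distr M borel (\<lambda>\<omega>. (\<lambda>u. cos_sq m p u g) (y \<omega>))"
    proof (rule gauss_array_distr_eq[OF M M gauss_array_rotate[OF y R(1)] y])
      show "(\<lambda>u. cos_sq m p (\<lambda>c i. u (i, c)) g) \<in> borel_measurable (\<Pi>\<^sub>M a\<in>{..<m} \<times> {..<p}. borel)"
        by (intro measurable_cos_sq measurable_component_singleton) auto
    qed (rule cos_sq_cong, auto)
    ultimately show ?thesis by simp
  qed
  have fix_y: "distr ?N borel (\<lambda>g. cos_sq m p u g) = distr ?N borel ?F" if u: "lin_indep m p u" for u
  proof -
    obtain f where f: "orthonormal m m f" "\<And>g. proj_sq m p u g = (\<Sum>d<p. (vdot m (f d) g)\<^sup>2)"
      using proj_sq_eq[OF u pm] by blast
    \<comment> \<open>In the coordinates given by \<open>f\<close> the columns span the first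
      \<open>p\<close> axes, and the coordinates of \<open>g\<close> in this basis are again
      standard Gaussian.\<close>
    have "cos_sq m p u g = ?F (\<lambda>i. vdot m (f i) g)" for g
      using vdot_rotate[OF f(1), of g g]
      by (simp add: cos_sq_def f(2), simp add: vdot_def[of m "\<lambda>i. vdot m (f i) g"] power2_eq_square)
    moreover have "distr ?N borel (\<lambda>g. ?F (\<lambda>i. vdot m (f i) g)) = distr ?N borel ?F"
    proof (rule std_gauss_rotate[OF f(1)])
      show "?F \<in> borel_measurable (\<Pi>\<^sub>M i\<in>{..<m}. borel)"
        using pm by (intro borel_measurable_divide borel_measurable_sum borel_measurable_power measurable_component_singleton) auto
    qed (use pm in \<open>intro arg_cong2[of _ _ _ _ "(/)"] sum.cong, auto\<close>)
    ultimately show ?thesis by simp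
  qed
  have AE_g: "AE g in ?N. vdot m g g \<noteq> 0"
  proof -
    have "AE x in std_normal_distribution. x \<noteq> (0::real)"
      using AE_lborel_singleton[of "0::real"] by (auto simp: AE_density)
    then have "AE g in ?N. g 0 \<noteq> 0"
      using m prob_space_std_normal by (intro AE_PiM_component[where P = "\<lambda>x. x \<noteq> 0"]) auto
    then show ?thesis by eventually_elim (use m in \<open>auto simp: vdot_self_eq_0\<close>)
  qed
  show ?thesis
  proof (rule measure_eqI)
    fix B :: "real set" assume "B \<in> sets (distr M borel (\<lambda>\<omega>. cos_sq m p (y \<omega>) e))"
    then have B: "B \<in> sets borel" by simp
    have eM: "emeasure (distr M borel (\<lambda>\<omega>. cos_sq m p (y \<omega>) g)) B = (\<integral>\<^sup>+\<omega>. indicator B (cos_sq m p (y \<omega>) g) \<partial>M)" for g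
      using B cm by (simp add: nn_integral_distr flip: nn_integral_indicator)
    have eN: "emeasure (distr ?N borel (\<lambda>g. cos_sq m p u g)) B = (\<integral>\<^sup>+g. indicator B (cos_sq m p u g) \<partial>?N)" for u
      using B cN by (simp add: nn_integral_distr flip: nn_integral_indicator)
    \<comment> \<open>A constant is integrated over the probability measure
      \<open>std_gauss m\<close>; \<open>swap\<close> then makes the integrand depend on
      \<open>g\<close>.\<close>
    have "emeasure (distr M borel (\<lambda>\<omega>. cos_sq m p (y \<omega>) e)) B = (\<integral>\<^sup>+g. emeasure (distr M borel (\<lambda>\<omega>. cos_sq m p (y \<omega>) e)) B \<partial>?N)"
      by (simp add: N.emeasure_space_1)
    also have "\<dots> = (\<integral>\<^sup>+g. emeasure (distr M borel (\<lambda>\<omega>. cos_sq m p (y \<omega>) g)) B \<partial>?N)"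
      using AE_g by (intro nn_integral_cong_AE, eventually_elim) (rule arg_cong[of _ _ "\<lambda>D. emeasure D B"], erule swap)
    also have "\<dots> = (\<integral>\<^sup>+\<omega>. \<integral>\<^sup>+g. indicator B (cos_sq m p (y \<omega>) g) \<partial>?N \<partial>M)"
      unfolding eM
      by (rule NM.Fubini'[symmetric]) (use measurable_compose[OF cNM borel_measurable_indicator[of B]] B in \<open>simp add: case_prod_unfold\<close>)
    also have "\<dots> = (\<integral>\<^sup>+\<omega>. emeasure (distr ?N borel ?F) B \<partial>M)"
      unfolding eN[symmetric] using li by (intro nn_integral_cong_AE, eventually_elim) (simp only: fix_y)
    also have "\<dots> = emeasure (distr ?N borel ?F) B" by (simp add: M.emeasure_space_1)
    finally show "emeasure (distr M borel (\<lambda>\<omega>. cos_sq m p (y \<omega>) e)) B = emeasure (distr ?N borel ?F) B" .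
  qed simp
qed

section \<open>The law of Hotelling's statistic\<close>

text \<open>The singletons \<open>{f j}\<close> are disjoint blocks by injectivity, so
  \<open>indep_vars_restrict\<close> applies to them.\<close>

lemma (in prob_space) indep_vars_reindex_inj:
  assumes ind: "indep_vars M' X I" and f: "inj_on f J" "f ` J \<subseteq> I"
  shows "indep_vars (\<lambda>j. M' (f j)) (\<lambda>j. X (f j)) J"
proof -
  have "indep_vars (\<lambda>j. PiM {f j} M') (\<lambda>j \<omega>. restrict (\<lambda>i. X i \<omega>) {f j}) J"
    by (rule indep_vars_restrict[OF ind]) (use f in \<open>auto simp: disjoint_family_on_def inj_on_def\<close>)
  then have "indep_vars (\<lambda>j. M' (f j)) (\<lambda>j \<omega>. (\<lambda>u. u (f j)) (restrict (\<lambda>i. X i \<omega>) {f j})) J"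
    by (rule indep_vars_compose2) (auto intro: measurable_component_singleton)
  then show ?thesis by simp
qed

text \<open>The Borel sets of \<open>nat \<Rightarrow> real\<close> come from the product topology,
  in which evaluation at \<open>c\<close> is continuous.\<close>

lemma measurable_coordinate:
  "X \<in> borel_measurable M \<Longrightarrow> (\<lambda>\<omega>. X \<omega> c :: real) \<in> borel_measurable M"
  for X :: "'a \<Rightarrow> nat \<Rightarrow> real"
  by (erule measurable_compose[where g = "\<lambda>x. x c"]) (simp add: borel_measurable_continuous_onI)

text \<open>\<open>mvnormal\<close> gives a scalar normal law for each \<open>b\<close> with a
  nonzero entry below \<open>p\<close>; any other \<open>b\<close> gives the constant 0. Positive
  definiteness makes the variance strictly positive, so the functional can be standardised.\<close>

lemma (in prob_space) mvnormal_char: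
  assumes X: "mvnormal M p X \<mu> \<Sigma>" and pd: "pos_def_mat p \<Sigma>"
  shows "expectation (\<lambda>\<omega>. iexp (\<Sum>c<p. b c * (X \<omega> c - \<mu> c))) = of_real (exp (- quad_form p \<Sigma> b / 2))"
proof (cases "\<exists>c<p. b c \<noteq> 0")
  case False
  then show ?thesis by (simp add: quad_form_def prob_space)
next
  case True
  define s where "s = sqrt (quad_form p \<Sigma> b)"
  have q: "quad_form p \<Sigma> b > 0" using pd True by (simp add: pos_def_mat_def)
  then have s: "s > 0" by (simp add: s_def)
  let ?Z = "\<lambda>\<omega>. (vdot p b (X \<omega>) - vdot p b \<mu>) / s"
  have "distributed M lborel (\<lambda>\<omega>. vdot p b (X \<omega>)) (normal_density (vdot p b \<mu>) s)"
    using X True by (simp add: mvnormal_def s_def)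
  then have Z: "distributed M lborel ?Z std_normal_density"
    by (subst (asm) normal_standard_normal_convert[OF s])
  have "s * ?Z \<omega> = vdot p b (X \<omega>) - vdot p b \<mu>" for \<omega>
    using s by simp
  then have "(\<Sum>c<p. b c * (X \<omega> c - \<mu> c)) = s * ?Z \<omega>" for \<omega>
    by (simp only: vdot_diff_right[symmetric]) (simp add: vdot_def)
  then have "expectation (\<lambda>\<omega>. iexp (\<Sum>c<p. b c * (X \<omega> c - \<mu> c))) = expectation (\<lambda>\<omega>. iexp (s * ?Z \<omega>))"
    by (simp only:)
  also have "\<dots> = (\<integral>x. iexp (s * x) \<partial>distr M lborel ?Z)"
    using Z by (subst integral_distr) (auto simp: distributed_def)
  also have "distr M lborel ?Z = std_normal_distribution"
    using Z by (simp add: distributed_def)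
  also have "(\<integral>x. iexp (s * x) \<partial>std_normal_distribution) = of_real (exp (- s\<^sup>2 / 2))"
    using fun_cong[OF char_std_normal_distribution, of s] by (simp add: char_def)
  also have "s\<^sup>2 = quad_form p \<Sigma> b" using q by (simp add: s_def)
  finally show ?thesis by simp
qed

text \<open>The linear functional has a density with respect to Lebesgue measure and so almost
  surely misses any single value.\<close>

lemma (in prob_space) mvnormal_hyperplane:
  assumes X: "mvnormal M p X \<mu> \<Sigma>" and a: "\<exists>c<p. a c \<noteq> 0"
  shows "AE \<omega> in M. vdot p a (\<lambda>c. X \<omega> c - \<mu> c) \<noteq> 0"
proof -
  have D: "distributed M lborel (\<lambda>\<omega>. vdot p a (X \<omega>)) (normal_density (vdot p a \<mu>) (sqrt (quad_form p \<Sigma> a)))"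
    using X a by (simp add: mvnormal_def)
  then have dens: "distr M lborel (\<lambda>\<omega>. vdot p a (X \<omega>)) =
      density lborel (normal_density (vdot p a \<mu>) (sqrt (quad_form p \<Sigma> a)))"
    by (simp add: distributed_def)
  have "AE x in distr M lborel (\<lambda>\<omega>. vdot p a (X \<omega>)). x \<noteq> vdot p a \<mu>"
    unfolding dens by (subst AE_density) (use AE_lborel_singleton[of "vdot p a \<mu>"] in auto)
  then have "AE \<omega> in M. vdot p a (X \<omega>) \<noteq> vdot p a \<mu>"
    using D by (subst (asm) AE_distr_iff) (auto simp: distributed_def)
  then show ?thesis by eventually_elim (simp add: vdot_def right_diff_distrib sum_subtractf)
qed

section \<open>Gaussian samples: joint characteristic function and almost sure independence of the
  columns\<close>

context prob_space
begin

context
  fixes X :: "nat \<Rightarrow> 'a \<Rightarrow> nat \<Rightarrow> real" and m p :: nat and \<mu> and \<Sigma>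
  assumes ind: "indep_vars (\<lambda>_. borel) X {..<m}"
    and norm: "\<And>i. i < m \<Longrightarrow> mvnormal M p (X i) \<mu> \<Sigma>"
    and pd: "pos_def_mat p \<Sigma>"
begin

lemma row_measurable: "i < m \<Longrightarrow> X i \<in> borel_measurable M"
  using ind by (simp add: indep_vars_def2)

lemma gauss_array_rows: "gauss_array M m p \<Sigma> (\<lambda>\<omega> c i. X i \<omega> c - \<mu> c)"
  unfolding gauss_array_def
proof (intro conjI allI impI)
  fix c i assume "c < p" "i < m"
  then show "(\<lambda>\<omega>. X i \<omega> c - \<mu> c) \<in> borel_measurable M"
    by (intro borel_measurable_diff measurable_coordinate row_measurable) auto
next
  fix b :: "nat \<Rightarrow> nat \<Rightarrow> real"
  let ?V = "\<lambda>i \<omega>. \<Sum>c<p. b i c * (X i \<omega> c - \<mu> c)"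
  have "indep_vars (\<lambda>_. borel) (\<lambda>i \<omega>. (\<lambda>x. \<Sum>c<p. b i c * (x c - \<mu> c)) (X i \<omega>)) {..<m}"
    by (rule indep_vars_compose2[OF ind])
      (intro borel_measurable_sum borel_measurable_times borel_measurable_diff measurable_coordinate, auto)
  then have V: "indep_vars (\<lambda>_. borel) ?V {..<m}" by simp
  have Vm: "?V i \<in> borel_measurable M" if "i < m" for i
    using V that by (simp add: indep_vars_def2)
  have "expectation (\<lambda>\<omega>. iexp (\<Sum>i<m. ?V i \<omega>)) = char (distr M borel (\<lambda>\<omega>. \<Sum>i<m. ?V i \<omega>)) 1"
    using Vm by (simp add: char_def integral_distr)
  also have "\<dots> = (\<Prod>i<m. char (distr M borel (?V i)) 1)"
    by (rule char_distr_sum[OF V])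
  also have "\<dots> = (\<Prod>i<m. of_real (exp (- quad_form p \<Sigma> (b i) / 2)))"
  proof (rule prod.cong)
    fix i assume "i \<in> {..<m}"
    then have i: "i < m" by simp
    show "char (distr M borel (?V i)) 1 = of_real (exp (- quad_form p \<Sigma> (b i) / 2))"
      using mvnormal_char[OF norm[OF i] pd, of "b i"] Vm[OF i] by (simp add: char_def integral_distr)
  qed simp
  also have "\<dots> = of_real (exp (- (\<Sum>i<m. quad_form p \<Sigma> (b i)) / 2))"
    by (simp add: exp_sum[symmetric] sum_negf sum_divide_distrib flip: of_real_prod)
  finally show "expectation (\<lambda>\<omega>. iexp (\<Sum>i<m. \<Sum>c<p. b i c * (X i \<omega> c - \<mu> c))) =
      of_real (exp (- (\<Sum>i<m. quad_form p \<Sigma> (b i)) / 2))" .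
qed

text \<open>Rows are added one at a time, because it is the rows that are stochastically
  independent. Fewer than \<open>p\<close> rows have a common nonzero orthogonal vector, and the
  next row almost surely avoids the corresponding hyperplane.\<close>

lemma AE_lin_indep_rows:
  assumes "i \<le> p" "p \<le> m"
  shows "AE \<omega> in M. lin_indep p i (\<lambda>j c. X j \<omega> c - \<mu> c)"
  using assms
proof (induction i)
  case 0
  then show ?case by (simp add: lin_indep_def)
next
  case (Suc i)
  let ?U = "PiM {..<i} (\<lambda>_. borel :: (nat \<Rightarrow> real) measure)"
  let ?V = "PiM {i} (\<lambda>_. borel :: (nat \<Rightarrow> real) measure)"
  let ?u = "\<lambda>\<omega>. restrict (\<lambda>j. X j \<omega>) {..<i}" and ?v = "\<lambda>\<omega>. restrict (\<lambda>j. X j \<omega>) {i}"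
  \<comment> \<open>The induction claim as a property of two arguments, the earlier rows and the new
    one, so that it can be checked under the product of their laws.\<close>
  define Q where "Q = (\<lambda>(u, v). lin_indep p (Suc i) (\<lambda>j c. (if j < i then u j c else v i c :: real) - \<mu> c))"
  have "indep_var ?U ?u ?V ?v"
    by (rule indep_var_restrict[OF ind]) (use Suc.prems in auto)
  then have u: "?u \<in> measurable M ?U" and v: "?v \<in> measurable M ?V"
    and prod: "distr M ?U ?u \<Otimes>\<^sub>M distr M ?V ?v = distr M (?U \<Otimes>\<^sub>M ?V) (\<lambda>\<omega>. (?u \<omega>, ?v \<omega>))"
    by (simp_all add: indep_var_distribution_eq)
  interpret U: prob_space "distr M ?U ?u" by (rule prob_space_distr[OF u])
  interpret V: prob_space "distr M ?V ?v" by (rule prob_space_distr[OF v])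
  interpret UV: pair_prob_space "distr M ?U ?u" "distr M ?V ?v" ..
  have cu: "(\<lambda>u. u j c) \<in> borel_measurable ?U" if "j < i" for j c
    by (intro measurable_coordinate measurable_component_singleton) (use that in auto)
  have cv: "(\<lambda>v. v i c) \<in> borel_measurable ?V" for c
    by (intro measurable_coordinate measurable_component_singleton) auto
  have Qm: "Measurable.pred (?U \<Otimes>\<^sub>M ?V) Q"
    unfolding Q_def case_prod_unfold nonsing_gram[symmetric]
  proof (intro measurable_nonsing measurable_vdot borel_measurable_diff)
    fix j c assume "j < Suc i"
    then show "(\<lambda>w. if j < i then fst w j c else snd w i c) \<in> borel_measurable (?U \<Otimes>\<^sub>M ?V)"
      using measurable_compose[OF measurable_fst cu[of j c]] measurable_compose[OF measurable_snd cv[of c]]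
      by (cases "j < i") simp_all
  next
    fix j c assume "j < Suc i"
    then show "(\<lambda>w. if j < i then fst w j c else snd w i c) \<in> borel_measurable (?U \<Otimes>\<^sub>M ?V)"
      using measurable_compose[OF measurable_fst cu[of j c]] measurable_compose[OF measurable_snd cv[of c]]
      by (cases "j < i") simp_all
  qed auto
  have IH: "AE u in distr M ?U ?u. lin_indep p i (\<lambda>j c. u j c - \<mu> c)"
  proof (subst AE_distr_iff[OF u])
    have "Measurable.pred ?U (\<lambda>u. lin_indep p i (\<lambda>j c. u j c - \<mu> c))"
      unfolding nonsing_gram[symmetric]
      by (intro measurable_nonsing measurable_vdot borel_measurable_diff cu) auto
    then show "{u \<in> space ?U. lin_indep p i (\<lambda>j c. u j c - \<mu> c)} \<in> sets ?U" by measurable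
    have "lin_indep p i (\<lambda>j c. ?u \<omega> j c - \<mu> c) = lin_indep p i (\<lambda>j c. X j \<omega> c - \<mu> c)" for \<omega>
      by (simp add: lin_indep_def)
    then show "AE \<omega> in M. lin_indep p i (\<lambda>j c. ?u \<omega> j c - \<mu> c)" using Suc by simp
  qed
  have step: "AE v in distr M ?V ?v. Q (u, v)" if li: "lin_indep p i (\<lambda>j c. u j c - \<mu> c)" for u
  proof -
    obtain a where a: "\<exists>c<p. a c \<noteq> 0" and orth: "\<And>j. j < i \<Longrightarrow> vdot p a (\<lambda>c. u j c - \<mu> c) = 0"
      using exists_orthogonal[OF li] Suc.prems by auto
    have "AE \<omega> in M. vdot p a (\<lambda>c. X i \<omega> c - \<mu> c) \<noteq> 0"
      by (rule mvnormal_hyperplane[OF norm a]) (use Suc.prems in auto)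
    then have "AE v in distr M ?V ?v. vdot p a (\<lambda>c. v i c - \<mu> c) \<noteq> 0"
    proof (subst AE_distr_iff[OF v])
      have "(\<lambda>v. vdot p a (\<lambda>c. v i c - \<mu> c)) \<in> borel_measurable ?V"
        by (intro measurable_vdot borel_measurable_diff cv) auto
      then show "{v \<in> space ?V. vdot p a (\<lambda>c. v i c - \<mu> c) \<noteq> 0} \<in> sets ?V" by measurable
    qed simp
    then show ?thesis
    proof eventually_elim
      case (elim v)
      let ?w = "\<lambda>j c. (if j < i then u j c else v i c) - \<mu> c"
      show "Q (u, v)" unfolding Q_def case_prod_conv lin_indep_def
      proof (intro allI impI)
        fix b c assume b: "\<forall>d<p. (\<Sum>j<Suc i. b j * ?w j d) = 0" and c: "c < Suc i"
        \<comment> \<open>Pairing a linear relation with \<open>a\<close> kills all earlier rows, so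
          the coefficient of the new row is 0.\<close>
        have "0 = vdot p a (\<lambda>d. \<Sum>j<Suc i. b j * ?w j d)" using b by (simp add: vdot_def)
        also have "\<dots> = (\<Sum>j<Suc i. b j * vdot p a (?w j))" by (rule vdot_sum_right)
        also have "\<dots> = b i * vdot p a (\<lambda>c. v i c - \<mu> c)" using orth by simp
        finally have bi: "b i = 0" using elim by simp
        then have "\<forall>d<p. (\<Sum>j<i. b j * (u j d - \<mu> d)) = 0" using b by simp
        then show "b c = 0" using li bi c unfolding lin_indep_def by (metis less_SucE)
      qed
    qed
  qed
  have "AE w in distr M ?U ?u \<Otimes>\<^sub>M distr M ?V ?v. Q w"
  proof (rule UV.AE_pair_measure)
    show "{w \<in> space (distr M ?U ?u \<Otimes>\<^sub>M distr M ?V ?v). Q w} \<in> sets (distr M ?U ?u \<Otimes>\<^sub>M distr M ?V ?v)"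
      using Qm by (simp add: space_pair_measure pred_def cong: sets_pair_measure_cong)
    show "AE u in distr M ?U ?u. AE v in distr M ?V ?v. Q (u, v)"
      using IH by eventually_elim (rule step)
  qed
  then have "AE \<omega> in M. Q (?u \<omega>, ?v \<omega>)"
    unfolding prod using u v Qm by (subst (asm) AE_distr_iff) (auto simp: pred_def)
  then show ?case
  proof eventually_elim
    case (elim \<omega>)
    have "(\<Sum>j<Suc i. a j * ((if j < i then ?u \<omega> j c else ?v \<omega> i c) - \<mu> c)) = (\<Sum>j<Suc i. a j * (X j \<omega> c - \<mu> c))" for a c
      by (intro sum.cong) (auto simp: less_Suc_eq)
    then show ?case using elim unfolding Q_def case_prod_conv lin_indep_def by metis
  qed
qed

text \<open>The first \<open>p\<close> rows already suffice: coefficients annihilated by all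
  \<open>m\<close> rows are orthogonal to \<open>p\<close> independent vectors in dimension
  \<open>p\<close>.\<close>

lemma AE_lin_indep_columns:
  assumes "p \<le> m"
  shows "AE \<omega> in M. lin_indep m p (\<lambda>c i. X i \<omega> c - \<mu> c)"
  using AE_lin_indep_rows[OF order_refl assms]
proof eventually_elim
  case (elim \<omega>)
  show ?case unfolding lin_indep_def
  proof (intro allI impI)
    fix a c assume a: "\<forall>i<m. (\<Sum>c<p. a c * (X i \<omega> c - \<mu> c)) = 0" and c: "c < p"
    show "a c = 0"
      by (rule lin_indep_square_orthogonal_zero[OF elim _ c]) (use a assms in \<open>simp add: vdot_def\<close>)
  qed
qed

end

end

text \<open>Division by zero keeps this true at the boundary: for \<open>a + b = 0\<close>, and for
  \<open>b = 0 < a\<close>, both sides are 0.\<close>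

lemma cos_sq_ratio:
  fixes a b :: real
  assumes "0 \<le> a" "0 \<le> b"
  shows "a / (a + b) / (1 - a / (a + b)) = a / b"
  using assms by (cases "a + b = 0") (auto simp: divide_simps)

lemma measurable_hotelling_T2:
  assumes x: "\<And>i c. i \<in> S \<Longrightarrow> c < p \<Longrightarrow> (\<lambda>\<omega>. x \<omega> i c) \<in> borel_measurable M"
  shows "(\<lambda>\<omega>. hotelling_T2 p S \<mu>0 (x \<omega>)) \<in> borel_measurable M"
proof -
  have mean: "(\<lambda>\<omega>. sample_mean S (x \<omega>) c) \<in> borel_measurable M" if "c < p" for c
    unfolding sample_mean_def
    by (intro borel_measurable_divide borel_measurable_sum x that borel_measurable_const) auto
  have cov: "(\<lambda>\<omega>. sample_cov S (x \<omega>) c d) \<in> borel_measurable M" if "c < p" "d < p" for c d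
    unfolding sample_cov_def
    by (intro borel_measurable_divide borel_measurable_sum borel_measurable_times borel_measurable_diff
        x mean that borel_measurable_const) auto
  show ?thesis unfolding hotelling_T2_def
    by (intro borel_measurable_times borel_measurable_const measurable_quad_form_mat_inv cov
        borel_measurable_diff mean) auto
qed

text \<open>\<open>T\<^sup>2\<close> is identified with a function of the angle only almost surely,
  where the columns are independent and the squared cosine is not 1. The second event is settled
  after the law of the angle is known, by transport from the Gaussian side.\<close>

theorem (in prob_space) distr_hotelling_T2:
  fixes X :: "nat \<Rightarrow> 'a \<Rightarrow> nat \<Rightarrow> real"
  assumes ind: "indep_vars (\<lambda>_. borel) X S"
    and norm: "\<And>i. i \<in> S \<Longrightarrow> mvnormal M p (X i) \<mu> \<Sigma>"
    and pd: "pos_def_mat p \<Sigma>" and fin: "finite S" and card: "card S = m" and pm: "p < m"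
    and H0: "\<And>c. c < p \<Longrightarrow> \<mu> c = \<mu>0 c"
  shows "distr M borel (\<lambda>\<omega>. hotelling_T2 p S \<mu>0 (\<lambda>i. X i \<omega>)) =
    distr (std_gauss m) borel (\<lambda>g. (real m - 1) * ((\<Sum>d<p. (g d)\<^sup>2) / (\<Sum>d\<in>{p..<m}. (g d)\<^sup>2)))"
proof -
  obtain h where h: "bij_betw h {..<m} S"
    using ex_bij_betw_nat_finite[OF fin] card by (auto simp: atLeast0LessThan)
  then have hS: "h i \<in> S" if "i < m" for i using that by (auto simp: bij_betw_def)
  have m: "0 < m" using pm by simp
  let ?one = "\<lambda>_::nat. 1::real"
  have one: "vdot m ?one ?one = m" by (simp add: vdot_def)
  define y where "y \<omega> c i = X (h i) \<omega> c - \<mu> c" for \<omega> c i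
  have ind': "indep_vars (\<lambda>_. borel) (\<lambda>i. X (h i)) {..<m}"
    by (rule indep_vars_reindex_inj[OF ind]) (use h in \<open>auto simp: bij_betw_def\<close>)
  have ga: "gauss_array M m p \<Sigma> y"
    unfolding y_def[abs_def] by (rule gauss_array_rows[OF ind' norm[OF hS] pd]) auto
  have li: "AE \<omega> in M. lin_indep m p (y \<omega>)"
    unfolding y_def[abs_def] by (rule AE_lin_indep_columns[OF ind' norm[OF hS] pd]) (use pm in auto)
  let ?R = "\<lambda>\<omega>. cos_sq m p (y \<omega>) ?one"
  let ?C = "\<lambda>g. (\<Sum>d<p. (g d)\<^sup>2) / (\<Sum>d<m. (g d)\<^sup>2) :: real"
  have Rm: "?R \<in> borel_measurable M"
    by (intro measurable_cos_sq gauss_arrayD(1)[OF ga]) auto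
  have Cm: "?C \<in> borel_measurable (std_gauss m)"
    by (intro borel_measurable_divide borel_measurable_sum borel_measurable_power measurable_std_gauss_component)
  have law: "distr M borel ?R = distr (std_gauss m) borel ?C"
    by (rule distr_cos_sq[OF prob_space_axioms ga li]) (use pm m one in auto)
  have split: "(\<Sum>d<m. (g d)\<^sup>2) = (\<Sum>d<p. (g d)\<^sup>2) + (\<Sum>d\<in>{p..<m}. (g d)\<^sup>2)" for g :: "nat \<Rightarrow> real"
    using sum.atLeastLessThan_concat[of 0 p m "\<lambda>d. (g d)\<^sup>2"] pm by (simp add: atLeast0LessThan)
  have ne: "AE \<omega> in M. ?R \<omega> \<noteq> 1"
  proof -
    have "AE x in std_normal_distribution. x \<noteq> (0::real)"
      using AE_lborel_singleton[of "0::real"] by (auto simp: AE_density)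
    \<comment> \<open>As \<open>p < m\<close>, index \<open>p\<close> belongs to the second block,
      and a nonzero \<open>g p\<close> makes the sum of squares of that block positive.\<close>
    then have "AE g in std_gauss m. g p \<noteq> 0"
      using pm prob_space_std_normal by (intro AE_PiM_component[where P = "\<lambda>x. x \<noteq> 0"]) auto
    then have "AE g in std_gauss m. ?C g \<noteq> 1"
    proof eventually_elim
      case (elim g)
      have "(g p)\<^sup>2 \<le> (\<Sum>d\<in>{p..<m}. (g d)\<^sup>2)"
        using pm by (intro member_le_sum) auto
      then have "0 < (\<Sum>d\<in>{p..<m}. (g d)\<^sup>2)" using elim by (smt (verit) zero_less_power2)
      then show ?case unfolding split by (auto simp: divide_simps)
    qed
    then have "AE x in distr (std_gauss m) borel ?C. x \<noteq> 1"
      using Cm by (subst AE_distr_iff) auto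
    then show ?thesis unfolding law[symmetric] using Rm by (subst (asm) AE_distr_iff) auto
  qed
  let ?\<Phi> = "\<lambda>x::real. (real m - 1) * (x / (1 - x))"
  have "distr M borel (\<lambda>\<omega>. hotelling_T2 p S \<mu>0 (\<lambda>i. X i \<omega>)) = distr M borel (\<lambda>\<omega>. ?\<Phi> (?R \<omega>))"
  proof (rule distr_cong_AE)
    show "AE \<omega> in M. hotelling_T2 p S \<mu>0 (\<lambda>i. X i \<omega>) = ?\<Phi> (?R \<omega>)"
      using li ne
    proof eventually_elim
      case (elim \<omega>)
      \<comment> \<open>\<open>y\<close> is centred at \<open>\<mu>\<close> and \<open>y0\<close> at
        \<open>\<mu>0\<close>; \<open>H0\<close> equates them for column indices below
        \<open>p\<close>, hence the appeal to congruence.\<close>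
      define y0 where "y0 c i = X (h i) \<omega> c - \<mu>0 c" for c i
      have R: "?R \<omega> = proj_sq m p y0 ?one / m"
        unfolding cos_sq_def one using proj_sq_cong[of p m "y \<omega>" y0 ?one ?one] H0 by (simp add: y_def y0_def)
      have "\<And>a i. (\<Sum>c<p. a c * y \<omega> c i) = (\<Sum>c<p. a c * y0 c i)"
        by (intro sum.cong) (auto simp: y_def y0_def H0)
      then have l0: "lin_indep m p y0" using elim(1) by (simp add: lin_indep_def)
      have "proj_sq m p y0 ?one \<noteq> m" using elim(2) m unfolding R by auto
      then have "hotelling_T2 p S \<mu>0 (\<lambda>i. X i \<omega>) = (real m - 1) * (proj_sq m p y0 ?one / (m - proj_sq m p y0 ?one))"
        using hotelling_T2_eq_proj_sq[OF h m, where x = "\<lambda>i. X i \<omega>" and p = p and \<nu> = \<mu>0] l0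
        by (simp add: y0_def[abs_def])
      also have "\<dots> = ?\<Phi> (?R \<omega>)" unfolding R using m by (simp add: divide_simps)
      finally show ?case .
    qed
    show "(\<lambda>\<omega>. hotelling_T2 p S \<mu>0 (\<lambda>i. X i \<omega>)) \<in> borel_measurable M"
      by (intro measurable_hotelling_T2 measurable_coordinate) (use ind in \<open>auto simp: indep_vars_def2\<close>)
  qed (use Rm in measurable)
  also have "\<dots> = distr (distr M borel ?R) borel ?\<Phi>"
    using Rm by (subst distr_distr) (auto simp: comp_def)
  also have "\<dots> = distr (std_gauss m) borel (\<lambda>g. ?\<Phi> (?C g))"
    unfolding law using Cm by (subst distr_distr) (auto simp: comp_def)
  also have "(\<lambda>g. ?\<Phi> (?C g)) = (\<lambda>g. (real m - 1) * ((\<Sum>d<p. (g d)\<^sup>2) / (\<Sum>d\<in>{p..<m}. (g d)\<^sup>2)))"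
    unfolding split by (intro ext) (simp only: cos_sq_ratio[OF sum_nonneg sum_nonneg] zero_le_power2)
  finally show ?thesis .
qed

section \<open>Moments of chi-square ratios\<close>

lemma (in prob_space) indep_power_add:
  fixes X Y :: "'a \<Rightarrow> real"
  assumes ind: "indep_var borel X borel Y"
    and X: "\<And>j. integrable M (\<lambda>\<omega>. X \<omega> ^ j)" and Y: "\<And>j. integrable M (\<lambda>\<omega>. Y \<omega> ^ j)"
  shows "integrable M (\<lambda>\<omega>. (X \<omega> + Y \<omega>) ^ k)"
    and "expectation (\<lambda>\<omega>. (X \<omega> + Y \<omega>) ^ k) =
      (\<Sum>j\<le>k. (k choose j) * expectation (\<lambda>\<omega>. X \<omega> ^ j) * expectation (\<lambda>\<omega>. Y \<omega> ^ (k - j)))"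
proof -
  have i: "indep_var borel (\<lambda>\<omega>. X \<omega> ^ a) borel (\<lambda>\<omega>. Y \<omega> ^ b)" for a b
    using indep_var_compose[OF ind, of "\<lambda>x. x ^ a" borel "\<lambda>x. x ^ b" borel] by (simp add: comp_def)
  note I = indep_var_integrable[OF i X Y] and E = indep_var_lebesgue_integral[OF i X Y]
  have J: "integrable M (\<lambda>\<omega>. (k choose j) * X \<omega> ^ j * Y \<omega> ^ (k - j))" for j
    using integrable_mult_right[OF I[of j "k - j"], of "real (k choose j)"] by (simp add: mult.assoc)
  show "integrable M (\<lambda>\<omega>. (X \<omega> + Y \<omega>) ^ k)"
    unfolding binomial_ring by (intro Bochner_Integration.integrable_sum J)
  have "expectation (\<lambda>\<omega>. (X \<omega> + Y \<omega>) ^ k) = (\<Sum>j\<le>k. expectation (\<lambda>\<omega>. (k choose j) * X \<omega> ^ j * Y \<omega> ^ (k - j)))"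
    unfolding binomial_ring by (intro Bochner_Integration.integral_sum J)
  then show "expectation (\<lambda>\<omega>. (X \<omega> + Y \<omega>) ^ k) =
      (\<Sum>j\<le>k. (k choose j) * expectation (\<lambda>\<omega>. X \<omega> ^ j) * expectation (\<lambda>\<omega>. Y \<omega> ^ (k - j)))"
    using E by (simp add: mult.assoc)
qed

text \<open>Binomial expansion in the even moments \<open>fact (2 * j) / (2 ^ j * fact j)\<close> of
  the normal law. The values 2, 8 and 60 are the central moments of a chi-square variable with one
  degree of freedom.\<close>

lemma std_normal_sq_moments:
  fixes k :: nat
  shows "integrable std_normal_distribution (\<lambda>x. (x\<^sup>2 - 1) ^ k)"
    and "(\<integral>x. (x\<^sup>2 - 1) \<partial>std_normal_distribution) = 0"
    and "(\<integral>x. (x\<^sup>2 - 1)\<^sup>2 \<partial>std_normal_distribution) = 2"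
    and "(\<integral>x. (x\<^sup>2 - 1) ^ 3 \<partial>std_normal_distribution) = 8"
    and "(\<integral>x. (x\<^sup>2 - 1) ^ 4 \<partial>std_normal_distribution) = 60"
proof -
  let ?G = std_normal_distribution
  interpret G: prob_space ?G using real_dist_normal_dist by (simp add: real_distribution_def)
  note I = integrable_std_normal_distribution_moment
  have E: "(\<integral>x. x ^ n \<partial>?G) = fact n / (2 ^ (n div 2) * fact (n div 2))" if "even n" for n
    using std_normal_distribution_even_moments(1)[of "n div 2"] that by simp
  have b: "(x\<^sup>2 - 1) ^ k = (\<Sum>j\<le>k. (real (k choose j) * (-1) ^ (k - j)) * x ^ (2 * j))" for x :: real and k
    using binomial_ring[of "x\<^sup>2" "-1" k] by (simp only: diff_conv_add_uminus power_mult[of x 2]) (simp only: mult_ac)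
  show "integrable ?G (\<lambda>x. (x\<^sup>2 - 1) ^ k)"
    unfolding b by (intro Bochner_Integration.integrable_sum integrable_mult_right I)
  have S: "(\<integral>x. (x\<^sup>2 - 1) ^ k \<partial>?G) = (\<Sum>j\<le>k. (real (k choose j) * (-1) ^ (k - j)) * (fact (2 * j) / (2 ^ j * fact j)))" for k
    unfolding b using I by (subst Bochner_Integration.integral_sum) (auto simp: E)
  show "(\<integral>x. (x\<^sup>2 - 1) \<partial>?G) = 0" using S[of 1] by (simp add: fact_numeral)
  show "(\<integral>x. (x\<^sup>2 - 1)\<^sup>2 \<partial>?G) = 2" unfolding S by (simp add: numeral_eq_Suc fact_numeral)
  show "(\<integral>x. (x\<^sup>2 - 1) ^ 3 \<partial>?G) = 8" unfolding S by (simp add: numeral_eq_Suc fact_numeral)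
  show "(\<integral>x. (x\<^sup>2 - 1) ^ 4 \<partial>?G) = 60" unfolding S by (simp add: numeral_eq_Suc fact_numeral)
qed

text \<open>\<open>- F 0\<close> is the integral of this function over the half-line, the shape in
  which negative chi-square moments appear. Each integration by parts lowers \<open>k\<close> by 1
  and \<open>q\<close> by 2, which produces the product; \<open>q > 2 * real k + 2\<close> is
  convergence at infinity.\<close>

lemma powr_antiderivative:
  fixes q :: real
  assumes "q > 2 * real k + 2"
  shows "\<exists>F. (\<forall>t\<ge>0. (F has_real_derivative t ^ k / fact k * (1 + 2 * t) powr (- q / 2)) (at t)) \<and>
    (F \<longlongrightarrow> 0) at_top \<and> F 0 = - 1 / (\<Prod>j\<le>k. (q - 2 * real j - 2))"
  using assms
proof (induction k arbitrary: q)
  case 0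
  let ?F = "\<lambda>t. - ((1 + 2 * t) powr (1 - q / 2)) / (q - 2)"
  have "(?F has_real_derivative t ^ 0 / fact 0 * (1 + 2 * t) powr (- q / 2)) (at t)" if t: "t \<ge> 0" for t
  proof -
    have "((\<lambda>t. (1 + 2 * t) powr (1 - q / 2)) has_real_derivative (1 - q / 2) * (1 + 2 * t) powr (- q / 2) * 2) (at t)"
      using t by (auto intro!: derivative_eq_intros)
    from DERIV_cdivide[OF DERIV_minus[OF this], of "q - 2"]
    have "(?F has_real_derivative - ((1 - q / 2) * (1 + 2 * t) powr (- q / 2) * 2) / (q - 2)) (at t)" .
    moreover have "- ((1 - q / 2) * v * 2) / (q - 2) = v" for v :: real
      using 0 by (simp add: field_simps)
    ultimately show ?thesis by simp
  qed
  moreover have "(?F \<longlongrightarrow> 0) at_top" using 0 by real_asymp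
  moreover have "?F 0 = - 1 / (\<Prod>j\<le>0. (q - 2 * real j - 2))" by simp
  ultimately show ?case by blast
next
  case (Suc k)
  then have "q - 2 > 2 * real k + 2" by simp
  from Suc.IH[OF this] obtain F where
    F: "\<And>t. t \<ge> 0 \<Longrightarrow> (F has_real_derivative t ^ k / fact k * (1 + 2 * t) powr (- (q - 2) / 2)) (at t)"
      "(F \<longlongrightarrow> 0) at_top" "F 0 = - 1 / (\<Prod>j\<le>k. (q - 2 - 2 * real j - 2))" by blast
  let ?G = "\<lambda>t. (F t - t ^ Suc k / fact (Suc k) * (1 + 2 * t) powr (1 - q / 2)) / (q - 2)"
  have "(?G has_real_derivative t ^ Suc k / fact (Suc k) * (1 + 2 * t) powr (- q / 2)) (at t)" if t: "t \<ge> 0" for t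
  proof -
    have e: "- (q - 2) / 2 = 1 - q / 2" by (simp add: field_simps)
    have "((\<lambda>t. t ^ Suc k / fact (Suc k)) has_real_derivative real (Suc k) * t ^ k / fact (Suc k)) (at t)"
      using DERIV_cdivide[OF DERIV_pow[of "Suc k" t], of "fact (Suc k)"] unfolding diff_Suc_Suc diff_zero .
    moreover have "real (Suc k) * t ^ k / fact (Suc k) = t ^ k / fact k"
      by (simp add: fact_Suc del: of_nat_Suc)
    ultimately have "((\<lambda>t. t ^ Suc k / fact (Suc k)) has_real_derivative t ^ k / fact k) (at t)"
      by (simp only:)
    moreover have "((\<lambda>t. (1 + 2 * t) powr (1 - q / 2)) has_real_derivative (1 - q / 2) * (1 + 2 * t) powr (- q / 2) * 2) (at t)"
      using t by (auto intro!: derivative_eq_intros)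
    ultimately have "(?G has_real_derivative
        (t ^ k / fact k * (1 + 2 * t) powr (- (q - 2) / 2) -
          (t ^ k / fact k * (1 + 2 * t) powr (1 - q / 2) + (1 - q / 2) * (1 + 2 * t) powr (- q / 2) * 2 * (t ^ Suc k / fact (Suc k)))) / (q - 2)) (at t)"
      by (intro DERIV_cdivide DERIV_diff DERIV_mult F t)
    moreover have "(t ^ k / fact k * (1 + 2 * t) powr (- (q - 2) / 2) -
          (t ^ k / fact k * (1 + 2 * t) powr (1 - q / 2) + (1 - q / 2) * (1 + 2 * t) powr (- q / 2) * 2 * (t ^ Suc k / fact (Suc k)))) / (q - 2)
        = t ^ Suc k / fact (Suc k) * (1 + 2 * t) powr (- q / 2)"
    proof -
      define u v where "u = t ^ Suc k / fact (Suc k)" and "v = (1 + 2 * t) powr (- q / 2)"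
      have "- ((1 - q / 2) * v * 2 * u) / (q - 2) = u * v"
        using Suc.prems by (simp add: field_simps)
      then show ?thesis unfolding e u_def v_def by simp
    qed
    ultimately show ?thesis by simp
  qed
  moreover have "(?G \<longlongrightarrow> 0) at_top"
  proof -
    have "((\<lambda>t. t ^ Suc k * (1 + 2 * t) powr (1 - q / 2)) \<longlongrightarrow> 0) at_top"
    proof (rule Lim_null_comparison)
      \<comment> \<open>Bounding \<open>t ^ Suc k\<close> by \<open>(1 + 2 * t) ^ Suc k\<close>
        leaves a single power; its exponent is negative because \<open>q > 2 * k + 4\<close>
        here.\<close>
      show "((\<lambda>t. (1 + 2 * t) powr (real k + 2 - q / 2)) \<longlongrightarrow> 0) at_top"
        using Suc.prems by real_asymp
      show "\<forall>\<^sub>F t in at_top. norm (t ^ Suc k * (1 + 2 * t) powr (1 - q / 2)) \<le> (1 + 2 * t) powr (real k + 2 - q / 2)"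
        using eventually_ge_at_top[of 0]
      proof eventually_elim
        case (elim t)
        have "t ^ Suc k \<le> (1 + 2 * t) ^ Suc k" using elim by (intro power_mono) auto
        also have "\<dots> = (1 + 2 * t) powr (real (Suc k))" using elim by (subst powr_realpow) auto
        finally have "t ^ Suc k * (1 + 2 * t) powr (1 - q / 2) \<le> (1 + 2 * t) powr real (Suc k) * (1 + 2 * t) powr (1 - q / 2)"
          by (intro mult_right_mono) auto
        also have "\<dots> = (1 + 2 * t) powr (real k + 2 - q / 2)"
          by (simp add: powr_add[symmetric] algebra_simps)
        finally show ?case using elim by simp
      qed
    qed
    from tendsto_divide[OF this tendsto_const[of "fact (Suc k)"]]
    have "((\<lambda>t. t ^ Suc k / fact (Suc k) * (1 + 2 * t) powr (1 - q / 2)) \<longlongrightarrow> 0) at_top" by simp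
    from tendsto_divide[OF tendsto_diff[OF F(2) this] tendsto_const[of "q - 2"]] show ?thesis
      using Suc.prems by simp
  qed
  moreover have "?G 0 = - 1 / (\<Prod>j\<le>Suc k. (q - 2 * real j - 2))"
    using Suc.prems by (subst prod.atMost_Suc_shift) (simp add: F(3) algebra_simps)
  ultimately show ?case by blast
qed

text \<open>The standard density times \<open>exp (- t * x\<^sup>2)\<close> is
  \<open>\<sigma>\<close> times the normal density of variance
  \<open>\<sigma>\<^sup>2 = 1 / (1 + 2 * t)\<close>.\<close>

lemma nn_integral_std_normal_laplace:
  fixes t :: real
  assumes "t \<ge> 0"
  shows "(\<integral>\<^sup>+x. ennreal (exp (- t * x\<^sup>2)) \<partial>std_normal_distribution) = ennreal ((1 + 2 * t) powr (- 1 / 2))"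
proof -
  define \<sigma> where "\<sigma> = 1 / sqrt (1 + 2 * t)"
  have s: "\<sigma>\<^sup>2 = 1 / (1 + 2 * t)" using assms by (simp add: \<sigma>_def power_divide)
  have sp: "\<sigma> > 0" using assms by (simp add: \<sigma>_def)
  have eq: "std_normal_density x * exp (- (t * x\<^sup>2)) = \<sigma> * normal_density 0 \<sigma> x" for x
  proof -
    have "sqrt (2 * pi * \<sigma>\<^sup>2) = \<sigma> * sqrt (2 * pi)" using sp by (simp add: real_sqrt_mult)
    moreover have "- (x\<^sup>2) / 2 + - (t * x\<^sup>2) = - (x\<^sup>2) / (2 * \<sigma>\<^sup>2)"
      using assms by (simp add: s field_simps)
    ultimately show ?thesis using sp by (simp add: normal_density_def exp_add[symmetric])
  qed
  have "(\<integral>\<^sup>+x. ennreal (exp (- t * x\<^sup>2)) \<partial>std_normal_distribution) =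
      (\<integral>\<^sup>+x. ennreal (\<sigma> * normal_density 0 \<sigma> x) \<partial>lborel)"
    by (subst nn_integral_density) (auto simp: ennreal_mult'[symmetric] eq intro!: nn_integral_cong)
  also have "\<dots> = ennreal \<sigma> * (\<integral>\<^sup>+x. ennreal (normal_density 0 \<sigma> x) \<partial>lborel)"
    using sp by (simp add: ennreal_mult' nn_integral_cmult)
  also have "(\<integral>\<^sup>+x. ennreal (normal_density 0 \<sigma> x) \<partial>lborel) = 1"
    using sp by (simp add: nn_integral_eq_integral)
  also have "\<sigma> = (1 + 2 * t) powr (- 1 / 2)"
    using assms by (simp add: \<sigma>_def powr_minus powr_half_sqrt inverse_eq_divide)
  finally show ?thesis by simp
qed

text \<open>The integrand is \<open>1 / C ^ Suc k\<close> times the Erlang density. Read from right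
  to left, the formula turns negative powers into mixtures of exponentials.\<close>

lemma nn_integral_gamma:
  fixes C :: real
  assumes "C > 0"
  shows "(\<integral>\<^sup>+t. ennreal (t ^ k / fact k * exp (- t * C)) * indicator {0..} t \<partial>lborel) = ennreal (1 / C ^ Suc k)"
proof -
  have "(\<integral>\<^sup>+t. ennreal (t ^ k / fact k * exp (- t * C)) * indicator {0..} t \<partial>lborel) =
      (\<integral>\<^sup>+t. ennreal (1 / C ^ Suc k) * ennreal (erlang_density k C t) \<partial>lborel)"
    using assms by (intro nn_integral_cong)
      (auto simp: erlang_density_def ennreal_mult'[symmetric] indicator_def mult_ac)
  also have "\<dots> = ennreal (1 / C ^ Suc k) * (\<integral>\<^sup>+t. ennreal (erlang_density k C t) \<partial>lborel)"
    by (simp add: nn_integral_cmult)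
  also have "(\<integral>\<^sup>+t. ennreal (erlang_density k C t) \<partial>lborel) = 1"
    using prob_space.emeasure_space_1[OF prob_space_erlang_density[OF assms, of k]]
    by (simp add: emeasure_density)
  finally show ?thesis by simp
qed

section \<open>Moments of chi-square sums, their reciprocals and their ratios\<close>

context prob_space
begin

context
  fixes g :: "nat \<Rightarrow> 'a \<Rightarrow> real" and m :: nat
  assumes ind: "indep_vars (\<lambda>_. borel) g {..<m}"
    and std: "\<And>i. i < m \<Longrightarrow> distr M borel (g i) = std_normal_distribution"
begin

lemma g_measurable: "i < m \<Longrightarrow> g i \<in> borel_measurable M"
  using ind by (simp add: indep_vars_def2)

text \<open>For independent centred summands the fourth moment is
  \<open>60 * p + 3 * p * (p - 1) * 2\<^sup>2\<close>, which is the polynomial stated.\<close>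

lemma centred_chi_sq_moments:
  assumes "p \<le> m"
  defines "S \<equiv> \<lambda>\<omega>. \<Sum>i<p. ((g i \<omega>)\<^sup>2 - 1)"
  shows "integrable M (\<lambda>\<omega>. S \<omega> ^ k)"
    and "expectation S = 0"
    and "expectation (\<lambda>\<omega>. (S \<omega>)\<^sup>2) = 2 * real p"
    and "expectation (\<lambda>\<omega>. S \<omega> ^ 4) = 12 * (real p)\<^sup>2 + 48 * real p"
proof -
  have tr: "expectation (\<lambda>\<omega>. f (g i \<omega>)) = (\<integral>x. f x \<partial>std_normal_distribution)"
    and tri: "integrable M (\<lambda>\<omega>. f (g i \<omega>)) \<longleftrightarrow> integrable std_normal_distribution f"
    if "i < m" "f \<in> borel_measurable borel" for i and f :: "real \<Rightarrow> real"
    using std[OF that(1)] g_measurable[OF that(1)] that(2) integral_distr[of "g i" M borel f] integrable_distr_eq[of "g i" M borel f]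
    by simp_all
  have "(\<forall>k. integrable M (\<lambda>\<omega>. (\<Sum>i<p. ((g i \<omega>)\<^sup>2 - 1)) ^ k)) \<and>
    expectation (\<lambda>\<omega>. \<Sum>i<p. ((g i \<omega>)\<^sup>2 - 1)) = 0 \<and>
    expectation (\<lambda>\<omega>. (\<Sum>i<p. ((g i \<omega>)\<^sup>2 - 1))\<^sup>2) = 2 * p \<and>
    expectation (\<lambda>\<omega>. (\<Sum>i<p. ((g i \<omega>)\<^sup>2 - 1)) ^ 4) = 12 * (real p)\<^sup>2 + 48 * real p"
    using assms(1)
  proof (induction p)
    case 0
    then show ?case by (simp add: power_0_left)
  next
    case (Suc p)
    let ?S = "\<lambda>\<omega>. \<Sum>i<p. ((g i \<omega>)\<^sup>2 - 1)" and ?W = "\<lambda>\<omega>. (g p \<omega>)\<^sup>2 - 1"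
    have p: "p < m" using Suc.prems by simp
    have "indep_vars (\<lambda>_. borel) g (insert p {..<p})"
      by (rule indep_vars_subset[OF ind]) (use p in auto)
    then have "indep_vars (\<lambda>_. borel) (\<lambda>i \<omega>. (g i \<omega>)\<^sup>2 - 1) (insert p {..<p})"
      by (rule indep_vars_compose2[where Y = "\<lambda>_ x. x\<^sup>2 - 1"]) auto
    then have iv: "indep_var borel ?W borel ?S"
      by (intro indep_vars_sum) auto
    have W: "integrable M (\<lambda>\<omega>. ?W \<omega> ^ j)" for j
      using tri[OF p, of "\<lambda>x. (x\<^sup>2 - 1) ^ j"] std_normal_sq_moments(1) by simp
    have EW: "expectation ?W = 0" "expectation (\<lambda>\<omega>. (?W \<omega>)\<^sup>2) = 2" "expectation (\<lambda>\<omega>. ?W \<omega> ^ 3) = 8" "expectation (\<lambda>\<omega>. ?W \<omega> ^ 4) = 60"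
      using tr[OF p, of "\<lambda>x. x\<^sup>2 - 1"] tr[OF p, of "\<lambda>x. (x\<^sup>2 - 1)\<^sup>2"] tr[OF p, of "\<lambda>x. (x\<^sup>2 - 1) ^ 3"]
        tr[OF p, of "\<lambda>x. (x\<^sup>2 - 1) ^ 4"] std_normal_sq_moments
      by simp_all
    from Suc have IH: "\<And>k. integrable M (\<lambda>\<omega>. ?S \<omega> ^ k)" "expectation ?S = 0"
      "expectation (\<lambda>\<omega>. (?S \<omega>)\<^sup>2) = 2 * real p" "expectation (\<lambda>\<omega>. ?S \<omega> ^ 4) = 12 * (real p)\<^sup>2 + 48 * real p"
      by auto
    have sum: "(\<Sum>i<Suc p. ((g i \<omega>)\<^sup>2 - 1)) = ?W \<omega> + ?S \<omega>" for \<omega> by simp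
    note PA = indep_power_add[OF iv W IH(1)]
    have "expectation (\<lambda>\<omega>. ?W \<omega> + ?S \<omega>) = 0"
      using PA(2)[of 1] EW IH by (simp add: prob_space)
    moreover have "expectation (\<lambda>\<omega>. (?W \<omega> + ?S \<omega>)\<^sup>2) = 2 * real (Suc p)"
      unfolding PA(2) using EW IH by (simp add: numeral_eq_Suc prob_space)
    moreover have "expectation (\<lambda>\<omega>. (?W \<omega> + ?S \<omega>) ^ 4) = 12 * (real (Suc p))\<^sup>2 + 48 * real (Suc p)"
    proof -
      have b4: "(\<Sum>j\<le>4. real (4 choose j) * a j * b (4 - j)) = a 0 * b 4 + 4 * a 1 * b 3 + 6 * a 2 * b 2 + 4 * a 3 * b 1 + a 4 * b 0"
        for a b :: "nat \<Rightarrow> real"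
        by (simp add: numeral_eq_Suc)
      \<comment> \<open>In the expansion every term with a first moment vanishes; the surviving
        mixed term is 6 times the product of the variances 2 and \<open>2 * p\<close>.\<close>
      have "expectation (\<lambda>\<omega>. (?W \<omega> + ?S \<omega>) ^ 4) = 12 * (real p)\<^sup>2 + 48 * real p + 6 * 2 * (2 * real p) + 60"
        unfolding PA(2) b4[of "\<lambda>j. expectation (\<lambda>\<omega>. ?W \<omega> ^ j)" "\<lambda>j. expectation (\<lambda>\<omega>. ?S \<omega> ^ j)"]
        by (simp add: EW IH prob_space)
      then show ?thesis by (simp add: power2_eq_square algebra_simps)
    qed
    ultimately show ?case unfolding sum using PA(1) by simp
  qed
  then show "integrable M (\<lambda>\<omega>. S \<omega> ^ k)" "expectation S = 0" "expectation (\<lambda>\<omega>. (S \<omega>)\<^sup>2) = 2 * real p"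
    "expectation (\<lambda>\<omega>. S \<omega> ^ 4) = 12 * (real p)\<^sup>2 + 48 * real p"
    unfolding S_def by auto
qed

text \<open>A negative power of \<open>C\<close> is a Gamma integral of
  \<open>exp (- t * C)\<close>; after Fubini the expectation of the exponential is the chi-square
  Laplace transform. Nonnegative integrals are used, so the finite value yields integrability
  too.\<close>

lemma inverse_chi_sq_moments:
  assumes J: "J \<subseteq> {..<m}" and q: "real (card J) > 2 * real k + 2"
  defines "C \<equiv> \<lambda>\<omega>. \<Sum>i\<in>J. (g i \<omega>)\<^sup>2"
  shows "integrable M (\<lambda>\<omega>. (1 / C \<omega>) ^ Suc k)"
    and "expectation (\<lambda>\<omega>. (1 / C \<omega>) ^ Suc k) = 1 / (\<Prod>j\<le>k. (real (card J) - 2 * real j - 2))"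
proof -
  let ?q = "real (card J)"
  have fin: "finite J" using J finite_subset by blast
  have gm: "g i \<in> borel_measurable M" if "i \<in> J" for i using that J by (intro g_measurable) auto
  have Cm: "C \<in> borel_measurable M"
    unfolding C_def by (intro borel_measurable_sum borel_measurable_power gm)
  obtain i where i: "i \<in> J" using q by (cases "J = {}") auto
  \<comment> \<open>At \<open>C = 0\<close> the Gamma formula fails: \<open>1 / C\<close> is 0 by
    convention while the integral diverges. This happens on a null set only.\<close>
  have Cpos: "AE \<omega> in M. C \<omega> > 0"
  proof -
    have im: "i < m" using i J by auto
    have "AE x in distr M borel (g i). x \<noteq> (0::real)"
      unfolding std[OF im] using AE_lborel_singleton[of "0::real"] by (auto simp: AE_density)
    then have "AE \<omega> in M. g i \<omega> \<noteq> 0"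
      using gm[OF i] by (subst (asm) AE_distr_iff) auto
    then show ?thesis
    proof eventually_elim
      case (elim \<omega>)
      have "(g i \<omega>)\<^sup>2 \<le> C \<omega>" unfolding C_def using i fin by (intro member_le_sum) auto
      then show ?case using elim by (smt (verit) zero_less_power2)
    qed
  qed
  have laplace: "(\<integral>\<^sup>+\<omega>. ennreal (exp (- t * C \<omega>)) \<partial>M) = ennreal ((1 + 2 * t) powr (- ?q / 2))" if t: "t \<ge> 0" for t
  proof -
    have "indep_vars (\<lambda>_. borel) (\<lambda>i \<omega>. (\<lambda>x. ennreal (exp (- t * x\<^sup>2))) (g i \<omega>)) J"
      by (rule indep_vars_compose2[OF indep_vars_subset[OF ind J]]) auto
    then have iv: "indep_vars (\<lambda>_. borel) (\<lambda>i \<omega>. ennreal (exp (- t * (g i \<omega>)\<^sup>2))) J" by simp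
    have "(\<integral>\<^sup>+\<omega>. ennreal (exp (- t * C \<omega>)) \<partial>M) = (\<integral>\<^sup>+\<omega>. (\<Prod>i\<in>J. ennreal (exp (- t * (g i \<omega>)\<^sup>2))) \<partial>M)"
      using fin by (simp add: C_def prod_ennreal exp_sum[symmetric] sum_distrib_left sum_negf)
    also have "\<dots> = (\<Prod>i\<in>J. \<integral>\<^sup>+\<omega>. ennreal (exp (- t * (g i \<omega>)\<^sup>2)) \<partial>M)"
      by (rule indep_vars_nn_integral[OF fin iv]) auto
    also have "\<dots> = (\<Prod>i\<in>J. ennreal ((1 + 2 * t) powr (- 1 / 2)))"
    proof (rule prod.cong)
      fix i assume i: "i \<in> J"
      then have im: "i < m" using J by auto
      have "(\<integral>\<^sup>+\<omega>. ennreal (exp (- t * (g i \<omega>)\<^sup>2)) \<partial>M) = (\<integral>\<^sup>+x. ennreal (exp (- t * x\<^sup>2)) \<partial>distr M borel (g i))"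
        using gm[OF i] by (subst nn_integral_distr) auto
      then show "(\<integral>\<^sup>+\<omega>. ennreal (exp (- t * (g i \<omega>)\<^sup>2)) \<partial>M) = ennreal ((1 + 2 * t) powr (- 1 / 2))"
        unfolding std[OF im] nn_integral_std_normal_laplace[OF t] .
    qed simp
    also have "\<dots> = ennreal ((1 + 2 * t) powr (- ?q / 2))"
      using t by (simp add: ennreal_power powr_power[symmetric]) (simp add: powr_realpow[symmetric] powr_powr mult.commute)
    finally show ?thesis .
  qed
  obtain F where F: "\<And>t. t \<ge> 0 \<Longrightarrow> (F has_real_derivative t ^ k / fact k * (1 + 2 * t) powr (- ?q / 2)) (at t)"
      "(F \<longlongrightarrow> 0) at_top" "F 0 = - 1 / (\<Prod>j\<le>k. (?q - 2 * real j - 2))"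
    using powr_antiderivative[OF q] by blast
  have pos: "0 \<le> 1 / (\<Prod>j\<le>k. (?q - 2 * real j - 2))"
    using q by (intro divide_nonneg_nonneg prod_nonneg) auto
  have "(\<integral>\<^sup>+\<omega>. ennreal ((1 / C \<omega>) ^ Suc k) \<partial>M) =
      (\<integral>\<^sup>+\<omega>. \<integral>\<^sup>+t. ennreal (t ^ k / fact k * exp (- t * C \<omega>)) * indicator {0..} t \<partial>lborel \<partial>M)"
    using Cpos by (intro nn_integral_cong_AE, eventually_elim) (simp only: nn_integral_gamma power_one_over)
  also have "\<dots> = (\<integral>\<^sup>+t. \<integral>\<^sup>+\<omega>. ennreal (t ^ k / fact k * exp (- t * C \<omega>)) * indicator {0..} t \<partial>M \<partial>lborel)"
  proof -
    interpret P: pair_sigma_finite M lborel ..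
    note [measurable] = Cm
    show ?thesis by (rule P.Fubini'[symmetric]) measurable
  qed
  also have "\<dots> = (\<integral>\<^sup>+t. ennreal (t ^ k / fact k * (1 + 2 * t) powr (- ?q / 2)) * indicator {0..} t \<partial>lborel)"
  proof (rule nn_integral_cong)
    fix t :: real
    note [measurable] = Cm
    show "(\<integral>\<^sup>+\<omega>. ennreal (t ^ k / fact k * exp (- t * C \<omega>)) * indicator {0..} t \<partial>M) =
        ennreal (t ^ k / fact k * (1 + 2 * t) powr (- ?q / 2)) * indicator {0..} t"
    proof (cases "t \<ge> 0")
      case True
      then have "(\<integral>\<^sup>+\<omega>. ennreal (t ^ k / fact k * exp (- t * C \<omega>)) \<partial>M) =
          (\<integral>\<^sup>+\<omega>. ennreal (t ^ k / fact k) * ennreal (exp (- t * C \<omega>)) \<partial>M)"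
        by (intro nn_integral_cong ennreal_mult) auto
      also have "\<dots> = ennreal (t ^ k / fact k) * (\<integral>\<^sup>+\<omega>. ennreal (exp (- t * C \<omega>)) \<partial>M)"
        by (rule nn_integral_cmult) measurable
      also have "\<dots> = ennreal (t ^ k / fact k * (1 + 2 * t) powr (- ?q / 2))"
        unfolding laplace[OF True] using True by (intro ennreal_mult[symmetric]) auto
      finally show ?thesis using True by simp
    qed simp
  qed
  also have "\<dots> = ennreal (0 - F 0)"
    by (rule nn_integral_FTC_atLeast) (use F in auto)
  finally have nn: "(\<integral>\<^sup>+\<omega>. ennreal ((1 / C \<omega>) ^ Suc k) \<partial>M) = ennreal (1 / (\<Prod>j\<le>k. (?q - 2 * real j - 2)))"
    using F(3) by simp
  have C0: "C \<omega> \<ge> 0" for \<omega> by (simp add: C_def sum_nonneg)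
  have "has_bochner_integral M (\<lambda>\<omega>. (1 / C \<omega>) ^ Suc k) (1 / (\<Prod>j\<le>k. (?q - 2 * real j - 2)))"
    by (rule has_bochner_integral_nn_integral) (use nn pos Cm C0 in \<open>auto simp del: power_Suc\<close>)
  then show "integrable M (\<lambda>\<omega>. (1 / C \<omega>) ^ Suc k)"
    "expectation (\<lambda>\<omega>. (1 / C \<omega>) ^ Suc k) = 1 / (\<Prod>j\<le>k. (?q - 2 * real j - 2))"
    by (simp_all add: has_bochner_integral_iff)
qed

text \<open>With \<open>S\<close> the centred numerator and \<open>C\<close> the denominator, the
  deviation splits as \<open>S / C + p * (1 / C - 1 / N)\<close>. Here \<open>S\<close> and
  \<open>C\<close> are independent and \<open>S\<close> has mean 0, so mean and variance reduce to
  moments of each. The fourth moment of \<open>1 / C\<close>, with \<open>m - p\<close> degrees of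
  freedom, is what asks for \<open>m - p > 8\<close>.\<close>

lemma chi_sq_ratio_moments:
  assumes pm: "p < m" and q: "real m - real p > 8"
  defines "N \<equiv> real m - real p - 2"
  defines "V \<equiv> \<lambda>\<omega>. (\<Sum>i<p. (g i \<omega>)\<^sup>2) / (\<Sum>i\<in>{p..<m}. (g i \<omega>)\<^sup>2) - real p / N"
  shows "integrable M V" "integrable M (\<lambda>\<omega>. (V \<omega>)\<^sup>2)" "integrable M (\<lambda>\<omega>. V \<omega> ^ 4)"
    and "expectation V = 0"
    and "expectation (\<lambda>\<omega>. (V \<omega>)\<^sup>2) = 2 * real p * (N + real p) / (N\<^sup>2 * (N - 2))"
    and "expectation (\<lambda>\<omega>. V \<omega> ^ 4) \<le> 8 * ((12 * (real p)\<^sup>2 + 48 * real p) / (N * (N - 2) * (N - 4) * (N - 6)) +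
      real p ^ 4 * (12 * (N + 12) / (N ^ 4 * (N - 2) * (N - 4) * (N - 6))))"
proof -
  let ?S = "\<lambda>\<omega>. \<Sum>i<p. ((g i \<omega>)\<^sup>2 - 1)"
  let ?C = "\<lambda>\<omega>. \<Sum>i\<in>{p..<m}. (g i \<omega>)\<^sup>2"
  let ?Y = "\<lambda>\<omega>. 1 / ?C \<omega>" and ?Z = "\<lambda>\<omega>. 1 / ?C \<omega> - 1 / N"
  have N: "N > 6" using q by (simp add: N_def)
  have card: "real (card {p..<m}) = N + 2" using pm by (simp add: N_def)
  have sub: "{p..<m} \<subseteq> {..<m}" by auto
  note Sm = centred_chi_sq_moments[OF less_imp_le[OF pm]]
  have Yi: "integrable M (\<lambda>\<omega>. ?Y \<omega> ^ k)" if "k \<le> 4" for k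
  proof (cases k)
    case (Suc j)
    then show ?thesis using inverse_chi_sq_moments(1)[OF sub, of j] that N card by simp
  qed simp
  have Y: "expectation (\<lambda>\<omega>. ?Y \<omega> ^ Suc k) = 1 / (\<Prod>j\<le>k. (N - 2 * real j))" if "k \<le> 3" for k
    using inverse_chi_sq_moments(2)[OF sub, of k] that N unfolding card by (simp del: power_Suc)
  have Y1: "expectation ?Y = 1 / N" using Y[of 0] by simp
  have Y2: "expectation (\<lambda>\<omega>. (?Y \<omega>)\<^sup>2) = 1 / (N * (N - 2))" using Y[of 1] by (simp add: numeral_eq_Suc)
  have Y3: "expectation (\<lambda>\<omega>. ?Y \<omega> ^ 3) = 1 / (N * (N - 2) * (N - 4))" using Y[of 2] by (simp add: numeral_eq_Suc)
  have Y4: "expectation (\<lambda>\<omega>. ?Y \<omega> ^ 4) = 1 / (N * (N - 2) * (N - 4) * (N - 6))" using Y[of 3] by (simp add: numeral_eq_Suc)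
  have bi: "(y - 1 / N) ^ k = (\<Sum>j\<le>k. ((k choose j) * (- 1 / N) ^ (k - j)) * y ^ j)" for y :: real and k
    using binomial_ring[of y "- 1 / N" k] by (simp add: mult_ac)
  have Zi: "integrable M (\<lambda>\<omega>. ?Z \<omega> ^ k)" if "k \<le> 4" for k
    unfolding bi by (intro Bochner_Integration.integrable_sum integrable_mult_right Yi) (use that in auto)
  have EZ: "expectation (\<lambda>\<omega>. ?Z \<omega> ^ k) = (\<Sum>j\<le>k. ((k choose j) * (- 1 / N) ^ (k - j)) * expectation (\<lambda>\<omega>. ?Y \<omega> ^ j))"
    if "k \<le> 4" for k
    unfolding bi using Yi that by (subst Bochner_Integration.integral_sum) auto
  have Z1: "expectation ?Z = 0" using EZ[of 1] Y1 by (simp add: prob_space)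
  have Z2: "expectation (\<lambda>\<omega>. (?Z \<omega>)\<^sup>2) = 2 / (N\<^sup>2 * (N - 2))"
  proof -
    have "expectation (\<lambda>\<omega>. (?Z \<omega>)\<^sup>2) = (1 / N)\<^sup>2 - 2 / N * (1 / N) + 1 / (N * (N - 2))"
      using EZ[of 2] Y1 Y2 by (simp add: numeral_eq_Suc prob_space)
    also have "\<dots> = 2 / (N\<^sup>2 * (N - 2))" using N by (simp add: field_simps power2_eq_square)
    finally show ?thesis .
  qed
  have Z4: "expectation (\<lambda>\<omega>. ?Z \<omega> ^ 4) = 12 * (N + 12) / (N ^ 4 * (N - 2) * (N - 4) * (N - 6))"
  proof -
    have b4: "(\<Sum>j\<le>4. (real (4 choose j) * c ^ (4 - j)) * a j) = c ^ 4 * a 0 + 4 * c ^ 3 * a 1 + 6 * c\<^sup>2 * a 2 + 4 * c * a 3 + a 4"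
      for a :: "nat \<Rightarrow> real" and c :: real
      by (simp add: numeral_eq_Suc)
    have "expectation (\<lambda>\<omega>. ?Z \<omega> ^ 4) = (- 1 / N) ^ 4 + 4 * (- 1 / N) ^ 3 * (1 / N) + 6 * (- 1 / N)\<^sup>2 * (1 / (N * (N - 2)))
        + 4 * (- 1 / N) * (1 / (N * (N - 2) * (N - 4))) + 1 / (N * (N - 2) * (N - 4) * (N - 6))"
      using EZ[of 4] Y1 Y2 Y3 Y4 by (simp add: b4 prob_space)
    also have "\<dots> = 12 * (N + 12) / (N ^ 4 * (N - 2) * (N - 4) * (N - 6))"
    proof -
      \<comment> \<open>The reciprocals get names and every term is written with the common factor
        \<open>E\<close>; the claim then becomes a polynomial identity in \<open>N\<close>.\<close>
      define i a b c where "i = 1 / N" and "a = 1 / (N - 2)" and "b = 1 / (N - 4)" and "c = 1 / (N - 6)"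
      define E where "E = i ^ 4 * a * b * c"
      have inv: "N * i = 1" "(N - 2) * a = 1" "(N - 4) * b = 1" "(N - 6) * c = 1"
        using N by (simp_all add: i_def a_def b_def c_def)
      have "E * ((N - 2) * (N - 4) * (N - 6)) = i ^ 4 * ((N - 2) * a) * ((N - 4) * b) * ((N - 6) * c)"
        by (simp only: E_def mult_ac)
      then have e1: "i ^ 4 = E * ((N - 2) * (N - 4) * (N - 6))" by (simp add: inv)
      have "E * (N * (N - 4) * (N - 6)) = i\<^sup>2 * (i * a) * (N * i) * ((N - 4) * b) * ((N - 6) * c)"
        by (simp only: E_def power4_eq_xxxx power2_eq_square mult_ac)
      then have e2: "i\<^sup>2 * (i * a) = E * (N * (N - 4) * (N - 6))" by (simp add: inv)
      have "E * (N * N * (N - 6)) = i * (i * a * b) * (N * i) * (N * i) * ((N - 6) * c)"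
        by (simp only: E_def power4_eq_xxxx mult_ac)
      then have e3: "i * (i * a * b) = E * (N * N * (N - 6))" by (simp add: inv)
      have "E * (N * N * N) = i * a * b * c * (N * i) * (N * i) * (N * i)"
        by (simp only: E_def power4_eq_xxxx mult_ac)
      then have e4: "i * a * b * c = E * (N * N * N)" by (simp add: inv)
      have e0: "i ^ 3 * i = i ^ 4" by (simp add: power3_eq_cube power4_eq_xxxx)
      have "i ^ 4 - 4 * (i ^ 3 * i) + 6 * (i\<^sup>2 * (i * a)) - 4 * (i * (i * a * b)) + i * a * b * c = 12 * (N + 12) * E"
        unfolding e0 e1 e2 e3 e4 by (simp add: algebra_simps)
      then have "i ^ 4 - 4 * i ^ 3 * i + 6 * i\<^sup>2 * (i * a) - 4 * i * (i * a * b) + i * a * b * c =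
          12 * (N + 12) * (i ^ 4 * a * b * c)"
        by (simp only: E_def mult.assoc)
      then show ?thesis by (simp add: i_def a_def b_def c_def power_one_over)
    qed
    finally show ?thesis .
  qed
  have iv: "indep_var borel ?S borel ?Y"
  proof -
    have "indep_var borel ((\<lambda>u. \<Sum>i<p. ((u i)\<^sup>2 - 1)) \<circ> (\<lambda>\<omega>. restrict (\<lambda>i. g i \<omega>) {..<p}))
       borel ((\<lambda>u. 1 / (\<Sum>i\<in>{p..<m}. (u i)\<^sup>2)) \<circ> (\<lambda>\<omega>. restrict (\<lambda>i. g i \<omega>) {p..<m}))"
      by (rule indep_var_compose[OF indep_var_restrict[OF ind]]) (use pm in auto)
    then show ?thesis by (simp add: comp_def)
  qed
  have ivp: "indep_var borel (\<lambda>\<omega>. ?S \<omega> ^ a) borel (\<lambda>\<omega>. f (?Y \<omega>))" if "f \<in> borel_measurable borel" for a and f :: "real \<Rightarrow> real"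
    using indep_var_compose[OF iv, of "\<lambda>x. x ^ a" borel f borel] that by (simp add: comp_def)
  have prod: "integrable M (\<lambda>\<omega>. ?S \<omega> ^ a * f (?Y \<omega>))"
    "expectation (\<lambda>\<omega>. ?S \<omega> ^ a * f (?Y \<omega>)) = expectation (\<lambda>\<omega>. ?S \<omega> ^ a) * expectation (\<lambda>\<omega>. f (?Y \<omega>))"
    if "f \<in> borel_measurable borel" "integrable M (\<lambda>\<omega>. f (?Y \<omega>))" for a and f :: "real \<Rightarrow> real"
    using indep_var_integrable[OF ivp Sm(1) that(2)] indep_var_lebesgue_integral[OF ivp Sm(1) that(2)] that(1) by auto
  have V: "V \<omega> = ?S \<omega> * ?Y \<omega> + real p * ?Z \<omega>" for \<omega>
    by (simp add: V_def sum_subtractf diff_divide_distrib right_diff_distrib)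
  have SY: "integrable M (\<lambda>\<omega>. ?S \<omega> * ?Y \<omega>)" "expectation (\<lambda>\<omega>. ?S \<omega> * ?Y \<omega>) = 0"
    using prod[of "\<lambda>x. x" 1] Yi[of 1] Sm(2) by simp_all
  have Z1i: "integrable M ?Z" using Zi[of 1] by simp
  show "integrable M V" unfolding V by (intro Bochner_Integration.integrable_add SY integrable_mult_right Z1i)
  show "expectation V = 0" unfolding V using SY Z1 Z1i by simp
  have S2: "integrable M (\<lambda>\<omega>. (?S \<omega>)\<^sup>2 * (?Y \<omega>)\<^sup>2)"
    "expectation (\<lambda>\<omega>. (?S \<omega>)\<^sup>2 * (?Y \<omega>)\<^sup>2) = 2 * real p * (1 / (N * (N - 2)))"
    using prod[of "\<lambda>x. x\<^sup>2" 2] Yi[of 2] Sm(3) Y2 by simp_all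
  have YZi: "integrable M (\<lambda>\<omega>. ?Y \<omega> * (?Y \<omega> - 1 / N))"
  proof -
    have "integrable M (\<lambda>\<omega>. (?Y \<omega>)\<^sup>2 - 1 / N * ?Y \<omega>)"
      using Yi[of 2] Yi[of 1] by (intro Bochner_Integration.integrable_diff integrable_mult_right) simp_all
    then show ?thesis by (simp add: power2_eq_square right_diff_distrib mult.commute)
  qed
  \<comment> \<open>The cross term of the square carries a single factor \<open>S\<close>, whose
    expectation is 0.\<close>
  have SZ: "integrable M (\<lambda>\<omega>. ?S \<omega> * (?Y \<omega> * ?Z \<omega>))" "expectation (\<lambda>\<omega>. ?S \<omega> * (?Y \<omega> * ?Z \<omega>)) = 0"
    using prod[of "\<lambda>y. y * (y - 1 / N)" 1] YZi Sm(2) by simp_all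
  have V2: "(V \<omega>)\<^sup>2 = (?S \<omega>)\<^sup>2 * (?Y \<omega>)\<^sup>2 + 2 * real p * (?S \<omega> * (?Y \<omega> * ?Z \<omega>)) + (real p)\<^sup>2 * (?Z \<omega>)\<^sup>2" for \<omega>
    unfolding V by (simp add: power2_eq_square algebra_simps)
  note Z2i = Zi[of 2, simplified]
  show "integrable M (\<lambda>\<omega>. (V \<omega>)\<^sup>2)"
    unfolding V2 by (intro Bochner_Integration.integrable_add S2 integrable_mult_right SZ Z2i)
  have "expectation (\<lambda>\<omega>. (V \<omega>)\<^sup>2) = 2 * real p * (1 / (N * (N - 2))) + (real p)\<^sup>2 * (2 / (N\<^sup>2 * (N - 2)))"
    unfolding V2
    by (simp only: Bochner_Integration.integral_add Bochner_Integration.integrable_add integrable_mult_right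
        integral_mult_right_zero S2 SZ Z2i Z2 simp_thms)
  also have "\<dots> = 2 * real p * (N + real p) / (N\<^sup>2 * (N - 2))"
    using N by (simp add: divide_simps) (simp add: algebra_simps power2_eq_square)
  finally show "expectation (\<lambda>\<omega>. (V \<omega>)\<^sup>2) = 2 * real p * (N + real p) / (N\<^sup>2 * (N - 2))" .
  have S4: "integrable M (\<lambda>\<omega>. ?S \<omega> ^ 4 * ?Y \<omega> ^ 4)"
    "expectation (\<lambda>\<omega>. ?S \<omega> ^ 4 * ?Y \<omega> ^ 4) = (12 * (real p)\<^sup>2 + 48 * real p) * (1 / (N * (N - 2) * (N - 4) * (N - 6)))"
    using prod[of "\<lambda>x. x ^ 4" 4] Yi[of 4] Sm(4) Y4 by simp_all
  let ?B = "\<lambda>\<omega>. 8 * (?S \<omega> ^ 4 * ?Y \<omega> ^ 4 + real p ^ 4 * ?Z \<omega> ^ 4)"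
  have B: "integrable M ?B"
    by (intro integrable_mult_right Bochner_Integration.integrable_add S4 Zi) auto
  \<comment> \<open>This convexity bound avoids the mixed terms of the fourth power; an upper bound
    is all that the limit theorem requires.\<close>
  have four: "(a + b) ^ 4 \<le> 8 * (a ^ 4 + b ^ 4)" for a b :: real
  proof -
    have "(a + b)\<^sup>2 \<le> 2 * (a\<^sup>2 + b\<^sup>2)" using sum_squares_bound[of a b] by (simp add: power2_sum)
    then have "((a + b)\<^sup>2)\<^sup>2 \<le> (2 * (a\<^sup>2 + b\<^sup>2))\<^sup>2" by (rule power_mono) simp
    also have "\<dots> \<le> 8 * ((a\<^sup>2)\<^sup>2 + (b\<^sup>2)\<^sup>2)"
      using sum_squares_bound[of "a\<^sup>2" "b\<^sup>2"] by (simp add: power2_sum power_mult_distrib)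
    finally show ?thesis by simp
  qed
  have VB: "V \<omega> ^ 4 \<le> ?B \<omega>" for \<omega>
    using four[of "?S \<omega> * ?Y \<omega>" "real p * ?Z \<omega>"] unfolding V power_mult_distrib .
  have Vm: "V \<in> borel_measurable M" by (rule borel_measurable_integrable[OF \<open>integrable M V\<close>])
  show V4: "integrable M (\<lambda>\<omega>. V \<omega> ^ 4)"
    by (rule Bochner_Integration.integrable_bound[OF B]) (use Vm VB in \<open>auto intro: order_trans[OF _ abs_ge_self]\<close>)
  have "expectation (\<lambda>\<omega>. V \<omega> ^ 4) \<le> expectation ?B"
    by (intro integral_mono V4 B VB)
  also have "expectation ?B = 8 * (expectation (\<lambda>\<omega>. ?S \<omega> ^ 4 * ?Y \<omega> ^ 4) + real p ^ 4 * expectation (\<lambda>\<omega>. ?Z \<omega> ^ 4))"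
    using S4(1) Zi[of 4] by simp
  also have "\<dots> = 8 * ((12 * (real p)\<^sup>2 + 48 * real p) / (N * (N - 2) * (N - 4) * (N - 6)) +
      real p ^ 4 * (12 * (N + 12) / (N ^ 4 * (N - 2) * (N - 4) * (N - 6))))"
    unfolding S4(2) Z4 by simp
  finally show "expectation (\<lambda>\<omega>. V \<omega> ^ 4) \<le> 8 * ((12 * (real p)\<^sup>2 + 48 * real p) / (N * (N - 2) * (N - 4) * (N - 6)) +
      real p ^ 4 * (12 * (N + 12) / (N ^ 4 * (N - 2) * (N - 4) * (N - 6))))" .
qed

end

end

section \<open>A central limit theorem for triangular arrays\<close>

text \<open>The less familiar side comes from
  \<open>exp (- x) \<le> 1 / (1 + x) \<le> 1 - x + x\<^sup>2\<close>.\<close>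

lemma exp_minus_quadratic_bound:
  fixes x :: real
  assumes "0 \<le> x"
  shows "\<bar>(1 - x) - exp (- x)\<bar> \<le> x\<^sup>2"
proof -
  have 1: "1 - x \<le> exp (- x)" using exp_ge_add_one_self[of "- x"] by simp
  have "exp (- x) = inverse (exp x)" by (simp add: exp_minus)
  also have "\<dots> \<le> inverse (1 + x)"
    using assms exp_ge_add_one_self[of x] by (intro le_imp_inverse_le) auto
  also have "\<dots> \<le> 1 - x + x\<^sup>2"
    using assms by (simp add: field_simps power2_eq_square)
  finally show ?thesis using 1 by simp
qed

text \<open>The comparison is with the Gaussian characteristic function of the same variance rather
  than with \<open>1 - t\<^sup>2 * s / 2\<close>, so that both sides have modulus at most 1 and
  their powers can be compared. The third absolute moment in the Taylor remainder is controlled by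
  \<open>1 + x ^ 4\<close>; constants are crude since only orders in \<open>t\<close> count.\<close>

lemma (in real_distribution) char_gauss_approx:
  assumes 1: "integrable M (\<lambda>x. x)" "expectation (\<lambda>x. x) = 0"
    and 2: "integrable M (\<lambda>x. x\<^sup>2)" "expectation (\<lambda>x. x\<^sup>2) = s"
    and 4: "integrable M (\<lambda>x. x ^ 4)" "expectation (\<lambda>x. x ^ 4) \<le> C"
  shows "cmod (char M t - of_real (exp (- (t\<^sup>2 * s / 2)))) \<le> \<bar>t\<bar> ^ 3 * (1 + C) + t ^ 4 * s\<^sup>2"
proof -
  have s: "0 \<le> s" unfolding 2(2)[symmetric] by (rule Bochner_Integration.integral_nonneg) simp
  have C: "0 \<le> C" using order_trans[OF Bochner_Integration.integral_nonneg 4(2)] by simp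
  have cube: "\<bar>x\<bar> ^ 3 \<le> 1 + x ^ 4" for x :: real
  proof (cases "\<bar>x\<bar> \<le> 1")
    case True
    then have "\<bar>x\<bar> ^ 3 \<le> 1" by (intro power_le_one) auto
    then show ?thesis by (smt (verit) zero_le_even_power even_numeral)
  next
    case False
    then have "\<bar>x\<bar> ^ 3 \<le> \<bar>x\<bar> ^ 4" by (intro power_increasing) auto
    then show ?thesis by simp
  qed
  have i: "integrable M (\<lambda>x. \<bar>t\<bar> * (1 + x ^ 4))" using 4(1) by simp
  have "expectation (\<lambda>x. min (6 * x\<^sup>2) (\<bar>t\<bar> * \<bar>x\<bar> ^ 3)) \<le> expectation (\<lambda>x. \<bar>t\<bar> * (1 + x ^ 4))"
  proof (rule integral_mono[OF _ i])
    show "integrable M (\<lambda>x. min (6 * x\<^sup>2) (\<bar>t\<bar> * \<bar>x\<bar> ^ 3))"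
      by (rule Bochner_Integration.integrable_bound[OF integrable_mult_right[OF 2(1), of 6]]) auto
    show "min (6 * x\<^sup>2) (\<bar>t\<bar> * \<bar>x\<bar> ^ 3) \<le> \<bar>t\<bar> * (1 + x ^ 4)" for x
      using mult_left_mono[OF cube[of x], of "\<bar>t\<bar>"] by (simp add: min.coboundedI2)
  qed
  also have "\<dots> = \<bar>t\<bar> * (1 + expectation (\<lambda>x. x ^ 4))" using 4(1) prob_space by simp
  also have "\<dots> \<le> \<bar>t\<bar> * (1 + C)" using 4(2) by (intro mult_left_mono) auto
  finally have E: "expectation (\<lambda>x. min (6 * x\<^sup>2) (\<bar>t\<bar> * \<bar>x\<bar> ^ 3)) \<le> \<bar>t\<bar> * (1 + C)" .
  have var: "variance (\<lambda>x. x) = s" by (simp add: 1(2) 2(2))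
  have "cmod (char M t - (1 - t\<^sup>2 * s / 2)) \<le> t\<^sup>2 / 6 * (\<bar>t\<bar> * (1 + C))"
    by (rule order_trans[OF char_approx3[OF 1 2(1) var] mult_left_mono[OF E]]) simp
  also have "\<dots> \<le> 1 * (t\<^sup>2 * (\<bar>t\<bar> * (1 + C)))"
    using C by simp
  also have "\<dots> = \<bar>t\<bar> ^ 3 * (1 + C)" by (simp add: power3_eq_cube power2_eq_square abs_mult)
  finally have a: "cmod (char M t - of_real (1 - t\<^sup>2 * s / 2)) \<le> \<bar>t\<bar> ^ 3 * (1 + C)" by simp
  have "cmod (of_real (1 - t\<^sup>2 * s / 2) - of_real (exp (- (t\<^sup>2 * s / 2)))) \<le> (t\<^sup>2 * s / 2)\<^sup>2"
    unfolding of_real_diff[symmetric] norm_of_real using s by (intro exp_minus_quadratic_bound) auto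
  also have "\<dots> \<le> t ^ 4 * s\<^sup>2"
    by (simp add: power_mult_distrib power_divide)
  finally have b: "cmod (of_real (1 - t\<^sup>2 * s / 2) - of_real (exp (- (t\<^sup>2 * s / 2)))) \<le> t ^ 4 * s\<^sup>2" .
  show ?thesis using norm_triangle_le[OF add_mono[OF a b]] by simp
qed

lemma char_normal_distribution:
  fixes \<sigma> :: real
  assumes "\<sigma> > 0"
  shows "real_distribution (density lborel (normal_density 0 \<sigma>))"
    and "char (density lborel (normal_density 0 \<sigma>)) t = of_real (exp (- (t\<^sup>2 * \<sigma>\<^sup>2 / 2)))"
proof -
  let ?D = "density lborel (normal_density 0 \<sigma>)"
  interpret D: prob_space ?D by (rule prob_space_normal_density[OF assms])
  show "real_distribution ?D" by unfold_locales auto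
  have "distributed ?D lborel (\<lambda>x. x) (normal_density 0 \<sigma>)"
    by (auto simp: distributed_def distr_id2[of lborel ?D, simplified])
  then have Z: "distributed ?D lborel (\<lambda>x. (x - 0) / \<sigma>) std_normal_density"
    by (subst (asm) D.normal_standard_normal_convert[OF assms])
  have "char ?D t = (\<integral>x. iexp ((t * \<sigma>) * ((x - 0) / \<sigma>)) \<partial>?D)"
    using assms by (simp add: char_def)
  also have "\<dots> = (\<integral>x. iexp ((t * \<sigma>) * x) \<partial>distr ?D lborel (\<lambda>x. (x - 0) / \<sigma>))"
    by (subst integral_distr) auto
  also have "distr ?D lborel (\<lambda>x. (x - 0) / \<sigma>) = std_normal_distribution"
    using Z by (simp add: distributed_def)
  also have "(\<integral>x. iexp ((t * \<sigma>) * x) \<partial>std_normal_distribution) = of_real (exp (- (t * \<sigma>)\<^sup>2 / 2))"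
    using fun_cong[OF char_std_normal_distribution, of "t * \<sigma>"] by (simp add: char_def)
  finally show "char ?D t = of_real (exp (- (t\<^sup>2 * \<sigma>\<^sup>2 / 2)))" by (simp add: power_mult_distrib)
qed

text \<open>Powers of numbers of modulus at most 1 differ by at most \<open>k\<close> times the
  difference of the bases, and at the argument \<open>t / sqrt k\<close> one factor has an error of
  order \<open>k powr (- 3 / 2)\<close>, so the total error vanishes. The uniform bound
  \<open>C\<close> acts as a Lyapunov condition. Laws and moments are assumed only eventually,
  because early stages may have too few degrees of freedom.\<close>

theorem triangular_clt:
  fixes M :: "nat \<Rightarrow> 'a measure" and Y :: "nat \<Rightarrow> nat \<Rightarrow> 'a \<Rightarrow> real"
    and \<nu> :: "nat \<Rightarrow> real measure" and k :: "nat \<Rightarrow> nat" and s :: "nat \<Rightarrow> real"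
  assumes M: "\<And>j. prob_space (M j)"
    and ind: "\<And>j. prob_space.indep_vars (M j) (\<lambda>_. borel) (Y j) {..<k j}"
    and law: "\<forall>\<^sub>F j in sequentially. \<forall>l<k j. distr (M j) borel (Y j l) = \<nu> j"
    and \<nu>: "\<And>j. real_distribution (\<nu> j)"
    and kp: "\<And>j. k j > 0" and k: "filterlim k at_top sequentially"
    and 1: "\<forall>\<^sub>F j in sequentially. integrable (\<nu> j) (\<lambda>x. x) \<and> (\<integral>x. x \<partial>\<nu> j) = 0"
    and 2: "\<forall>\<^sub>F j in sequentially. integrable (\<nu> j) (\<lambda>x. x\<^sup>2) \<and> (\<integral>x. x\<^sup>2 \<partial>\<nu> j) = s j"
    and 4: "\<forall>\<^sub>F j in sequentially. integrable (\<nu> j) (\<lambda>x. x ^ 4) \<and> (\<integral>x. x ^ 4 \<partial>\<nu> j) \<le> C"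
    and s: "s \<longlonglongrightarrow> \<sigma>\<^sup>2" and \<sigma>: "\<sigma> > 0"
  shows "weak_conv_m (\<lambda>j. distr (M j) borel (\<lambda>\<omega>. (\<Sum>l<k j. Y j l \<omega>) / sqrt (k j)))
    (density lborel (normal_density 0 \<sigma>))"
proof (rule levy_continuity)
  have Ym: "Y j l \<in> borel_measurable (M j)" if "l < k j" for j l
    using ind[of j] that unfolding prob_space.indep_vars_def2[OF M] by simp
  have Sm: "(\<lambda>\<omega>. (\<Sum>l<k j. Y j l \<omega>) / sqrt (k j)) \<in> borel_measurable (M j)" for j
    by (intro borel_measurable_divide borel_measurable_sum Ym) auto
  show "real_distribution (distr (M j) borel (\<lambda>\<omega>. (\<Sum>l<k j. Y j l \<omega>) / sqrt (k j)))" for j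
    by (rule prob_space.real_distribution_distr[OF M Sm])
  show "real_distribution (density lborel (normal_density 0 \<sigma>))"
    by (rule char_normal_distribution(1)[OF \<sigma>])
  fix t :: real
  have char_sum: "char (distr (M j) borel (\<lambda>\<omega>. (\<Sum>l<k j. Y j l \<omega>) / sqrt (k j))) t = char (\<nu> j) (t / sqrt (k j)) ^ k j"
    if "\<forall>l<k j. distr (M j) borel (Y j l) = \<nu> j" for j
  proof -
    have "char (distr (M j) borel (\<lambda>\<omega>. (\<Sum>l<k j. Y j l \<omega>) / sqrt (k j))) t =
        char (distr (M j) borel (\<lambda>\<omega>. \<Sum>l<k j. Y j l \<omega>)) (t / sqrt (k j))"
    proof -
      have "(\<lambda>\<omega>. \<Sum>l<k j. Y j l \<omega>) \<in> borel_measurable (M j)"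
        by (intro borel_measurable_sum Ym) auto
      then show ?thesis using Sm[of j] by (simp add: char_def integral_distr)
    qed
    also have "\<dots> = (\<Prod>l<k j. char (distr (M j) borel (Y j l)) (t / sqrt (k j)))"
      by (rule prob_space.char_distr_sum[OF M ind])
    also have "\<dots> = char (\<nu> j) (t / sqrt (k j)) ^ k j"
      using that by simp
    finally show ?thesis .
  qed
  have bound: "\<forall>\<^sub>F j in sequentially. norm (char (\<nu> j) (t / sqrt (k j)) ^ k j - of_real (exp (- (t\<^sup>2 * s j / 2))))
      \<le> \<bar>t\<bar> ^ 3 * (1 + C) / sqrt (k j) + t ^ 4 * (s j)\<^sup>2 / k j"
    using 1 2 4
  proof eventually_elim
    case (elim j)
    interpret \<nu>: real_distribution "\<nu> j" by (rule \<nu>)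
    let ?t = "t / sqrt (k j)"
    have kj: "real (k j) > 0" using kp by simp
    have sj: "0 \<le> s j" using elim Bochner_Integration.integral_nonneg[of "\<nu> j" "\<lambda>x. x\<^sup>2"] by auto
    have e: "exp (- (?t\<^sup>2 * s j / 2)) ^ k j = exp (- (t\<^sup>2 * s j / 2))"
      using kj by (simp add: exp_of_nat_mult[symmetric] power_divide)
    have "norm (char (\<nu> j) ?t ^ k j - of_real (exp (- (?t\<^sup>2 * s j / 2))) ^ k j) \<le>
        k j * norm (char (\<nu> j) ?t - of_real (exp (- (?t\<^sup>2 * s j / 2))))"
      by (rule norm_power_diff) (use sj \<nu>.cmod_char_le_1 in auto)
    also have "\<dots> \<le> k j * (\<bar>?t\<bar> ^ 3 * (1 + C) + ?t ^ 4 * (s j)\<^sup>2)"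
      using elim by (intro mult_left_mono \<nu>.char_gauss_approx) auto
    also have "\<dots> = \<bar>t\<bar> ^ 3 * (1 + C) / sqrt (k j) + t ^ 4 * (s j)\<^sup>2 / k j"
    proof -
      \<comment> \<open>Substituting \<open>r\<^sup>2\<close> for \<open>k\<close> turns the claim
        into an identity of rational functions of \<open>r\<close>.\<close>
      define r where "r = sqrt (real (k j))"
      have r: "real (k j) = r\<^sup>2" "r > 0" using kj by (auto simp: r_def)
      show ?thesis unfolding r_def[symmetric] unfolding r(1) using r(2)
        by (simp add: field_simps power_divide abs_divide eval_nat_numeral)
    qed
    finally show ?case unfolding of_real_power[symmetric] e .
  qed
  have kr: "filterlim (\<lambda>j. real (k j)) at_top sequentially"
    by (rule filterlim_compose[OF filterlim_real_sequentially k])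
  have "((\<lambda>j. \<bar>t\<bar> ^ 3 * (1 + C) / sqrt (k j) + t ^ 4 * (s j)\<^sup>2 / k j) \<longlongrightarrow> 0 + 0) sequentially"
  proof (rule tendsto_add)
    show "(\<lambda>j. \<bar>t\<bar> ^ 3 * (1 + C) / sqrt (k j)) \<longlonglongrightarrow> 0"
      by (rule tendsto_divide_0[OF tendsto_const])
        (intro filterlim_at_top_imp_at_infinity filterlim_compose[OF sqrt_at_top kr])
    show "(\<lambda>j. t ^ 4 * (s j)\<^sup>2 / k j) \<longlonglongrightarrow> 0"
      by (rule tendsto_divide_0[OF tendsto_mult[OF tendsto_const tendsto_power[OF s]]])
        (intro filterlim_at_top_imp_at_infinity kr)
  qed
  then have "(\<lambda>j. char (\<nu> j) (t / sqrt (k j)) ^ k j - of_real (exp (- (t\<^sup>2 * s j / 2)))) \<longlonglongrightarrow> 0"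
    using Lim_null_comparison[OF bound] by simp
  moreover have "(\<lambda>j. complex_of_real (exp (- (t\<^sup>2 * s j / 2)))) \<longlonglongrightarrow> of_real (exp (- (t\<^sup>2 * \<sigma>\<^sup>2 / 2)))"
    by (intro tendsto_intros s) auto
  ultimately have "(\<lambda>j. (char (\<nu> j) (t / sqrt (k j)) ^ k j - of_real (exp (- (t\<^sup>2 * s j / 2)))) + of_real (exp (- (t\<^sup>2 * s j / 2))))
      \<longlonglongrightarrow> 0 + of_real (exp (- (t\<^sup>2 * \<sigma>\<^sup>2 / 2)))"
    by (rule tendsto_add)
  then have "(\<lambda>j. char (\<nu> j) (t / sqrt (k j)) ^ k j) \<longlonglongrightarrow> of_real (exp (- (t\<^sup>2 * \<sigma>\<^sup>2 / 2)))"
    by simp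
  then show "(\<lambda>j. char (distr (M j) borel (\<lambda>\<omega>. (\<Sum>l<k j. Y j l \<omega>) / sqrt (k j))) t) \<longlonglongrightarrow>
      char (density lborel (normal_density 0 \<sigma>)) t"
    unfolding char_normal_distribution(2)[OF \<sigma>]
    by (rule Lim_transform_eventually) (use law in \<open>eventually_elim, simp add: char_sum\<close>)
qed

section \<open>The pooled statistic\<close>

lemma distr_std_gauss_component:
  assumes "i < m"
  shows "distr (std_gauss m) borel (\<lambda>g. g i) = std_normal_distribution"
proof -
  have "distr (std_gauss m) std_normal_distribution (\<lambda>g. g i) = std_normal_distribution"
    by (rule distr_PiM_component) (use assms prob_space_std_normal in auto)
  moreover have "distr (std_gauss m) borel (\<lambda>g. g i) = distr (std_gauss m) std_normal_distribution (\<lambda>g. g i)"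
    by (rule distr_cong) auto
  ultimately show ?thesis by simp
qed

lemma indep_vars_std_gauss:
  assumes "0 < m"
  shows "prob_space.indep_vars (std_gauss m) (\<lambda>_. borel) (\<lambda>i g. g i) {..<m}"
proof -
  interpret N: prob_space "std_gauss m" by (rule prob_space_std_gauss)
  have rv: "(\<lambda>g. g i) \<in> borel_measurable (std_gauss m)" if "i \<in> {..<m}" for i
    by (rule measurable_std_gauss_component)
  \<comment> \<open>\<open>borel\<close> and \<open>std_normal_distribution\<close> have the same
    measurable sets, so the coordinate map is the identity and its law is already the product of the
    marginals.\<close>
  have "distr (std_gauss m) (\<Pi>\<^sub>M i\<in>{..<m}. borel) (\<lambda>g. \<lambda>i\<in>{..<m}. g i) = distr (std_gauss m) (std_gauss m) (\<lambda>g. g)"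
    by (rule distr_cong) (auto simp: space_PiM restrict_PiE_iff PiE_restrict intro!: sets_PiM_cong)
  also have "\<dots> = std_gauss m" by simp
  also have "\<dots> = (\<Pi>\<^sub>M i\<in>{..<m}. distr (std_gauss m) borel (\<lambda>g. g i))"
    by (intro PiM_cong) (simp_all add: distr_std_gauss_component)
  finally show ?thesis using assms rv by (subst N.indep_vars_iff_distr_eq_PiM') auto
qed

lemma hotelling_T2_cong:
  assumes "\<And>i. i \<in> S \<Longrightarrow> x i = x' i"
  shows "hotelling_T2 p S \<mu>0 x = hotelling_T2 p S \<mu>0 x'"
proof -
  have m: "sample_mean S x = sample_mean S x'"
    using assms by (auto simp: sample_mean_def fun_eq_iff intro!: sum.cong)
  moreover have "sample_cov S x = sample_cov S x'"
    using assms by (auto simp: sample_cov_def fun_eq_iff m intro!: sum.cong)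
  ultimately show ?thesis by (simp add: hotelling_T2_def)
qed

lemma (in prob_space) indep_vars_hotelling_T2:
  fixes X :: "nat \<Rightarrow> 'a \<Rightarrow> nat \<Rightarrow> real"
  assumes ind: "indep_vars (\<lambda>_. borel) X I"
    and S: "\<And>l. l \<in> L \<Longrightarrow> S l \<subseteq> I" "disjoint_family_on S L"
  shows "indep_vars (\<lambda>_. borel) (\<lambda>l \<omega>. hotelling_T2 p (S l) \<mu>0 (\<lambda>i. X i \<omega>)) L"
proof -
  have "indep_vars (\<lambda>l. PiM (S l) (\<lambda>_. borel)) (\<lambda>l \<omega>. restrict (\<lambda>i. X i \<omega>) (S l)) L"
    by (rule indep_vars_restrict[OF ind S])
  then have "indep_vars (\<lambda>_. borel) (\<lambda>l \<omega>. hotelling_T2 p (S l) \<mu>0 (restrict (\<lambda>i. X i \<omega>) (S l))) L"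
  proof (rule indep_vars_compose2)
    fix l
    show "hotelling_T2 p (S l) \<mu>0 \<in> borel_measurable (PiM (S l) (\<lambda>_. borel :: (nat \<Rightarrow> real) measure))"
      by (intro measurable_hotelling_T2 measurable_coordinate measurable_component_singleton)
  qed
  moreover have "hotelling_T2 p (S l) \<mu>0 (restrict (\<lambda>i. X i \<omega>) (S l)) = hotelling_T2 p (S l) \<mu>0 (\<lambda>i. X i \<omega>)" for l \<omega>
    by (rule hotelling_T2_cong) simp
  ultimately show ?thesis by simp
qed

text \<open>Under \<open>std_gauss m\<close> this has the law of \<open>T\<^sup>2 / sqrt p\<close> minus its mean.\<close>
definition centred_ratio :: "nat \<Rightarrow> nat \<Rightarrow> (nat \<Rightarrow> real) \<Rightarrow> real" where
  "centred_ratio m p g = (real m - 1) / sqrt (real p) *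
    ((\<Sum>i<p. (g i)\<^sup>2) / (\<Sum>i\<in>{p..<m}. (g i)\<^sup>2) - real p / (real m - real p - 2))"

lemma measurable_centred_ratio:
  "centred_ratio m p \<in> borel_measurable (std_gauss m)"
  unfolding centred_ratio_def
  by (intro borel_measurable_times borel_measurable_const borel_measurable_diff borel_measurable_divide
      borel_measurable_sum borel_measurable_power measurable_std_gauss_component)

text \<open>The scaling contributes \<open>1 / p\<^sup>2\<close> to the fourth moment and cancels
  two powers of \<open>p\<close> in each term; the \<open>p\<^sup>2\<close> left in the second term
  is bounded by \<open>m\<^sup>2\<close>. The bound then depends on \<open>p\<close> only through
  \<open>N\<close>, which suits the regime where \<open>N\<close> is comparable to
  \<open>m\<close>.\<close>

lemma centred_ratio_moments:
  assumes p: "0 < p" "p < m" and q: "real m - real p > 8"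
  defines "N \<equiv> real m - real p - 2" and "\<nu> \<equiv> distr (std_gauss m) borel (centred_ratio m p)"
  shows "integrable \<nu> (\<lambda>x. x)" "(\<integral>x. x \<partial>\<nu>) = 0"
    and "integrable \<nu> (\<lambda>x. x\<^sup>2)" "(\<integral>x. x\<^sup>2 \<partial>\<nu>) = 2 * (real m - 1)\<^sup>2 * (real m - 2) / (N\<^sup>2 * (N - 2))"
    and "integrable \<nu> (\<lambda>x. x ^ 4)"
    and "(\<integral>x. x ^ 4 \<partial>\<nu>) \<le> 8 * (60 * real m ^ 4 / (N * (N - 2) * (N - 4) * (N - 6)) +
      12 * real m ^ 6 * (N + 12) / (N ^ 4 * (N - 2) * (N - 4) * (N - 6)))"
proof -
  let ?G = "std_gauss m"
  let ?a = "(real m - 1) / sqrt (real p)"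
  let ?V = "\<lambda>g. (\<Sum>i<p. (g i)\<^sup>2) / (\<Sum>i\<in>{p..<m}. (g i)\<^sup>2) - real p / N"
  have N: "N > 6" using q by (simp add: N_def)
  have c: "centred_ratio m p = (\<lambda>g. ?a * ?V g)" by (simp add: centred_ratio_def fun_eq_iff N_def)
  have cm: "centred_ratio m p \<in> borel_measurable ?G" by (rule measurable_centred_ratio)
  have m: "0 < m" using p by simp
  note V = prob_space.chi_sq_ratio_moments[OF prob_space_std_gauss indep_vars_std_gauss[OF m] distr_std_gauss_component p(2) q,
      folded N_def]
  have tri: "integrable \<nu> (\<lambda>x. x ^ k)" if "integrable ?G (\<lambda>g. ?V g ^ k)" for k
  proof -
    have "integrable ?G (\<lambda>g. centred_ratio m p g ^ k)"
      unfolding c power_mult_distrib using that by (rule integrable_mult_right)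
    then show ?thesis unfolding \<nu>_def by (subst integrable_distr_eq[OF cm]) auto
  qed
  have tr: "(\<integral>x. x ^ k \<partial>\<nu>) = ?a ^ k * (\<integral>g. ?V g ^ k \<partial>?G)" for k
  proof -
    have "(\<integral>x. x ^ k \<partial>\<nu>) = (\<integral>g. centred_ratio m p g ^ k \<partial>?G)"
      unfolding \<nu>_def by (subst integral_distr[OF cm]) auto
    also have "\<dots> = ?a ^ k * (\<integral>g. ?V g ^ k \<partial>?G)"
      unfolding c power_mult_distrib by (rule integral_mult_right_zero)
    finally show ?thesis .
  qed
  show "integrable \<nu> (\<lambda>x. x)" using tri[of 1] V(1) by simp
  show "(\<integral>x. x \<partial>\<nu>) = 0" using tr[of 1] V(4) by simp
  show "integrable \<nu> (\<lambda>x. x\<^sup>2)" by (rule tri[OF V(2)])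
  have sp: "(sqrt (real p))\<^sup>2 = real p" "sqrt (real p) ^ 4 = (real p)\<^sup>2"
    by (simp, metis power2_eq_square real_sqrt_pow2 of_nat_0_le_iff power_even_eq numeral_Bit0 power_add mult_2)
  have a2: "?a\<^sup>2 = (real m - 1)\<^sup>2 / p" and a4: "?a ^ 4 = (real m - 1) ^ 4 / (real p)\<^sup>2"
    by (simp_all add: power_divide sp)
  have "(\<integral>x. x\<^sup>2 \<partial>\<nu>) = ?a\<^sup>2 * (\<integral>g. (?V g)\<^sup>2 \<partial>?G)"
    by (rule tr)
  also have "\<dots> = 2 * (real m - 1)\<^sup>2 * (real m - 2) / (N\<^sup>2 * (N - 2))"
  proof -
    have V5: "(\<integral>g. (?V g)\<^sup>2 \<partial>?G) = 2 * real p * (N + real p) / (N\<^sup>2 * (N - 2))" by (rule V(5))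
    have Np: "N + real p = real m - 2" by (simp add: N_def)
    show ?thesis unfolding a2 V5 Np using p N by (simp add: field_simps)
  qed
  finally show "(\<integral>x. x\<^sup>2 \<partial>\<nu>) = 2 * (real m - 1)\<^sup>2 * (real m - 2) / (N\<^sup>2 * (N - 2))" .
  show "integrable \<nu> (\<lambda>x. x ^ 4)" by (rule tri[OF V(3)])
  have "(\<integral>x. x ^ 4 \<partial>\<nu>) = ?a ^ 4 * (\<integral>g. ?V g ^ 4 \<partial>?G)"
    by (rule tr)
  also have "\<dots> \<le> (real m ^ 4 / (real p)\<^sup>2) * (8 * ((60 * (real p)\<^sup>2) / (N * (N - 2) * (N - 4) * (N - 6)) +
      (real p)\<^sup>2 * (real m)\<^sup>2 * (12 * (N + 12) / (N ^ 4 * (N - 2) * (N - 4) * (N - 6)))))"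
  proof (rule mult_mono)
    show "?a ^ 4 \<le> real m ^ 4 / (real p)\<^sup>2"
      unfolding a4 using p by (intro divide_right_mono power_mono) auto
    have "(12 * (real p)\<^sup>2 + 48 * real p) \<le> 60 * (real p)\<^sup>2"
      using p by (simp add: power2_eq_square)
    moreover have "real p ^ 4 \<le> (real p)\<^sup>2 * (real m)\<^sup>2"
    proof -
      have "real p ^ 4 = (real p)\<^sup>2 * (real p)\<^sup>2" by (simp add: power_add[symmetric])
      also have "\<dots> \<le> (real p)\<^sup>2 * (real m)\<^sup>2" using p by (intro mult_left_mono power_mono) auto
      finally show ?thesis .
    qed
    ultimately have "8 * ((12 * (real p)\<^sup>2 + 48 * real p) / (N * (N - 2) * (N - 4) * (N - 6)) +
        real p ^ 4 * (12 * (N + 12) / (N ^ 4 * (N - 2) * (N - 4) * (N - 6)))) \<le>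
      8 * ((60 * (real p)\<^sup>2) / (N * (N - 2) * (N - 4) * (N - 6)) +
      (real p)\<^sup>2 * (real m)\<^sup>2 * (12 * (N + 12) / (N ^ 4 * (N - 2) * (N - 4) * (N - 6))))"
      using N by (intro mult_left_mono add_mono divide_right_mono mult_right_mono divide_nonneg_nonneg mult_nonneg_nonneg) auto
    from order_trans[OF V(6) this]
    show "(\<integral>g. ?V g ^ 4 \<partial>?G) \<le> 8 * ((60 * (real p)\<^sup>2) / (N * (N - 2) * (N - 4) * (N - 6)) +
      (real p)\<^sup>2 * (real m)\<^sup>2 * (12 * (N + 12) / (N ^ 4 * (N - 2) * (N - 4) * (N - 6))))" .
  qed (auto intro: Bochner_Integration.integral_nonneg)
  also have "\<dots> = 8 * (60 * real m ^ 4 / (N * (N - 2) * (N - 4) * (N - 6)) +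
      12 * real m ^ 6 * (N + 12) / (N ^ 4 * (N - 2) * (N - 4) * (N - 6)))"
  proof -
    have r: "(M ^ 4 / P\<^sup>2) * (8 * ((60 * P\<^sup>2) / A + P\<^sup>2 * M\<^sup>2 * (12 * B / D))) = 8 * (60 * M ^ 4 / A + 12 * M ^ 6 * B / D)"
      if "P > 0" for P A B D M :: real
    proof -
      have "M ^ 6 = M ^ 4 * M\<^sup>2" by (simp add: power_add[symmetric])
      show ?thesis unfolding \<open>M ^ 6 = M ^ 4 * M\<^sup>2\<close> using that by (simp add: distrib_left mult_ac)
    qed
    show ?thesis by (rule r) (use p in simp)
  qed
  finally show "(\<integral>x. x ^ 4 \<partial>\<nu>) \<le> 8 * (60 * real m ^ 4 / (N * (N - 2) * (N - 4) * (N - 6)) +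
      12 * real m ^ 6 * (N + 12) / (N ^ 4 * (N - 2) * (N - 4) * (N - 6)))" .
qed

text \<open>Dividing by powers of \<open>m\<close> leaves rational functions of
  \<open>x = N / m\<close> and \<open>h = 1 / m\<close>, continuous at \<open>(1 - r, 0)\<close>
  because \<open>r < 1\<close>. Numerator and denominator have equal degree in \<open>m\<close>: 3
  for the variance, 4 and 7 for the two terms of the bound.\<close>

lemma moment_limits:
  fixes m p :: "nat \<Rightarrow> nat" and r :: real
  assumes m: "filterlim (\<lambda>j. real (m j)) at_top sequentially"
    and r: "(\<lambda>j. real (p j) / real (m j)) \<longlonglongrightarrow> r" "r < 1"
  defines "N \<equiv> \<lambda>j. real (m j) - real (p j) - 2"
  shows "(\<lambda>j. 2 * (real (m j) - 1)\<^sup>2 * (real (m j) - 2) / ((N j)\<^sup>2 * (N j - 2))) \<longlonglongrightarrow> 2 / (1 - r) ^ 3"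
    and "\<exists>C. \<forall>\<^sub>F j in sequentially. 8 * (60 * real (m j) ^ 4 / (N j * (N j - 2) * (N j - 4) * (N j - 6)) +
      12 * real (m j) ^ 6 * (N j + 12) / (N j ^ 4 * (N j - 2) * (N j - 4) * (N j - 6))) \<le> C"
    and "\<forall>\<^sub>F j in sequentially. real (m j) - real (p j) > 8"
proof -
  define h where "h j = 1 / real (m j)" for j
  define x where "x j = 1 - real (p j) / real (m j) - 2 * h j" for j
  have h: "h \<longlonglongrightarrow> 0" unfolding h_def
    by (rule tendsto_divide_0[OF tendsto_const filterlim_at_top_imp_at_infinity[OF m]])
  have "x \<longlonglongrightarrow> 1 - r - 2 * 0" unfolding x_def by (intro tendsto_intros r h)
  then have x: "x \<longlonglongrightarrow> 1 - r" by simp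
  have pos: "\<forall>\<^sub>F j in sequentially. real (m j) > 0"
    using m unfolding filterlim_at_top_dense by (rule spec)
  have r0: "1 - r \<noteq> 0" using r(2) by simp
  have xm: "N j = x j * real (m j)" and hm: "h j * real (m j) = 1" if "real (m j) > 0" for j
    using that by (simp_all add: x_def h_def N_def field_simps)
  show "(\<lambda>j. 2 * (real (m j) - 1)\<^sup>2 * (real (m j) - 2) / ((N j)\<^sup>2 * (N j - 2))) \<longlonglongrightarrow> 2 / (1 - r) ^ 3"
  proof (rule Lim_transform_eventually)
    have "(\<lambda>j. 2 * (1 - h j)\<^sup>2 * (1 - 2 * h j) / ((x j)\<^sup>2 * (x j - 2 * h j))) \<longlonglongrightarrow>
        2 * (1 - 0)\<^sup>2 * (1 - 2 * 0) / ((1 - r)\<^sup>2 * (1 - r - 2 * 0))"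
      by (intro tendsto_intros h x) (use r0 in auto)
    then show "(\<lambda>j. 2 * (1 - h j)\<^sup>2 * (1 - 2 * h j) / ((x j)\<^sup>2 * (x j - 2 * h j))) \<longlonglongrightarrow> 2 / (1 - r) ^ 3"
      by (simp add: power2_eq_square power3_eq_cube mult.assoc)
    show "\<forall>\<^sub>F j in sequentially. 2 * (1 - h j)\<^sup>2 * (1 - 2 * h j) / ((x j)\<^sup>2 * (x j - 2 * h j)) =
        2 * (real (m j) - 1)\<^sup>2 * (real (m j) - 2) / ((N j)\<^sup>2 * (N j - 2))"
      using pos
    proof eventually_elim
      case (elim j)
      define M H X where "M = real (m j)" and "H = h j" and "X = x j"
      have M: "M > 0" "H * M = 1" using elim hm[OF elim] by (simp_all add: M_def H_def)
      have e1: "M - 1 = M * (1 - H)" "M - 2 = M * (1 - 2 * H)" "X * M - 2 = M * (X - 2 * H)"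
        using M(2) by (simp_all add: algebra_simps)
      have "2 * (M - 1)\<^sup>2 * (M - 2) / ((X * M)\<^sup>2 * (X * M - 2)) =
          (M ^ 3 * (2 * (1 - H)\<^sup>2 * (1 - 2 * H))) / (M ^ 3 * (X\<^sup>2 * (X - 2 * H)))"
        unfolding e1 by (simp add: power2_eq_square power3_eq_cube mult_ac)
      also have "\<dots> = 2 * (1 - H)\<^sup>2 * (1 - 2 * H) / (X\<^sup>2 * (X - 2 * H))"
        using M(1) by (subst mult_divide_mult_cancel_left) auto
      finally show ?case unfolding xm[OF elim] M_def H_def X_def by simp
    qed
  qed
  let ?L = "8 * (60 / ((1 - r) * (1 - r - 2 * 0) * (1 - r - 4 * 0) * (1 - r - 6 * 0)) +
      12 * (1 - r + 12 * 0) / ((1 - r) ^ 4 * (1 - r - 2 * 0) * (1 - r - 4 * 0) * (1 - r - 6 * 0)))"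
  have "(\<lambda>j. 8 * (60 / (x j * (x j - 2 * h j) * (x j - 4 * h j) * (x j - 6 * h j)) +
      12 * (x j + 12 * h j) / (x j ^ 4 * (x j - 2 * h j) * (x j - 4 * h j) * (x j - 6 * h j)))) \<longlonglongrightarrow> ?L"
    by (intro tendsto_intros h x) (use r0 in auto)
  then have "\<forall>\<^sub>F j in sequentially. 8 * (60 / (x j * (x j - 2 * h j) * (x j - 4 * h j) * (x j - 6 * h j)) +
      12 * (x j + 12 * h j) / (x j ^ 4 * (x j - 2 * h j) * (x j - 4 * h j) * (x j - 6 * h j))) < ?L + 1"
    by (rule order_tendstoD(2)) simp
  then have "\<forall>\<^sub>F j in sequentially. 8 * (60 * real (m j) ^ 4 / (N j * (N j - 2) * (N j - 4) * (N j - 6)) +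
      12 * real (m j) ^ 6 * (N j + 12) / (N j ^ 4 * (N j - 2) * (N j - 4) * (N j - 6))) \<le> ?L + 1"
    using pos
  proof eventually_elim
    case (elim j)
    define M H X where "M = real (m j)" and "H = h j" and "X = x j"
    have M: "M > 0" "H * M = 1" using elim hm[OF elim(2)] by (simp_all add: M_def H_def)
    have e1: "X * M - 2 = M * (X - 2 * H)" "X * M - 4 = M * (X - 4 * H)" "X * M - 6 = M * (X - 6 * H)" "X * M + 12 = M * (X + 12 * H)"
      using M(2) by (simp_all add: algebra_simps)
    have "60 * M ^ 4 / (X * M * (X * M - 2) * (X * M - 4) * (X * M - 6)) =
        (M ^ 4 * 60) / (M ^ 4 * (X * (X - 2 * H) * (X - 4 * H) * (X - 6 * H)))"
      unfolding e1 by (simp add: eval_nat_numeral mult_ac)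
    also have "\<dots> = 60 / (X * (X - 2 * H) * (X - 4 * H) * (X - 6 * H))"
      using M(1) by (subst mult_divide_mult_cancel_left) auto
    finally have 1: "60 * M ^ 4 / (X * M * (X * M - 2) * (X * M - 4) * (X * M - 6)) = \<dots>" .
    have "12 * M ^ 6 * (X * M + 12) / ((X * M) ^ 4 * (X * M - 2) * (X * M - 4) * (X * M - 6)) =
        (M ^ 7 * (12 * (X + 12 * H))) / (M ^ 7 * (X ^ 4 * (X - 2 * H) * (X - 4 * H) * (X - 6 * H)))"
      unfolding e1 by (simp add: eval_nat_numeral mult_ac)
    also have "\<dots> = 12 * (X + 12 * H) / (X ^ 4 * (X - 2 * H) * (X - 4 * H) * (X - 6 * H))"
      using M(1) by (subst mult_divide_mult_cancel_left) auto
    finally have 2: "12 * M ^ 6 * (X * M + 12) / ((X * M) ^ 4 * (X * M - 2) * (X * M - 4) * (X * M - 6)) = \<dots>" .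
    show ?case
      using elim(1) unfolding xm[OF elim(2)] M_def[symmetric] H_def[symmetric] X_def[symmetric] 1 2 by simp
  qed
  then show "\<exists>C. \<forall>\<^sub>F j in sequentially. 8 * (60 * real (m j) ^ 4 / (N j * (N j - 2) * (N j - 4) * (N j - 6)) +
      12 * real (m j) ^ 6 * (N j + 12) / (N j ^ 4 * (N j - 2) * (N j - 4) * (N j - 6))) \<le> C" by blast
  have "filterlim (\<lambda>j. x j * real (m j)) at_top sequentially"
    by (rule filterlim_tendsto_pos_mult_at_top[OF x _ m]) (use r(2) in simp)
  \<comment> \<open>As \<open>N = m - p - 2\<close>, the bound \<open>N > 6\<close> is the condition
    \<open>m - p > 8\<close> of the moment lemmas.\<close>
  then have "\<forall>\<^sub>F j in sequentially. x j * real (m j) > 6"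
    unfolding filterlim_at_top_dense by (rule spec)
  then show "\<forall>\<^sub>F j in sequentially. real (m j) - real (p j) > 8"
    using pos
  proof eventually_elim
    case (elim j)
    then show ?case using xm[OF elim(2)] by (simp add: N_def)
  qed
qed


text \<open>One index \<open>j\<close> drives \<open>n\<close>, \<open>k\<close> and
  \<open>p\<close> together. Every stage has its own probability space, since convergence in
  distribution concerns laws only.\<close>

theorem theorem1:
  fixes M :: "nat \<Rightarrow> 'a measure"
    and X :: "nat \<Rightarrow> nat \<Rightarrow> 'a \<Rightarrow> nat \<Rightarrow> real"
    and n k p :: "nat \<Rightarrow> nat"
    and S :: "nat \<Rightarrow> nat \<Rightarrow> nat set"
    and \<mu> \<mu>0 :: "nat \<Rightarrow> nat \<Rightarrow> real"
    and \<Sigma> :: "nat \<Rightarrow> nat \<Rightarrow> nat \<Rightarrow> real"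
    and r :: real
  assumes prob: "\<And>j. prob_space (M j)"
    and p_pos: "\<And>j. p j > 0"
    and k_pos: "\<And>j. k j > 0"
    and k_dvd: "\<And>j. k j dvd n j"
    and part_sub: "\<And>j l. l < k j \<Longrightarrow> S j l \<subseteq> {..<n j}"
    and part_disj: "\<And>j l l'. l < k j \<Longrightarrow> l' < k j \<Longrightarrow> l \<noteq> l' \<Longrightarrow> S j l \<inter> S j l' = {}"
    and part_cover: "\<And>j. (\<Union>l<k j. S j l) = {..<n j}"
    and part_card: "\<And>j l. l < k j \<Longrightarrow> card (S j l) = n j div k j"
    and indep: "\<And>j. prob_space.indep_vars (M j) (\<lambda>_. borel) (X j) {..<n j}"
    and gauss: "\<And>j i. i < n j \<Longrightarrow> mvnormal (M j) (p j) (X j i) (\<mu> j) (\<Sigma> j)"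
    and Sigma_pd: "\<And>j. pos_def_mat (p j) (\<Sigma> j)"
    and H0: "\<And>j c. c < p j \<Longrightarrow> \<mu> j c = \<mu>0 j c"
    and gamma_lt: "\<And>j. real (p j * k j) / real (n j) < 1"
    and gamma_lim: "(\<lambda>j. real (p j * k j) / real (n j)) \<longlonglongrightarrow> r"
    and r_nonneg: "0 \<le> r" and r_lt: "r < 1"
    and n_lim: "filterlim n at_top sequentially"
    and nl_lim: "filterlim (\<lambda>j. real (n j) / real (k j)) at_top sequentially"
    and k_lim: "filterlim k at_top sequentially"
  shows "weak_conv_m
     (\<lambda>j. distr (M j) borel
        (\<lambda>\<omega>. sqrt (real (k j)) *
           (T2_dis (p j) (k j) (S j) (\<mu>0 j) (\<lambda>i. X j i \<omega>)
            - (real (n j) / real (k j) - 1) * sqrt (real (p j))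
              / (real (n j) / real (k j) - real (p j) - 2))))
     (density lborel (normal_density 0 (sqrt (2 / (1 - r) ^ 3))))"
proof -
  define m where "m j = n j div k j" for j
  \<comment> \<open>Divisibility makes the natural-number quotient \<open>m j\<close> exact, so the
    real quotient in the statement is the size of each block.\<close>
  have nm: "real (n j) / real (k j) = real (m j)" for j
    using k_dvd[of j] by (simp add: m_def real_of_nat_div)
  have "real (p j * k j) / real (n j) = real (p j) / real (m j)" for j
    using k_pos[of j] by (simp add: nm[symmetric] divide_simps)
  with gamma_lim have pm_lim: "(\<lambda>j. real (p j) / real (m j)) \<longlonglongrightarrow> r" by simp
  have m_lim: "filterlim (\<lambda>j. real (m j)) at_top sequentially" using nl_lim unfolding nm .
  note lims = moment_limits[OF m_lim pm_lim r_lt]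
  obtain C where C: "\<forall>\<^sub>F j in sequentially.
      8 * (60 * real (m j) ^ 4 / ((real (m j) - real (p j) - 2) * (real (m j) - real (p j) - 2 - 2) *
        (real (m j) - real (p j) - 2 - 4) * (real (m j) - real (p j) - 2 - 6)) +
      12 * real (m j) ^ 6 * (real (m j) - real (p j) - 2 + 12) / ((real (m j) - real (p j) - 2) ^ 4 *
        (real (m j) - real (p j) - 2 - 2) * (real (m j) - real (p j) - 2 - 4) * (real (m j) - real (p j) - 2 - 6))) \<le> C"
    using lims(2) by blast
  \<comment> \<open>The centring of \<open>T\<^sup>2 / sqrt p\<close> for one machine:
    \<open>(m - 1) / sqrt p\<close> times the mean \<open>p / (m - p - 2)\<close> of the chi-square
    ratio.\<close>
  define a where "a j = (real (m j) - 1) * sqrt (real (p j)) / (real (m j) - real (p j) - 2)" for j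
  define T where "T j l \<omega> = hotelling_T2 (p j) (S j l) (\<mu>0 j) (\<lambda>i. X j i \<omega>)" for j l \<omega>
  define Y where "Y j l \<omega> = T j l \<omega> / sqrt (real (p j)) - a j" for j l \<omega>
  define \<nu> where "\<nu> j = distr (std_gauss (m j)) borel (centred_ratio (m j) (p j))" for j
  define N where "N j = real (m j) - real (p j) - 2" for j
  define s where "s j = 2 * (real (m j) - 1)\<^sup>2 * (real (m j) - 2) / ((N j)\<^sup>2 * (N j - 2))" for j
  \<comment> \<open>Only such \<open>j\<close> meet the hypotheses of the moment lemmas; the
    finitely many others do not affect the limit.\<close>
  have large: "\<forall>\<^sub>F j in sequentially. p j < m j \<and> real (m j) - real (p j) > 8"
    using lims(3) by eventually_elim auto
  note mom = centred_ratio_moments[where p = "p j" and m = "m j" for j, OF p_pos, folded \<nu>_def N_def]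
  have statistic: "sqrt (real (k j)) * (T2_dis (p j) (k j) (S j) (\<mu>0 j) (\<lambda>i. X j i \<omega>)
            - (real (n j) / real (k j) - 1) * sqrt (real (p j)) / (real (n j) / real (k j) - real (p j) - 2))
      = (\<Sum>l<k j. Y j l \<omega>) / sqrt (real (k j))" for j \<omega>
  proof -
    define t where "t = (\<Sum>l<k j. T j l \<omega>)"
    \<comment> \<open>Writing \<open>k\<close> as \<open>R * R\<close> reduces the quotient of
      \<open>sqrt k\<close> and \<open>k\<close> in the statistic to field arithmetic.\<close>
    define R where "R = sqrt (real (k j))"
    have R: "R > 0" "real (k j) = R * R" using k_pos[of j] by (simp_all add: R_def)
    have sum: "(\<Sum>l<k j. Y j l \<omega>) = t / sqrt (real (p j)) - (R * R) * a j"
      by (simp add: Y_def sum_subtractf sum_divide_distrib[symmetric] t_def R(2)[symmetric])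
    have "R * (t / (R * R * sqrt (real (p j))) - a j) = (t / sqrt (real (p j)) - (R * R) * a j) / R"
      using R(1) p_pos[of j] by (simp add: field_simps)
    then show ?thesis
      unfolding nm sum a_def[symmetric] T2_dis_def R_def[symmetric] t_def T_def unfolding R(2) .
  qed
  have "weak_conv_m (\<lambda>j. distr (M j) borel (\<lambda>\<omega>. (\<Sum>l<k j. Y j l \<omega>) / sqrt (real (k j))))
    (density lborel (normal_density 0 (sqrt (2 / (1 - r) ^ 3))))"
  proof (rule triangular_clt[where \<nu> = \<nu> and s = s and C = C, OF prob _ _ _ k_pos k_lim])
    fix j
    interpret prob_space "M j" by (rule prob)
    interpret G: prob_space "std_gauss (m j)" by (rule prob_space_std_gauss)
    have "indep_vars (\<lambda>_. borel) (T j) {..<k j}"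
      unfolding T_def[abs_def]
      by (rule indep_vars_hotelling_T2[OF indep]) (use part_sub part_disj in \<open>auto simp: disjoint_family_on_def\<close>)
    then have "indep_vars (\<lambda>_. borel) (\<lambda>l \<omega>. (\<lambda>x. x / sqrt (real (p j)) - a j) (T j l \<omega>)) {..<k j}"
      by (rule indep_vars_compose2) auto
    then show "indep_vars (\<lambda>_. borel) (Y j) {..<k j}" by (simp add: Y_def[abs_def])
    show "real_distribution (\<nu> j)"
      unfolding \<nu>_def by (rule G.real_distribution_distr[OF measurable_centred_ratio])
  next
    show "\<forall>\<^sub>F j in sequentially. \<forall>l<k j. distr (M j) borel (Y j l) = \<nu> j"
      using large
    proof eventually_elim
      case (elim j)
      then have pm: "p j < m j" by simp
      interpret prob_space "M j" by (rule prob)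
      show ?case
      proof (intro allI impI)
        fix l assume l: "l < k j"
        have fin: "finite (S j l)" using part_sub[OF l] finite_subset by blast
        let ?G = "\<lambda>g. (real (m j) - 1) * ((\<Sum>d<p j. (g d)\<^sup>2) / (\<Sum>d\<in>{p j..<m j}. (g d)\<^sup>2)) :: real"
        let ?\<Phi> = "\<lambda>x. x / sqrt (real (p j)) - a j"
        have TG: "distr (M j) borel (T j l) = distr (std_gauss (m j)) borel ?G"
          unfolding T_def[abs_def]
        proof (rule distr_hotelling_T2[OF indep_vars_subset[OF indep part_sub[OF l]] _ Sigma_pd fin _ pm H0])
          show "mvnormal (M j) (p j) (X j i) (\<mu> j) (\<Sigma> j)" if "i \<in> S j l" for i
            using that part_sub[OF l] by (intro gauss) auto
          show "card (S j l) = m j" using part_card[OF l] by (simp add: m_def)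
        qed
        have Tm: "T j l \<in> borel_measurable (M j)"
          unfolding T_def[abs_def]
          by (intro measurable_hotelling_T2 measurable_coordinate)
            (use indep[of j] part_sub[OF l] in \<open>auto simp: indep_vars_def2\<close>)
        have Gm: "?G \<in> borel_measurable (std_gauss (m j))"
          by (intro borel_measurable_times borel_measurable_const borel_measurable_divide borel_measurable_sum
              borel_measurable_power measurable_std_gauss_component)
        have "distr (M j) borel (Y j l) = distr (distr (M j) borel (T j l)) borel ?\<Phi>"
          using Tm by (subst distr_distr) (auto simp: comp_def Y_def[abs_def])
        also have "\<dots> = distr (std_gauss (m j)) borel (\<lambda>g. ?\<Phi> (?G g))"
          unfolding TG using Gm by (subst distr_distr) (auto simp: comp_def)
        also have "(\<lambda>g. ?\<Phi> (?G g)) = centred_ratio (m j) (p j)"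
        proof
          fix g
          \<comment> \<open>Rewriting \<open>sqrt p\<close> as \<open>p / sqrt p\<close> extracts
            from \<open>a j\<close> the prefactor \<open>(m - 1) / sqrt p\<close> of
            \<open>centred_ratio\<close>.\<close>
          have "sqrt (real (p j)) = real (p j) / sqrt (real (p j))"
            using p_pos[of j] by (simp add: real_div_sqrt)
          then have "a j = (real (m j) - 1) / sqrt (real (p j)) * (real (p j) / (real (m j) - real (p j) - 2))"
            unfolding a_def by (metis (no_types, lifting) mult.commute times_divide_eq_left times_divide_eq_right)
          then show "?\<Phi> (?G g) = centred_ratio (m j) (p j) g"
            by (simp add: centred_ratio_def right_diff_distrib)
        qed
        finally show "distr (M j) borel (Y j l) = \<nu> j" by (simp add: \<nu>_def)
      qed
    qed
    show "\<forall>\<^sub>F j in sequentially. integrable (\<nu> j) (\<lambda>x. x) \<and> (\<integral>x. x \<partial>\<nu> j) = 0"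
      using large by eventually_elim (use mom(1,2) in auto)
    show "\<forall>\<^sub>F j in sequentially. integrable (\<nu> j) (\<lambda>x. x\<^sup>2) \<and> (\<integral>x. x\<^sup>2 \<partial>\<nu> j) = s j"
      using large by eventually_elim (use mom(3,4) in \<open>auto simp: s_def\<close>)
    show "\<forall>\<^sub>F j in sequentially. integrable (\<nu> j) (\<lambda>x. x ^ 4) \<and> (\<integral>x. x ^ 4 \<partial>\<nu> j) \<le> C"
      using large C[folded N_def] by eventually_elim (use mom(5) order_trans[OF mom(6)] in blast)
    show "s \<longlonglongrightarrow> (sqrt (2 / (1 - r) ^ 3))\<^sup>2"
      using lims(1) r_lt by (simp add: s_def[abs_def] N_def)
    show "sqrt (2 / (1 - r) ^ 3) > 0" using r_lt by simp
  qed
  then show ?thesis unfolding statistic .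
qed

end
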